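(* For any $1<\xi<\lambda^+$, the boldface pointclass $\boldsymbol{\Sigma}^0_\xi$ has the ordinal $\lambda$-uniformization property, and thus the $\lambda$-reduction property, but it does not have the $\lambda$-separation property. The class $\boldsymbol{\Pi}^0_\xi$ has the $\lambda$-separation property, but not the $\lambda$-reduction property. The same is true for $\xi=1$ if either $\mu>\omega$, or $\mu=\omega$ and the properties are taken with respect to the class of spaces $X\in\mathscr{M}_\lambda$ with $\dim(X)=0$ (equivalently, ultrametrizable spaces of weight at most $\lambda$) instead of all of $\mathscr{M}_\lambda$.
   Context: Work in ZFC. $\lambda$ is an uncountable cardinal with $2^{<\lambda}=\lambda$, $\mu=\operatorname{cof}(\lambda)$. All spaces are regular Hausdorff. $\mathbb{G}=\mathbb{R}$ if $\mu=\omega$, otherwise a fixed ordered field with $\mathbb{G}^+$ of coinitiality $\mu$. A space is $\mu$-metrizable if its topology is induced by a $\mathbb{G}$-valued metric; $\mathscr{M}_\lambda$ is the class of $\mu$-metrizable spaces of weight $\le\lambda$. $\boldsymbol{\Sigma}^0_1(X)$ = open sets; for $1<\xi<\lambda^+$, $\boldsymbol{\Sigma}^0_\xi(X)$ = all unions $\bigcup_{i<\lambda}A_i$ with $X\setminus A_i\in\bigcup_{\xi'<\xi}\boldsymbol{\Sigma}^0_{\xi'}(X)$; $\boldsymbol{\Pi}^0_\xi(X)$ = complements of $\boldsymbol{\Sigma}^0_\xi(X)$-sets; $\boldsymbol{\Delta}^0_\xi=\boldsymbol{\Sigma}^0_\xi\cap\boldsymbol{\Pi}^0_\xi$. For a pointclass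 $\boldsymbol\Gamma$, $\boldsymbol\Delta_{\boldsymbol\Gamma}(X)=\boldsymbol\Gamma(X)\cap\{X\setminus A\mid A\in\boldsymbol\Gamma(X)\}$. Here $\lambda$ carries the discrete topology and $X\times\lambda$ the product topology. $\boldsymbol\Gamma$ has the $\lambda$-separation property if for every $X\in\mathscr{M}_\lambda$ and every sequence $(A_i)_{i<\lambda}$ of sets in $\boldsymbol\Gamma(X)$ with $\bigcap_{i<\lambda}A_i=\emptyset$ there are $B_i\in\boldsymbol\Delta_{\boldsymbol\Gamma}(X)$ with $A_i\subseteq B_i$ for all $i$ and $\bigcap_{i<\lambda}B_i=\emptyset$. $\boldsymbol\Gamma$ has the $\lambda$-reduction property if for every $X\in\mathscr{M}_\lambda$ and every sequence $(A_i)_{i<\lambda}$ in $\boldsymbol\Gamma(X)$ there are pairwise disjoint $A_i^*\in\boldsymbol\Gamma(X)$ with $A_i^*\subseteq A_i$ and $\bigcup_i A_i^*=\bigcup_i A_i$. $\boldsymbol\Gamma$ has the ordinal $\lambda$-uniformization property if for every $X\in\mathscr{M}_\lambda$ and every $R\in\boldsymbol\Gamma(X\times\lambda)$ there is $R^*\in\boldsymbol\Gamma(X\times\lambda)$, $R^*\subseteq R$, such that for every $x\in X$: $\exists\gamma\,(x,\gamma)\in R$ iff there is exactly one $\gamma$ with $(x,\gamma)\in R^*$. *)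

theory Defs
  imports "HOL-Analysis.Analysis"
begin

unbundle cardinal_syntax
no_notation elt_set_eq (infix \<open>=o\<close> 50)

section \<open>Cardinals\<close>

definition min_card :: "('a set \<Rightarrow> bool) \<Rightarrow> 'a rel" where
  "min_card P = |SOME A. P A \<and> (\<forall>B. P B \<longrightarrow> |A| \<le>o |B| )|"

lemma min_card_attained:
  assumes "P A0"
  shows "\<exists>A. P A \<and> min_card P = |A| \<and> (\<forall>B. P B \<longrightarrow> |A| \<le>o |B| )"
proof -
  have "\<exists>r \<in> card_of ` Collect P. \<forall>r' \<in> card_of ` Collect P. r \<le>o r'"
    by (rule exists_minim_Card_order) (use assms in \<open>auto simp: card_of_Card_order\<close>)
  then have "\<exists>A. P A \<and> (\<forall>B. P B \<longrightarrow> |A| \<le>o |B| )" by auto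
  from someI_ex[OF this] show ?thesis unfolding min_card_def by blast
qed

definition cof :: "'l rel \<Rightarrow> 'l rel" where
  "cof r = min_card (\<lambda>A. A \<subseteq> Field r \<and> cofinal A r)"

text \<open>The cardinality of the set of binary sequences of length \<open>< \<lambda>\<close>. A sequence is a partial
  map whose domain is a proper initial segment of \<open>\<lambda>\<close>.\<close>

definition two_pow_less :: "'l rel \<Rightarrow> ('l \<rightharpoonup> bool) rel" where
  "two_pow_less r = |{s. \<exists>a \<in> Field r. dom s = underS r a}|"

definition pos_coinitiality :: "'g::linordered_field itself \<Rightarrow> 'g rel" where
  "pos_coinitiality _ = min_card (\<lambda>C. C \<subseteq> {0<..} \<and> (\<forall>x>0. \<exists>c\<in>C. c \<le> x))"

text \<open>The ordinals below \<open>\<lambda>\<^sup>+\<close>, where \<open>\<lambda>\<close> is the cardinality of the type \<open>'l\<close>.\<close>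

typedef 'l succ_ord = "Field (cardSuc |UNIV :: 'l set| )"
  by (metis Field_cardSuc_not_empty card_of_Card_order ex_in_conv)

instantiation succ_ord :: (type) ord
begin

definition less_eq_succ_ord :: "'a succ_ord \<Rightarrow> 'a succ_ord \<Rightarrow> bool" where
  "x \<le> y \<longleftrightarrow> (Rep_succ_ord x, Rep_succ_ord y) \<in> cardSuc |UNIV :: 'a set|"

definition less_succ_ord :: "'a succ_ord \<Rightarrow> 'a succ_ord \<Rightarrow> bool" where
  "x < y \<longleftrightarrow> x \<le> y \<and> \<not> y \<le> (x :: 'a succ_ord)"

instance ..

end

instance succ_ord :: (type) wellorder
proof -
  let ?r = "cardSuc |UNIV :: 'a set|"
  have wo: "Well_order ?r" by (rule cardSuc_Well_order[OF card_of_Card_order])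
  then have refl: "refl_on (Field ?r) ?r" and tr: "trans ?r" and an: "antisym ?r"
    and tot: "total_on (Field ?r) ?r" and wf: "wf (?r - Id)"
    by (auto simp: well_order_on_def linear_order_on_def partial_order_on_def preorder_on_def)
  note d = less_eq_succ_ord_def less_succ_ord_def
  show "OFCLASS('a succ_ord, wellorder_class)"
  proof
    fix x y z :: "'a succ_ord"
    show "x \<le> x" using refl Rep_succ_ord[of x] by (auto simp: d refl_on_def)
    show "x \<le> y \<Longrightarrow> y \<le> z \<Longrightarrow> x \<le> z" using tr unfolding d trans_def by blast
    show as: "x \<le> y \<Longrightarrow> y \<le> x \<Longrightarrow> x = y"
      using an unfolding d antisym_def by (meson Rep_succ_ord_inject)
    show "x < y \<longleftrightarrow> x \<le> y \<and> \<not> y \<le> x"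
      using an Rep_succ_ord_inject refl Rep_succ_ord[of x] unfolding d antisym_def refl_on_def by metis
    show "x \<le> y \<or> y \<le> x"
      using tot refl Rep_succ_ord[of x] Rep_succ_ord[of y] unfolding d total_on_def refl_on_def by metis
  next
    fix P :: "'a succ_ord \<Rightarrow> bool" and a
    assume step: "\<And>x. (\<And>y. y < x \<Longrightarrow> P y) \<Longrightarrow> P x"
    have eq: "{(x :: 'a succ_ord, y). x < y} = inv_image (?r - Id) Rep_succ_ord"
      using an by (auto simp: d inv_image_def Rep_succ_ord_inject dest: antisymD)
    have "wf {(x :: 'a succ_ord, y). x < y}" unfolding eq using wf by (rule wf_inv_image)
    then show "P a" by (induction a rule: wf_induct_rule) (use step in auto)
  qed
qed

instantiation succ_ord :: (type) "{zero, one}"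
begin

definition zero_succ_ord :: "'a succ_ord" where "0 = (LEAST x :: 'a succ_ord. True)"

definition one_succ_ord :: "'a succ_ord" where "1 = (LEAST x :: 'a succ_ord. 0 < x)"

instance ..

end

section \<open>Spaces\<close>

definition weight :: "'a topology \<Rightarrow> 'a set rel" where
  "weight X = min_card (\<lambda>\<B>. (\<forall>V\<in>\<B>. openin X V) \<and>
     (\<forall>U x. openin X U \<and> x \<in> U \<longrightarrow> (\<exists>V\<in>\<B>. x \<in> V \<and> V \<subseteq> U)))"

definition G_metric :: "'a set \<Rightarrow> ('a \<Rightarrow> 'a \<Rightarrow> 'g::linordered_field) \<Rightarrow> bool" where
  "G_metric M d \<longleftrightarrow>
     (\<forall>x\<in>M. \<forall>y\<in>M. 0 \<le> d x y \<and> (d x y = 0 \<longleftrightarrow> x = y) \<and> d x y = d y x) \<and>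
     (\<forall>x\<in>M. \<forall>y\<in>M. \<forall>z\<in>M. d x z \<le> d x y + d y z)"

definition G_metrizable_space :: "'g::linordered_field itself \<Rightarrow> 'a topology \<Rightarrow> bool" where
  "G_metrizable_space _ X \<longleftrightarrow>
     (\<exists>d :: 'a \<Rightarrow> 'a \<Rightarrow> 'g. G_metric (topspace X) d \<and>
        (\<forall>U. openin X U \<longleftrightarrow> U \<subseteq> topspace X \<and>
           (\<forall>x\<in>U. \<exists>e>0. \<forall>y\<in>topspace X. d x y < e \<longrightarrow> y \<in> U)))"

text \<open>For \<open>\<mu> = \<omega>\<close> the distances are real; \<open>'g\<close> only matters for uncountable \<open>\<mu>\<close>.\<close>

definition mu_metrizable_space ::
  "'l rel \<Rightarrow> 'g::linordered_field itself \<Rightarrow> 'a topology \<Rightarrow> bool" where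
  "mu_metrizable_space lam G X \<longleftrightarrow>
     (if cof lam =o natLeq then metrizable_space X else G_metrizable_space G X)"

definition M_class :: "'l rel \<Rightarrow> 'g::linordered_field itself \<Rightarrow> 'a topology set" where
  "M_class lam G = {X. regular_space X \<and> Hausdorff_space X \<and>
     mu_metrizable_space lam G X \<and> weight X \<le>o lam}"

text \<open>Spaces in \<open>M_class\<close> live on subsets of a fixed type. Every such space has at most
  \<open>2\<^sup>\<lambda>\<close> points, so a type with at least \<open>2\<^sup>\<lambda>\<close> elements carries all of them up to
  homeomorphism.\<close>

lemma M_class_representable:
  fixes X :: "'a topology" and lam :: "'l rel"
  assumes lam: "card_order lam" and X: "X \<in> M_class lam TYPE('g::linordered_field)"
    and big: "|UNIV :: 'l set set| \<le>o |UNIV :: 'u set|"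
  shows "\<exists>Y :: 'u topology. X homeomorphic_space Y"
proof -
  let ?P = "\<lambda>\<B>. (\<forall>V\<in>\<B>. openin X V) \<and>
     (\<forall>U x. openin X U \<and> x \<in> U \<longrightarrow> (\<exists>V\<in>\<B>. x \<in> V \<and> V \<subseteq> U))"
  have "?P {U. openin X U}" by auto
  from min_card_attained[of ?P, OF this] obtain \<B> where \<B>: "?P \<B>" and w: "weight X = |\<B>|"
    unfolding weight_def by blast
  have "|\<B>| \<le>o lam" using X w by (simp add: M_class_def)
  also have "lam =o |UNIV :: 'l set|" using lam
    by (metis Card_order_iff_ordIso_card_of card_order_on_Card_order)
  finally obtain k :: "'a set \<Rightarrow> 'l" where "inj_on k \<B>"
    using card_of_ordLeq[of \<B> "UNIV :: 'l set"] by auto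
  then have "inj_on ((`) k) (Pow \<B>)" by (rule inj_on_image_Pow)
  then have "|Pow \<B>| \<le>o |UNIV :: 'l set set|"
    using card_of_ordLeq[of "Pow \<B>" "UNIV :: 'l set set"] by blast
  then have "|Pow \<B>| \<le>o |UNIV :: 'u set|" using big by (rule ordLeq_transitive)
  then obtain g :: "'a set set \<Rightarrow> 'u" where g: "inj_on g (Pow \<B>)"
    using card_of_ordLeq[of "Pow \<B>" "UNIV :: 'u set"] by auto
  define f where "f x = g {V\<in>\<B>. x \<in> V}" for x
  have inj: "inj_on f (topspace X)"
  proof (rule inj_onI, rule ccontr)
    fix x y assume xy: "x \<in> topspace X" "y \<in> topspace X" "f x = f y" "x \<noteq> y"
    have eq: "{V\<in>\<B>. x \<in> V} = {V\<in>\<B>. y \<in> V}"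
      using g xy(3) unfolding f_def by (auto dest!: inj_onD)
    have "Hausdorff_space X" using X by (simp add: M_class_def)
    then obtain U W where UW: "openin X U" "x \<in> U" "y \<in> W" "disjnt U W"
      using xy unfolding Hausdorff_space_def by blast
    then obtain V where "V \<in> \<B>" "x \<in> V" "V \<subseteq> U" using \<B> by blast
    then show False using eq UW by (auto simp: disjnt_def)
  qed
  define h where "h = inv_into (topspace X) f"
  define Y where "Y = pullback_topology (f ` topspace X) h X"
  have h: "h (f x) = x" if "x \<in> topspace X" for x using inj that by (simp add: h_def)
  have tY: "topspace Y = f ` topspace X" unfolding Y_def topspace_pullback_topology using h by auto
  have "continuous_map Y X h" unfolding Y_def using continuous_map_pullback[of X X id] by simp
  moreover have "continuous_map X Y f"
    unfolding Y_def
    by (rule continuous_map_pullback') (auto intro: continuous_map_eq[OF continuous_map_id] simp: h)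
  ultimately have "homeomorphic_maps X Y f h" unfolding homeomorphic_maps_def using h tY by auto
  then show ?thesis unfolding homeomorphic_space_def by blast
qed

text \<open>Lebesgue covering dimension. The empty space gets dimension 0 instead of \<open>-1\<close>.\<close>

definition covering_dim_le :: "'a topology \<Rightarrow> nat \<Rightarrow> bool" where
  "covering_dim_le X n \<longleftrightarrow>
     (\<forall>\<U>. finite \<U> \<and> (\<forall>U\<in>\<U>. openin X U) \<and> \<Union>\<U> = topspace X \<longrightarrow>
        (\<exists>\<V>. finite \<V> \<and> (\<forall>V\<in>\<V>. openin X V \<and> (\<exists>U\<in>\<U>. V \<subseteq> U)) \<and> \<Union>\<V> = topspace X \<and>
           (\<forall>x\<in>topspace X. card {V\<in>\<V>. x \<in> V} \<le> n + 1)))"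

definition covering_dim :: "'a topology \<Rightarrow> enat" where
  "covering_dim X = (INF n \<in> {n. covering_dim_le X n}. enat n)"

definition ultrametrizable_space :: "'a topology \<Rightarrow> bool" where
  "ultrametrizable_space X \<longleftrightarrow>
     (\<exists>M d. Metric_space M d \<and> (\<forall>x\<in>M. \<forall>y\<in>M. \<forall>z\<in>M. d x z \<le> max (d x y) (d y z)) \<and>
        X = Metric_space.mtopology M d)"

section \<open>Pointclasses\<close>

type_synonym 'a pointclass = "'a topology \<Rightarrow> 'a set set"

text \<open>There is no class at index 0, so \<open>\<xi>' < \<xi>\<close> in the second rule means \<open>1 \<le> \<xi>' < \<xi>\<close>.\<close>

inductive is_Sigma0 :: "'a topology \<Rightarrow> 'l succ_ord \<Rightarrow> 'a set \<Rightarrow> bool" for X where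
  is_Sigma0_one: "openin X U \<Longrightarrow> is_Sigma0 X 1 U"
| is_Sigma0_union: "1 < \<xi> \<Longrightarrow>
    (\<And>i :: 'l. A i \<subseteq> topspace X \<and> (\<exists>\<xi>'<\<xi>. is_Sigma0 X \<xi>' (topspace X - A i))) \<Longrightarrow>
    is_Sigma0 X \<xi> (\<Union>i. A i)"

definition Sigma0 :: "'l succ_ord \<Rightarrow> 'a pointclass" where
  "Sigma0 \<xi> X = {A. is_Sigma0 X \<xi> A}"

lemma Sigma0_1: "Sigma0 1 X = {U. openin X U}"
  unfolding Sigma0_def by (auto intro: is_Sigma0_one elim: is_Sigma0.cases)

lemma Sigma0_gt_1:
  fixes \<xi> :: "'l succ_ord"
  assumes "1 < \<xi>"
  shows "Sigma0 \<xi> X = {\<Union>i. A i | A :: 'l \<Rightarrow> _.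
    \<forall>i. A i \<subseteq> topspace X \<and> topspace X - A i \<in> (\<Union>\<xi>'\<in>{1..<\<xi>}. Sigma0 \<xi>' X)}"
proof -
  have ge1: "1 \<le> \<eta>" if "is_Sigma0 X \<eta> B" for \<eta> :: "'l succ_ord" and B
    using that by (auto elim: is_Sigma0.cases)
  show ?thesis
  proof (intro set_eqI iffI)
    fix B assume "B \<in> Sigma0 \<xi> X"
    then have "is_Sigma0 X \<xi> B" by (simp add: Sigma0_def)
    then show "B \<in> {\<Union>i. A i | A :: 'l \<Rightarrow> _.
      \<forall>i. A i \<subseteq> topspace X \<and> topspace X - A i \<in> (\<Union>\<xi>'\<in>{1..<\<xi>}. Sigma0 \<xi>' X)}"
      using assms by cases (auto simp: Sigma0_def dest: ge1, metis atLeastLessThan_iff ge1)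
  next
    fix B assume "B \<in> {\<Union>i. A i | A :: 'l \<Rightarrow> _.
      \<forall>i. A i \<subseteq> topspace X \<and> topspace X - A i \<in> (\<Union>\<xi>'\<in>{1..<\<xi>}. Sigma0 \<xi>' X)}"
    then obtain A :: "'l \<Rightarrow> _" where B: "B = (\<Union>i. A i)"
      and "\<And>i. A i \<subseteq> topspace X \<and> topspace X - A i \<in> (\<Union>\<xi>'\<in>{1..<\<xi>}. Sigma0 \<xi>' X)"
      by blast
    then have "A i \<subseteq> topspace X \<and> (\<exists>\<xi>'<\<xi>. is_Sigma0 X \<xi>' (topspace X - A i))" for i
      by (simp add: Sigma0_def) (meson atLeastLessThan_iff)
    then show "B \<in> Sigma0 \<xi> X"
      unfolding Sigma0_def B mem_Collect_eq using assms by (intro is_Sigma0_union)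
  qed
qed

definition Pi0 :: "'l succ_ord \<Rightarrow> 'a pointclass" where
  "Pi0 \<xi> X = {topspace X - A | A. A \<in> Sigma0 \<xi> X}"

definition Delta_of :: "'a pointclass \<Rightarrow> 'a pointclass" where
  "Delta_of \<Gamma> X = \<Gamma> X \<inter> {topspace X - A | A. A \<in> \<Gamma> X}"

text \<open>The three properties with respect to a class \<open>\<C>\<close> of spaces; \<open>\<lambda>\<close> is the cardinality
  of \<open>'l\<close>, whose elements index the sequences.\<close>

definition separation_property ::
  "'l itself \<Rightarrow> 'a topology set \<Rightarrow> 'a pointclass \<Rightarrow> bool" where
  "separation_property _ \<C> \<Gamma> \<longleftrightarrow>
     (\<forall>X\<in>\<C>. \<forall>A :: 'l \<Rightarrow> 'a set. (\<forall>i. A i \<in> \<Gamma> X) \<and> (\<Inter>i. A i) = {} \<longrightarrow>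
        (\<exists>B :: 'l \<Rightarrow> 'a set. (\<forall>i. B i \<in> Delta_of \<Gamma> X \<and> A i \<subseteq> B i) \<and> (\<Inter>i. B i) = {}))"

definition reduction_property ::
  "'l itself \<Rightarrow> 'a topology set \<Rightarrow> 'a pointclass \<Rightarrow> bool" where
  "reduction_property _ \<C> \<Gamma> \<longleftrightarrow>
     (\<forall>X\<in>\<C>. \<forall>A :: 'l \<Rightarrow> 'a set. (\<forall>i. A i \<in> \<Gamma> X) \<longrightarrow>
        (\<exists>A' :: 'l \<Rightarrow> 'a set. (\<forall>i. A' i \<in> \<Gamma> X \<and> A' i \<subseteq> A i) \<and>
           (\<forall>i j. i \<noteq> j \<longrightarrow> A' i \<inter> A' j = {}) \<and> (\<Union>i. A' i) = (\<Union>i. A i)))"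

definition ordinal_uniformization_property ::
  "'a topology set \<Rightarrow> ('a \<times> 'l) pointclass \<Rightarrow> bool" where
  "ordinal_uniformization_property \<C> \<Gamma> \<longleftrightarrow>
     (\<forall>X\<in>\<C>. \<forall>R \<in> \<Gamma> (prod_topology X (discrete_topology UNIV)).
        \<exists>R' \<in> \<Gamma> (prod_topology X (discrete_topology UNIV)). R' \<subseteq> R \<and>
          (\<forall>x\<in>topspace X. (\<exists>\<gamma>. (x, \<gamma>) \<in> R) \<longleftrightarrow> (\<exists>!\<gamma>. (x, \<gamma>) \<in> R')))"

end

theory Submission
  imports Defs
begin

text \<open>
  Given sets \<open>A\<^sub>k\<close> (\<open>k < \<lambda>\<close>) with \<open>A\<^sub>k\<close> in \<open>\<Pi>\<close> of level \<open>rk k < \<xi>\<close>, order the indices by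
  \<open>(rk k, k)\<close> and subtract from each \<open>A\<^sub>k\<close> all earlier ones. The earlier sets of smaller level have
  a union in \<open>\<Sigma>\<close> of level \<open>rk k\<close>; those of the same level are fewer than \<open>\<lambda>\<close> many. So reduction for
  \<open>\<Sigma>\<close> of level \<open>\<xi> > 1\<close> rests on the claim that an intersection of fewer than \<open>\<lambda>\<close> many \<open>\<Sigma>\<close> sets
  of level \<open>\<eta>\<close> is a \<open>\<Sigma>\<close> set of every level above \<open>\<eta>\<close>. By induction on \<open>\<eta>\<close>, all \<open>\<Sigma>\<close> sets of
  level \<open>\<eta>\<close> are unions of \<open>\<Pi>\<close> sets of level \<open>\<eta>\<close> over one index set \<open>C\<close>, namely a cofinal set of
  least size in the order above (in \<open>\<lambda>\<close> itself for \<open>\<eta> = 1\<close>), and then \<open>2^(<\<lambda>) = \<lambda>\<close> bounds the number of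
  choice functions by \<open>\<lambda>\<close>. For \<open>\<xi> = 1\<close> the topology comes from a decreasing well-ordered family of
  equivalence relations, and each point joins the first set containing its first class that fits
  into one of the sets. Uniformization follows by taking sections, separation of \<open>\<Pi>\<close> by taking
  complements. Finally, universal sets on the generalized Cantor space and the usual diagonal
  argument turn reduction into a pair of disjoint \<open>\<Sigma>\<close> sets that no set in \<open>\<Delta>\<close> separates.
\<close>

section \<open>The Borel hierarchy of a topological space\<close>

text \<open>The obstacle is singular \<lambda>. Distributing an intersection of \<open>J\<close>
  many unions over \<lambda> produces one term for each function from \<open>J\<close> into
  \<lambda>, and by Koenig's theorem these are more than \<lambda> already when \<open>J\<close> has
  size \<mu>. Unions of initial segments increase, so a cofinal set \<open>C\<close> of indices is
  enough. If \<open>C\<close> is smaller than \<lambda>, the functions from \<open>J\<close> to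
  \<open>C\<close> are subsets of a small set and 2^(<\<lambda>) = \<lambda> counts them. If it is
  not, then \<lambda> is regular, because the least size of a cofinal set without last element is,
  and every function from \<open>J\<close> into \<lambda> is bounded. The order by level depends on
  the levels, so these must first be made the same for all sets of a class; only then can one
  \<open>C\<close> be chosen for all members of the intersection. The same uniformity lets one
  sequence of codes describe every set of a level, so that a single tree space serves the diagonal
  argument for all \<open>\<xi>\<close>.\<close>

lemma Sigma0_subset_topspace: "A \<in> Sigma0 \<xi> X \<Longrightarrow> A \<subseteq> topspace X"
  unfolding Sigma0_def by (auto elim!: is_Sigma0.cases dest: openin_subset)

lemma Sigma0_ge_1: "A \<in> Sigma0 \<xi> X \<Longrightarrow> 1 \<le> \<xi>"
  unfolding Sigma0_def by (auto elim!: is_Sigma0.cases)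

lemma Pi0_subset_topspace: "A \<in> Pi0 \<xi> X \<Longrightarrow> A \<subseteq> topspace X"
  unfolding Pi0_def by auto

lemma Pi0_iff: "A \<in> Pi0 \<xi> X \<longleftrightarrow> A \<subseteq> topspace X \<and> topspace X - A \<in> Sigma0 \<xi> X"
  unfolding Pi0_def using Sigma0_subset_topspace[of _ \<xi> X] by (auto simp: double_diff)

lemma Sigma0_compl_iff: "A \<in> Sigma0 \<xi> X \<longleftrightarrow> A \<subseteq> topspace X \<and> topspace X - A \<in> Pi0 \<xi> X"
  using Sigma0_subset_topspace[of A \<xi> X] by (auto simp: Pi0_iff double_diff)

lemma Pi0_1: "Pi0 1 X = {C. closedin X C}"
  by (auto simp: Pi0_iff Sigma0_1 closedin_def)

lemma Sigma0_iff_Pi0_union: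
  fixes \<xi> :: "'l succ_ord"
  assumes "1 < \<xi>"
  shows "B \<in> Sigma0 \<xi> X \<longleftrightarrow> (\<exists>A :: 'l \<Rightarrow> _. B = (\<Union>i. A i) \<and> (\<forall>i. \<exists>\<zeta><\<xi>. A i \<in> Pi0 \<zeta> X))"
proof -
  have "(A \<subseteq> topspace X \<and> topspace X - A \<in> (\<Union>\<zeta>\<in>{1..<\<xi>}. Sigma0 \<zeta> X)) \<longleftrightarrow> (\<exists>\<zeta><\<xi>. A \<in> Pi0 \<zeta> X)" for A
    by (auto simp: Pi0_iff simp: Bex_def intro: Sigma0_ge_1)
  then show ?thesis unfolding Sigma0_gt_1[OF assms] mem_Collect_eq by simp
qed

lemma Sigma0_union_ranked:
  fixes \<xi> :: "'l succ_ord"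
  assumes "1 < \<xi>" "B \<in> Sigma0 \<xi> X"
  shows "\<exists>(A :: 'l \<Rightarrow> _) z. B = (\<Union>i. A i) \<and> (\<forall>i. z i < \<xi>) \<and> (\<forall>i. A i \<in> Pi0 (z i) X)"
proof -
  have "\<exists>A :: 'l \<Rightarrow> _. B = (\<Union>i. A i) \<and> (\<forall>i. \<exists>\<zeta><\<xi>. A i \<in> Pi0 \<zeta> X)"
    using assms(2) unfolding Sigma0_iff_Pi0_union[OF assms(1)] .
  then obtain A :: "'l \<Rightarrow> _" where B: "B = (\<Union>i. A i)" and A: "\<forall>i. \<exists>\<zeta>. \<zeta> < \<xi> \<and> A i \<in> Pi0 \<zeta> X"
    by (elim exE conjE) (rule that)
  from choice[OF A] obtain z where "\<forall>i. z i < \<xi> \<and> A i \<in> Pi0 (z i) X" ..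
  then show ?thesis using B by (intro exI[of _ A] exI[of _ z]) simp
qed

lemma empty_in_Pi0_one: "{} \<in> Pi0 1 X" by (simp add: Pi0_1)

lemma empty_in_Sigma0: "1 \<le> \<xi> \<Longrightarrow> {} \<in> Sigma0 \<xi> X"
proof (cases "\<xi> = 1")
  case False
  moreover assume "1 \<le> \<xi>"
  ultimately have "1 < \<xi>" by simp
  then show ?thesis unfolding Sigma0_iff_Pi0_union[OF \<open>1 < \<xi>\<close>]
    by (intro exI[of _ "\<lambda>_. {}"]) (auto intro: empty_in_Pi0_one)
qed (simp add: Sigma0_1)

lemma topspace_in_Sigma0: "1 \<le> \<xi> \<Longrightarrow> topspace X \<in> Sigma0 \<xi> X"
proof (cases "\<xi> = 1")
  case False
  moreover assume "1 \<le> \<xi>"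
  ultimately have "1 < \<xi>" by simp
  moreover have "topspace X \<in> Pi0 1 X" by (simp add: Pi0_1)
  ultimately show ?thesis unfolding Sigma0_iff_Pi0_union[OF \<open>1 < \<xi>\<close>] by (intro exI[of _ "\<lambda>_. topspace X"]) auto
qed (simp add: Sigma0_1)

lemma empty_in_Pi0: "1 \<le> \<xi> \<Longrightarrow> {} \<in> Pi0 \<xi> X"
  by (simp add: Pi0_iff topspace_in_Sigma0)

lemma Sigma0_continuous_preimage:
  fixes \<xi> :: "'l succ_ord"
  assumes f: "continuous_map X Y f"
  shows "A \<in> Sigma0 \<xi> Y \<Longrightarrow> {x \<in> topspace X. f x \<in> A} \<in> Sigma0 \<xi> X"
proof (induction \<xi> arbitrary: A rule: less_induct)
  case (less \<xi>)
  show ?case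
  proof (cases "\<xi> = 1")
    case True
    then show ?thesis using less.prems f by (auto simp: Sigma0_1 openin_continuous_map_preimage)
  next
    case False
    then have gt: "1 < \<xi>" using Sigma0_ge_1[OF less.prems] by simp
    then obtain B :: "'l \<Rightarrow> _" where B: "A = (\<Union>i. B i)" "\<And>i. \<exists>\<zeta><\<xi>. B i \<in> Pi0 \<zeta> Y"
      using less.prems by (auto simp: Sigma0_iff_Pi0_union)
    have "\<exists>\<zeta><\<xi>. {x \<in> topspace X. f x \<in> B i} \<in> Pi0 \<zeta> X" for i
    proof -
      obtain \<zeta> where \<zeta>: "\<zeta> < \<xi>" "B i \<in> Pi0 \<zeta> Y" using B(2) by blast
      have "{x \<in> topspace X. f x \<in> topspace Y - B i} \<in> Sigma0 \<zeta> X"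
        using less.IH[OF \<zeta>(1), of "topspace Y - B i"] \<zeta>(2) unfolding Pi0_iff by blast
      moreover have "{x \<in> topspace X. f x \<in> topspace Y - B i} = topspace X - {x \<in> topspace X. f x \<in> B i}"
        using continuous_map_image_subset_topspace[OF f] by auto
      ultimately show ?thesis using \<zeta>(1) by (auto simp: Pi0_iff)
    qed
    moreover have "{x \<in> topspace X. f x \<in> A} = (\<Union>i. {x \<in> topspace X. f x \<in> B i})"
      using B(1) by auto
    ultimately show ?thesis unfolding Sigma0_iff_Pi0_union[OF gt] by blast
  qed
qed

lemma Sigma0_Pi0_small_union:
  fixes \<xi> :: "'l succ_ord"
  assumes "1 < \<xi>" and "|S| \<le>o |UNIV :: 'l set|" and "\<And>s. s \<in> S \<Longrightarrow> \<exists>\<zeta><\<xi>. A s \<in> Pi0 \<zeta> X"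
  shows "(\<Union>s\<in>S. A s) \<in> Sigma0 \<xi> X"
proof -
  obtain k :: "_ \<Rightarrow> 'l" where k: "inj_on k S"
    using assms(2) card_of_ordLeq[of S "UNIV :: 'l set"] by auto
  \<comment> \<open>Indices outside the image of \<open>k\<close> contribute the empty set, which is
    closed and thus of level 1, below \<open>\<xi>\<close>.\<close>
  define B where "B i = (if i \<in> k ` S then A (inv_into S k i) else {})" for i
  have "(\<Union>s\<in>S. A s) = (\<Union>i. B i)"
    using k by (auto simp: B_def)
  moreover have "\<exists>\<zeta><\<xi>. B i \<in> Pi0 \<zeta> X" for i
    using assms(1,3) empty_in_Pi0_one[of X] by (auto simp: B_def inv_into_into)
  ultimately show ?thesis unfolding Sigma0_iff_Pi0_union[OF assms(1)] by blast
qed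

lemma Sigma0_small_union:
  fixes \<xi> :: "'l succ_ord"
  assumes inf: "infinite (UNIV :: 'l set)" and "1 \<le> \<xi>" and S: "|S| \<le>o |UNIV :: 'l set|"
    and A: "\<And>s. s \<in> S \<Longrightarrow> A s \<in> Sigma0 \<xi> X"
  shows "(\<Union>s\<in>S. A s) \<in> Sigma0 \<xi> X"
proof (cases "\<xi> = 1")
  case True
  then show ?thesis using A by (auto simp: Sigma0_1)
next
  case False
  then have gt: "1 < \<xi>" using assms by simp
  have "\<forall>s\<in>S. \<exists>B :: 'l \<Rightarrow> _. A s = (\<Union>i. B i) \<and> (\<forall>i. \<exists>\<zeta><\<xi>. B i \<in> Pi0 \<zeta> X)"
    using A gt by (simp add: Sigma0_iff_Pi0_union)
  then obtain B :: "_ \<Rightarrow> 'l \<Rightarrow> _" where B: "\<And>s. s \<in> S \<Longrightarrow> A s = (\<Union>i. B s i)"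
      "\<And>s i. s \<in> S \<Longrightarrow> \<exists>\<zeta><\<xi>. B s i \<in> Pi0 \<zeta> X"
    by metis
  have "|S \<times> (UNIV :: 'l set)| \<le>o |UNIV :: 'l set|"
    using inf S by (intro card_of_Sigma_ordLeq_infinite) (auto simp: card_of_refl[THEN ordIso_imp_ordLeq])
  then have "(\<Union>p\<in>S \<times> (UNIV :: 'l set). B (fst p) (snd p)) \<in> Sigma0 \<xi> X"
    using gt B(2) by (intro Sigma0_Pi0_small_union) auto
  moreover have "(\<Union>p\<in>S \<times> (UNIV :: 'l set). B (fst p) (snd p)) = (\<Union>s\<in>S. A s)"
    using B(1) by fastforce
  ultimately show ?thesis by simp
qed

lemma Pi0_small_inter:
  fixes \<xi> :: "'l succ_ord"
  assumes "infinite (UNIV :: 'l set)" and "1 \<le> \<xi>" and "|S| \<le>o |UNIV :: 'l set|"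
    and "\<And>s. s \<in> S \<Longrightarrow> A s \<in> Pi0 \<xi> X"
  shows "topspace X \<inter> (\<Inter>s\<in>S. A s) \<in> Pi0 \<xi> X"
proof -
  have "(\<Union>s\<in>S. topspace X - A s) \<in> Sigma0 \<xi> X"
    using assms by (intro Sigma0_small_union) (auto simp: Pi0_iff)
  moreover have "(\<Union>s\<in>S. topspace X - A s) = topspace X - topspace X \<inter> (\<Inter>s\<in>S. A s)" by auto
  ultimately show ?thesis by (simp add: Pi0_iff)
qed

lemma Sigma0_Un:
  fixes \<xi> :: "'l succ_ord"
  assumes inf: "infinite (UNIV :: 'l set)" and "A \<in> Sigma0 \<xi> X" "B \<in> Sigma0 \<xi> X"
  shows "A \<union> B \<in> Sigma0 \<xi> X"
proof -
  have "|UNIV :: bool set| \<le>o |UNIV :: 'l set|"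
    using inf by (intro ordLess_imp_ordLeq finite_ordLess_infinite) (auto simp: card_of_well_order_on Field_card_of)
  then have "(\<Union>b\<in>UNIV. if b then A else B) \<in> Sigma0 \<xi> X"
    using assms Sigma0_ge_1[of A \<xi> X] by (intro Sigma0_small_union) auto
  then show ?thesis by (simp add: UNIV_bool Un_commute)
qed

lemma Pi0_Int:
  fixes \<xi> :: "'l succ_ord"
  assumes "infinite (UNIV :: 'l set)" and "A \<in> Pi0 \<xi> X" "B \<in> Pi0 \<xi> X"
  shows "A \<inter> B \<in> Pi0 \<xi> X"
  using Sigma0_Un[OF assms(1), of "topspace X - A" \<xi> X "topspace X - B"] assms(2,3)
  by (auto simp: Pi0_iff Diff_Int)

lemma infinite_ex_distinct: "infinite (UNIV :: 'l set) \<Longrightarrow> \<exists>p q :: 'l. p \<noteq> q"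
  using finite_subset[of UNIV "{undefined :: 'l}"] by blast

text \<open>The inclusion of the open sets in level 2 is the one instance of monotonicity that
  depends on the space; from level 2 on it can be read off from the definition.\<close>

definition open_Fsigma :: "'l itself \<Rightarrow> 'a topology \<Rightarrow> bool" where
  "open_Fsigma _ X \<longleftrightarrow> (\<forall>U. openin X U \<longrightarrow> (\<exists>A :: 'l \<Rightarrow> _. U = (\<Union>i. A i) \<and> (\<forall>i. closedin X (A i))))"

lemma Sigma0_mono:
  fixes \<xi> \<zeta> :: "'l succ_ord"
  assumes X: "open_Fsigma TYPE('l) X" and "\<zeta> \<le> \<xi>" and A: "A \<in> Sigma0 \<zeta> X"
  shows "A \<in> Sigma0 \<xi> X"
proof (cases "\<zeta> = \<xi>")
  case False
  then have gt: "1 < \<xi>" using assms Sigma0_ge_1[OF A] by simp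
  show ?thesis
  proof (cases "\<zeta> = 1")
    case True
    then have "openin X A" using A by (simp add: Sigma0_1)
    then obtain B :: "'l \<Rightarrow> _" where "A = (\<Union>i. B i)" "\<And>i. closedin X (B i)"
      using X unfolding open_Fsigma_def by blast
    then show ?thesis unfolding Sigma0_iff_Pi0_union[OF gt]
      by (intro exI[of _ B]) (use gt in \<open>auto simp: Pi0_1 intro!: exI[of _ 1]\<close>)
  next
    case False
    then have "1 < \<zeta>" using Sigma0_ge_1[OF A] by simp
    then obtain B :: "'l \<Rightarrow> _" where "A = (\<Union>i. B i)" "\<And>i. \<exists>\<eta><\<zeta>. B i \<in> Pi0 \<eta> X"
      using A by (auto simp: Sigma0_iff_Pi0_union)
    moreover from this(2) have "\<exists>\<eta><\<xi>. B i \<in> Pi0 \<eta> X" for i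
      using assms(2) order_less_le_trans by blast
    ultimately show ?thesis unfolding Sigma0_iff_Pi0_union[OF gt] by blast
  qed
qed (use A in simp)

lemma Pi0_mono:
  fixes \<xi> \<zeta> :: "'l succ_ord"
  assumes "open_Fsigma TYPE('l) X" and "\<zeta> \<le> \<xi>" and "A \<in> Pi0 \<zeta> X"
  shows "A \<in> Pi0 \<xi> X"
  using Sigma0_mono[OF assms(1,2)] assms(3) by (simp add: Pi0_iff)

lemma Pi0_subset_Sigma0:
  fixes \<xi> \<zeta> :: "'l succ_ord"
  assumes "\<zeta> < \<xi>" and "A \<in> Pi0 \<zeta> X"
  shows "A \<in> Sigma0 \<xi> X"
proof -
  have "1 \<le> \<zeta>" using assms(2) by (auto simp: Pi0_iff dest: Sigma0_ge_1)
  then have "1 < \<xi>" using assms(1) by simp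
  then show ?thesis using assms unfolding Sigma0_iff_Pi0_union[OF \<open>1 < \<xi>\<close>]
    by (intro exI[of _ "\<lambda>_. A"]) auto
qed

lemma Sigma0_subset_Pi0:
  fixes \<xi> \<zeta> :: "'l succ_ord"
  assumes "\<zeta> < \<xi>" and "A \<in> Sigma0 \<zeta> X"
  shows "A \<in> Pi0 \<xi> X"
  using Pi0_subset_Sigma0[OF assms(1)] assms(2) Sigma0_compl_iff by (metis Pi0_iff)

lemma Sigma0_Int:
  fixes \<xi> :: "'l succ_ord"
  assumes inf: "infinite (UNIV :: 'l set)" and X: "open_Fsigma TYPE('l) X"
    and A: "A \<in> Sigma0 \<xi> X" and B: "B \<in> Sigma0 \<xi> X"
  shows "A \<inter> B \<in> Sigma0 \<xi> X"
proof (cases "\<xi> = 1")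
  case True
  then show ?thesis using A B by (auto simp: Sigma0_1)
next
  case False
  then have gt: "1 < \<xi>" using Sigma0_ge_1[OF A] by simp
  obtain A' :: "'l \<Rightarrow> _" where A': "A = (\<Union>i. A' i)" "\<And>i. \<exists>\<zeta><\<xi>. A' i \<in> Pi0 \<zeta> X"
    using A gt by (auto simp: Sigma0_iff_Pi0_union)
  obtain B' :: "'l \<Rightarrow> _" where B': "B = (\<Union>i. B' i)" "\<And>i. \<exists>\<zeta><\<xi>. B' i \<in> Pi0 \<zeta> X"
    using B gt by (auto simp: Sigma0_iff_Pi0_union)
  have "\<exists>\<zeta><\<xi>. A' i \<inter> B' j \<in> Pi0 \<zeta> X" for i j
  proof -
    obtain \<zeta>1 \<zeta>2 where z: "\<zeta>1 < \<xi>" "A' i \<in> Pi0 \<zeta>1 X" "\<zeta>2 < \<xi>" "B' j \<in> Pi0 \<zeta>2 X"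
      using A'(2) B'(2) by meson
    \<comment> \<open>The two levels may differ, while closure of \<open>Pi0\<close> under
      intersections is for a single level; the larger of the two is still below
      \<open>\<xi>\<close>.\<close>
    have "A' i \<in> Pi0 (max \<zeta>1 \<zeta>2) X" "B' j \<in> Pi0 (max \<zeta>1 \<zeta>2) X"
      using z Pi0_mono[OF X, of \<zeta>1 "max \<zeta>1 \<zeta>2"] Pi0_mono[OF X, of \<zeta>2 "max \<zeta>1 \<zeta>2"] by auto
    then have "A' i \<inter> B' j \<in> Pi0 (max \<zeta>1 \<zeta>2) X" by (rule Pi0_Int[OF inf])
    then show ?thesis using z by (intro exI[of _ "max \<zeta>1 \<zeta>2"]) auto
  qed
  moreover have "|(UNIV :: 'l set) \<times> (UNIV :: 'l set)| \<le>o |UNIV :: 'l set|"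
    using inf by (intro card_of_Sigma_ordLeq_infinite) (auto simp: card_of_refl[THEN ordIso_imp_ordLeq])
  ultimately have "(\<Union>p\<in>(UNIV :: 'l set) \<times> (UNIV :: 'l set). A' (fst p) \<inter> B' (snd p)) \<in> Sigma0 \<xi> X"
    using gt by (intro Sigma0_Pi0_small_union) auto
  moreover have "(\<Union>p\<in>(UNIV :: 'l set) \<times> (UNIV :: 'l set). A' (fst p) \<inter> B' (snd p)) = A \<inter> B"
    using A' B' by auto
  ultimately show ?thesis by simp
qed

lemma Pi0_Un:
  fixes \<xi> :: "'l succ_ord"
  assumes "infinite (UNIV :: 'l set)" and "open_Fsigma TYPE('l) X" and "A \<in> Pi0 \<xi> X" "B \<in> Pi0 \<xi> X"
  shows "A \<union> B \<in> Pi0 \<xi> X"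
  using Sigma0_Int[OF assms(1,2), of "topspace X - A" \<xi> "topspace X - B"] assms(3,4)
  by (auto simp: Pi0_iff Diff_Un)

text \<open>This glues the reduced sections of a relation back together. Different sections may
  involve \<Pi> sets of different levels, so the set is cut into pieces over single points of
  \<lambda>.\<close>

lemma Sigma0_prod_discrete:
  fixes \<xi> :: "'l succ_ord" and X :: "'a topology"
  assumes inf: "infinite (UNIV :: 'l set)"
  shows "1 \<le> \<xi> \<Longrightarrow> (\<And>\<gamma>. A \<gamma> \<in> Sigma0 \<xi> X) \<Longrightarrow>
    {(x, \<gamma> :: 'l). x \<in> A \<gamma>} \<in> Sigma0 \<xi> (prod_topology X (discrete_topology UNIV))"
proof (induction \<xi> arbitrary: A rule: less_induct)
  case (less \<xi>)
  let ?Y = "prod_topology X (discrete_topology (UNIV :: 'l set))"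
  show ?case
  proof (cases "\<xi> = 1")
    case True
    have "openin ?Y (\<Union>\<gamma>. A \<gamma> \<times> {\<gamma>})"
      using less.prems(2) True by (intro openin_Union) (auto simp: Sigma0_1 openin_prod_Times_iff)
    moreover have "(\<Union>\<gamma>. A \<gamma> \<times> {\<gamma>}) = {(x, \<gamma>). x \<in> A \<gamma>}" by auto
    ultimately show ?thesis using True by (simp add: Sigma0_1)
  next
    case False
    then have gt: "1 < \<xi>" using less.prems(1) by simp
    have "\<forall>\<gamma>. \<exists>B :: 'l \<Rightarrow> _. A \<gamma> = (\<Union>i. B i) \<and> (\<forall>i. \<exists>\<zeta><\<xi>. B i \<in> Pi0 \<zeta> X)"
      using less.prems(2) gt by (simp add: Sigma0_iff_Pi0_union)
    then obtain B :: "'l \<Rightarrow> 'l \<Rightarrow> _" where B: "\<And>s. A s = (\<Union>i. B s i)" "\<And>s i. \<exists>\<zeta><\<xi>. B s i \<in> Pi0 \<zeta> X"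
      by metis
    have "\<exists>\<zeta><\<xi>. B g i \<times> {g} \<in> Pi0 \<zeta> ?Y" for g i
    proof -
      obtain \<zeta> where \<zeta>: "\<zeta> < \<xi>" "B g i \<in> Pi0 \<zeta> X" using B(2) by blast
      then have "topspace X - B g i \<in> Sigma0 \<zeta> X" "1 \<le> \<zeta>" by (auto simp: Pi0_iff dest: Sigma0_ge_1)
      \<comment> \<open>The complement of \<open>B g i \<times> {g}\<close> has the complement of
        \<open>B g i\<close> as its section over \<open>g\<close> and the whole space elsewhere, so
        the induction hypothesis applies to it.\<close>
      then have "{(x, \<gamma> :: 'l). x \<in> (if \<gamma> = g then topspace X - B g i else topspace X)} \<in> Sigma0 \<zeta> ?Y"
        using \<zeta>(1) by (intro less.IH) (auto simp: topspace_in_Sigma0)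
      moreover have "{(x, \<gamma> :: 'l). x \<in> (if \<gamma> = g then topspace X - B g i else topspace X)}
          = topspace ?Y - B g i \<times> {g}" by (auto split: if_splits)
      moreover have "B g i \<times> {g} \<subseteq> topspace ?Y" using Pi0_subset_topspace[OF \<zeta>(2)] by auto
      ultimately show ?thesis using \<zeta>(1) by (auto simp: Pi0_iff)
    qed
    moreover have "|(UNIV :: 'l set) \<times> (UNIV :: 'l set)| \<le>o |UNIV :: 'l set|"
      using inf by (intro card_of_Sigma_ordLeq_infinite) (auto simp: card_of_refl[THEN ordIso_imp_ordLeq])
    ultimately have "(\<Union>p\<in>(UNIV :: 'l set) \<times> (UNIV :: 'l set). B (fst p) (snd p) \<times> {fst p}) \<in> Sigma0 \<xi> ?Y"
      using gt by (intro Sigma0_Pi0_small_union) auto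
    moreover have "(\<Union>p\<in>(UNIV :: 'l set) \<times> (UNIV :: 'l set). B (fst p) (snd p) \<times> {fst p}) = {(x, \<gamma>). x \<in> A \<gamma>}"
      using B(1) by auto
    ultimately show ?thesis by simp
  qed
qed

section \<open>Consequences of reduction and of an inseparable pair\<close>

definition Sigma0_reduction :: "'l succ_ord \<Rightarrow> 'a topology \<Rightarrow> bool" where
  "Sigma0_reduction \<xi> X \<longleftrightarrow>
     (\<forall>A :: 'l \<Rightarrow> 'a set. (\<forall>i. A i \<in> Sigma0 \<xi> X) \<longrightarrow>
        (\<exists>A' :: 'l \<Rightarrow> 'a set. (\<forall>i. A' i \<in> Sigma0 \<xi> X \<and> A' i \<subseteq> A i) \<and>
           (\<forall>i j. i \<noteq> j \<longrightarrow> A' i \<inter> A' j = {}) \<and> (\<Union>i. A' i) = (\<Union>i. A i)))"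

lemma reduction_property_Sigma0:
  fixes \<xi> :: "'l succ_ord"
  shows "reduction_property TYPE('l) \<C> (Sigma0 \<xi>) \<longleftrightarrow> (\<forall>X\<in>\<C>. Sigma0_reduction \<xi> X)"
  unfolding reduction_property_def Sigma0_reduction_def ..

lemma reduction_propertyE:
  fixes A :: "'l \<Rightarrow> 'a set"
  assumes "reduction_property TYPE('l) \<C> \<Gamma>" "X \<in> \<C>" "\<And>i. A i \<in> \<Gamma> X"
  obtains A' where "\<And>i. A' i \<in> \<Gamma> X" "\<And>i. A' i \<subseteq> A i" "\<And>i j. i \<noteq> j \<Longrightarrow> A' i \<inter> A' j = {}"
    "(\<Union>i. A' i) = (\<Union>i. A i)"
proof -
  have "\<exists>A' :: 'l \<Rightarrow> 'a set. (\<forall>i. A' i \<in> \<Gamma> X \<and> A' i \<subseteq> A i) \<and>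
           (\<forall>i j. i \<noteq> j \<longrightarrow> A' i \<inter> A' j = {}) \<and> (\<Union>i. A' i) = (\<Union>i. A i)"
    using assms unfolding reduction_property_def by simp
  then show thesis using that by auto
qed

lemma ordinal_uniformization_property_Sigma0:
  fixes \<xi> :: "'l succ_ord"
  assumes inf: "infinite (UNIV :: 'l set)" and red: "reduction_property TYPE('l) \<C> (Sigma0 \<xi>)"
  shows "ordinal_uniformization_property \<C> (Sigma0 \<xi> :: ('a \<times> 'l) pointclass)"
  unfolding ordinal_uniformization_property_def
proof (intro ballI)
  fix X :: "'a topology" and R :: "('a \<times> 'l) set"
  let ?Y = "prod_topology X (discrete_topology (UNIV :: 'l set))"
  assume X: "X \<in> \<C>" and R: "R \<in> Sigma0 \<xi> ?Y"
  have Rsub: "R \<subseteq> topspace X \<times> UNIV" using Sigma0_subset_topspace[OF R] by simp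
  define A where "A \<gamma> = {x \<in> topspace X. (x, \<gamma>) \<in> R}" for \<gamma>
  have A: "A \<gamma> \<in> Sigma0 \<xi> X" for \<gamma>
    unfolding A_def by (rule Sigma0_continuous_preimage[OF _ R]) (simp add: continuous_map_pairwise o_def)
  obtain A' where A': "\<And>\<gamma>. A' \<gamma> \<in> Sigma0 \<xi> X" "\<And>\<gamma>. A' \<gamma> \<subseteq> A \<gamma>"
      "\<And>i j. i \<noteq> j \<Longrightarrow> A' i \<inter> A' j = {}" "(\<Union>\<gamma>. A' \<gamma>) = (\<Union>\<gamma>. A \<gamma>)"
    using reduction_propertyE[of \<C> "Sigma0 \<xi>" X A, OF red X A] by blast
  show "\<exists>R'\<in>Sigma0 \<xi> ?Y. R' \<subseteq> R \<and>
      (\<forall>x\<in>topspace X. (\<exists>\<gamma>. (x, \<gamma>) \<in> R) \<longleftrightarrow> (\<exists>!\<gamma>. (x, \<gamma>) \<in> R'))"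
  proof (intro bexI conjI ballI)
    show "{(x, \<gamma>). x \<in> A' \<gamma>} \<in> Sigma0 \<xi> ?Y"
      using A'(1) Sigma0_ge_1[OF R] by (intro Sigma0_prod_discrete[OF inf])
    show "{(x, \<gamma>). x \<in> A' \<gamma>} \<subseteq> R" using A'(2) by (auto simp: A_def)
    fix x assume "x \<in> topspace X"
    then have "(\<exists>\<gamma>. (x, \<gamma>) \<in> R) \<longleftrightarrow> x \<in> (\<Union>\<gamma>. A' \<gamma>)" unfolding A'(4) by (auto simp: A_def)
    also have "\<dots> \<longleftrightarrow> (\<exists>!\<gamma>. x \<in> A' \<gamma>)" using A'(3) by blast
    finally show "(\<exists>\<gamma>. (x, \<gamma>) \<in> R) \<longleftrightarrow> (\<exists>!\<gamma>. (x, \<gamma>) \<in> {(x, \<gamma>). x \<in> A' \<gamma>})" by simp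
  qed
qed

lemma separation_property_Pi0:
  fixes \<xi> :: "'l succ_ord"
  assumes inf: "infinite (UNIV :: 'l set)" and red: "reduction_property TYPE('l) \<C> (Sigma0 \<xi>)"
  shows "separation_property TYPE('l) \<C> (Pi0 \<xi>)"
  unfolding separation_property_def
proof (intro ballI allI impI)
  fix X :: "'a topology" and A :: "'l \<Rightarrow> 'a set"
  assume X: "X \<in> \<C>" and A: "(\<forall>i. A i \<in> Pi0 \<xi> X) \<and> (\<Inter>i. A i) = {}"
  have A0: "topspace X - A i \<in> Sigma0 \<xi> X" for i using A by (simp add: Pi0_iff)
  obtain C :: "'l \<Rightarrow> _" where C: "\<And>i. C i \<in> Sigma0 \<xi> X" "\<And>i. C i \<subseteq> topspace X - A i"
      "\<And>i j. i \<noteq> j \<Longrightarrow> C i \<inter> C j = {}" "(\<Union>i. C i) = (\<Union>i. topspace X - A i)"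
    using reduction_propertyE[of \<C> "Sigma0 \<xi>" X "\<lambda>i. topspace X - A i", OF red X A0] by blast
  have cover: "(\<Union>i. C i) = topspace X" unfolding C(4) using A by auto
  have "topspace X - C i \<in> Delta_of (Pi0 \<xi>) X" for i
  proof -
    \<comment> \<open>The sets \<open>C j\<close> partition the space, so the complement of one is
      the union of the others, and each of them lies in both classes.\<close>
    have "(\<Union>j\<in>-{i}. C j) \<in> Sigma0 \<xi> X"
      using C(1) Sigma0_ge_1[OF C(1)] by (intro Sigma0_small_union[OF inf]) (auto intro: card_of_mono1)
    moreover have "(\<Union>j\<in>-{i}. C j) = topspace X - C i"
      using cover C(3) by fastforce
    ultimately have S: "topspace X - C i \<in> Sigma0 \<xi> X" by simp
    moreover have sub: "C i \<subseteq> topspace X" by (rule Sigma0_subset_topspace[OF C(1)])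
    ultimately have "C i \<in> Pi0 \<xi> X" "topspace X - C i \<in> Pi0 \<xi> X"
      using C(1)[of i] by (auto simp: Pi0_iff double_diff)
    then show ?thesis unfolding Delta_of_def by blast
  qed
  moreover have "A i \<subseteq> topspace X - C i" for i using A C(2)[of i] by (auto simp: Pi0_iff)
  moreover have "(\<Inter>i. topspace X - C i) = {}" using cover by auto
  ultimately show "\<exists>B :: 'l \<Rightarrow> 'a set. (\<forall>i. B i \<in> Delta_of (Pi0 \<xi>) X \<and> A i \<subseteq> B i) \<and> (\<Inter>i. B i) = {}"
    by (intro exI[of _ "\<lambda>i. topspace X - C i"]) auto
qed

text \<open>One such pair refutes separation for \<Sigma> and, through the complements of its
  members, reduction for \<Pi>.\<close>

definition Sigma0_inseparable_pair :: "'l succ_ord \<Rightarrow> 'a topology \<Rightarrow> bool" where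
  "Sigma0_inseparable_pair \<xi> X \<longleftrightarrow>
     (\<exists>A\<in>Sigma0 \<xi> X. \<exists>B\<in>Sigma0 \<xi> X. A \<inter> B = {} \<and>
       (\<forall>D\<in>Sigma0 \<xi> X. D \<in> Pi0 \<xi> X \<longrightarrow> A \<subseteq> D \<longrightarrow> B \<inter> D \<noteq> {}))"

lemma not_separation_property_Sigma0:
  fixes \<xi> :: "'l succ_ord"
  assumes inf: "infinite (UNIV :: 'l set)" and X: "X \<in> \<C>" "Sigma0_inseparable_pair \<xi> X"
  shows "\<not> separation_property TYPE('l) \<C> (Sigma0 \<xi>)"
proof
  assume sep: "separation_property TYPE('l) \<C> (Sigma0 \<xi>)"
  obtain A0 A1 where A: "A0 \<in> Sigma0 \<xi> X" "A1 \<in> Sigma0 \<xi> X" "A0 \<inter> A1 = {}"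
    and ns: "\<And>D. D \<in> Sigma0 \<xi> X \<Longrightarrow> D \<in> Pi0 \<xi> X \<Longrightarrow> A0 \<subseteq> D \<Longrightarrow> A1 \<inter> D \<noteq> {}"
    using X(2) unfolding Sigma0_inseparable_pair_def by blast
  obtain p q :: 'l where pq: "p \<noteq> q"
    using infinite_ex_distinct[OF inf] by blast
  \<comment> \<open>Padding with the whole space: a superset at any other index is again the whole
    space, so an empty intersection means that \<open>B p\<close> and \<open>B q\<close> are
    disjoint.\<close>
  define A where "A i = (if i = p then A0 else if i = q then A1 else topspace X)" for i
  have "A i \<in> Sigma0 \<xi> X" for i
    using A Sigma0_ge_1[OF A(1)] by (simp add: A_def topspace_in_Sigma0)
  moreover have "(\<Inter>i. A i) = {}"
  proof -
    have "(\<Inter>i. A i) \<subseteq> A p \<inter> A q" by blast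
    then show ?thesis using A(3) pq by (simp add: A_def)
  qed
  ultimately have "\<exists>B :: 'l \<Rightarrow> _. (\<forall>i. B i \<in> Delta_of (Sigma0 \<xi>) X \<and> A i \<subseteq> B i) \<and> (\<Inter>i. B i) = {}"
    using sep X(1) unfolding separation_property_def by simp
  then obtain B :: "'l \<Rightarrow> _" where B: "\<And>i. B i \<in> Delta_of (Sigma0 \<xi>) X" "\<And>i. A i \<subseteq> B i" "(\<Inter>i. B i) = {}"
    by auto
  have "topspace X \<subseteq> B i" if "i \<noteq> p" "i \<noteq> q" for i using B(2)[of i] that by (simp add: A_def)
  moreover have sub: "B i \<subseteq> topspace X" for i
    using B(1)[of i] Sigma0_subset_topspace by (auto simp: Delta_of_def)
  ultimately have "x \<in> B i" if "x \<in> B p \<inter> B q" for x i using that by (cases "i = p"; cases "i = q") auto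
  then have "B p \<inter> B q \<subseteq> (\<Inter>i. B i)" by blast
  then have "B p \<inter> B q = {}" using B(3) by simp
  moreover have "A1 \<subseteq> B q" "A0 \<subseteq> B p" using B(2)[of q] B(2)[of p] pq by (auto simp: A_def)
  moreover have "B p \<in> Sigma0 \<xi> X" "B p \<in> Pi0 \<xi> X" using B(1)[of p] by (auto simp: Delta_of_def Pi0_def)
  ultimately show False using ns[of "B p"] by blast
qed

lemma not_reduction_property_Pi0:
  fixes \<xi> :: "'l succ_ord"
  assumes inf: "infinite (UNIV :: 'l set)" and X: "X \<in> \<C>" "Sigma0_inseparable_pair \<xi> X"
  shows "\<not> reduction_property TYPE('l) \<C> (Pi0 \<xi>)"
proof
  assume red: "reduction_property TYPE('l) \<C> (Pi0 \<xi>)"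
  obtain A0 A1 where A: "A0 \<in> Sigma0 \<xi> X" "A1 \<in> Sigma0 \<xi> X" "A0 \<inter> A1 = {}"
    and ns: "\<And>D. D \<in> Sigma0 \<xi> X \<Longrightarrow> D \<in> Pi0 \<xi> X \<Longrightarrow> A0 \<subseteq> D \<Longrightarrow> A1 \<inter> D \<noteq> {}"
    using X(2) unfolding Sigma0_inseparable_pair_def by blast
  obtain p q :: 'l where pq: "p \<noteq> q"
    using infinite_ex_distinct[OF inf] by blast
  \<comment> \<open>The complements of disjoint sets cover the space, so reducing them gives two
    complementary \<Pi> sets; \<open>C q\<close> then lies in both classes, contains
    \<open>A0\<close> and misses \<open>A1\<close>.\<close>
  define A where "A i = (if i = p then topspace X - A0 else if i = q then topspace X - A1 else {})" for i
  have AP: "A i \<in> Pi0 \<xi> X" for i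
    using A Sigma0_ge_1[OF A(1)] by (auto simp: A_def empty_in_Pi0 Pi0_iff double_diff Sigma0_subset_topspace topspace_in_Sigma0)
  obtain C where C: "\<And>i. C i \<in> Pi0 \<xi> X" "\<And>i. C i \<subseteq> A i"
      "\<And>i j. i \<noteq> j \<Longrightarrow> C i \<inter> C j = {}" "(\<Union>i. C i) = (\<Union>i. A i)"
    using reduction_propertyE[of \<C> "Pi0 \<xi>" X A, OF red X(1) AP] by blast
  have "(\<Union>i. A i) = topspace X" using A(3) pq by (auto simp: A_def split: if_splits)
  moreover have "(\<Union>i. C i) = C p \<union> C q" using C(2) by (fastforce simp: A_def split: if_splits)
  ultimately have cov: "C p \<union> C q = topspace X" using C(4) by simp
  then have eq: "C p = topspace X - C q" using C(3)[OF pq] by blast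
  then have eq': "C q = topspace X - C p" using cov by blast
  have "C q \<in> Sigma0 \<xi> X" using C(1)[of p] eq' by (simp add: Pi0_iff)
  moreover have "A0 \<subseteq> C q"
    using eq' C(2)[of p] Sigma0_subset_topspace[OF A(1)] by (auto simp: A_def)
  moreover have "A1 \<inter> C q = {}" using C(2)[of q] pq by (auto simp: A_def)
  ultimately show False using ns C(1)[of q] by blast
qed

section \<open>Small intersections and reduction above the first level\<close>

text \<open>A proper initial segment of a successor cardinal is smaller than that cardinal. This
  lets \<lambda> enumerate the levels below \<open>\<xi>\<close>.\<close>

lemma card_of_succ_ord_lessThan:
  fixes \<xi> :: "'l succ_ord"
  shows "|{..<\<xi>}| \<le>o |UNIV :: 'l set|"
proof -
  let ?r = "cardSuc |UNIV :: 'l set|"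
  have "Rep_succ_ord ` {..<\<xi>} \<subseteq> underS ?r (Rep_succ_ord \<xi>)"
    by (auto simp: underS_def Rep_succ_ord_inject less_eq_succ_ord_def[symmetric])
  moreover have "inj_on Rep_succ_ord {..<\<xi>}" by (simp add: inj_on_def Rep_succ_ord_inject)
  ultimately have "|{..<\<xi>}| \<le>o |underS ?r (Rep_succ_ord \<xi>)|" using card_of_ordLeq by blast
  moreover have "|underS ?r (Rep_succ_ord \<xi>)| <o ?r"
    by (intro card_of_underS Rep_succ_ord) (simp add: cardSuc_Card_order card_of_Card_order)
  ultimately have "|{..<\<xi>}| <o ?r" by (rule ordLeq_ordLess_trans)
  then show ?thesis using cardSuc_ordLeq_ordLess[OF card_of_Card_order card_of_Card_order] by blast
qed

section \<open>Cardinal arithmetic from 2^(<\<lambda>) = \<lambda>\<close>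

locale lambda_cardinal =
  fixes lam :: "'l rel"
  assumes card_order_lam: "card_order lam" and uncountable_lam: "natLeq <o lam"
    and two_pow_less_lam: "two_pow_less lam =o lam"
begin

abbreviation le (infix \<open>\<sqsubseteq>\<close> 50) where "a \<sqsubseteq> b \<equiv> (a, b) \<in> lam"
abbreviation lt (infix \<open>\<sqsubset>\<close> 50) where "a \<sqsubset> b \<equiv> a \<sqsubseteq> b \<and> a \<noteq> b"

definition small :: "'b set \<Rightarrow> bool" where
  "small J \<longleftrightarrow> |J| <o |UNIV :: 'l set|"

text \<open>Counting choice functions: an intersection of fewer than \<open>\<lambda>\<close> many unions indexed by \<open>C\<close>
  distributes into a union of at most \<open>\<lambda>\<close> many intersections.\<close>

definition power_bounded :: "'l set \<Rightarrow> bool" where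
  "power_bounded C \<longleftrightarrow> (\<forall>J :: 'l set. small J \<longrightarrow> |Func J C| \<le>o |UNIV :: 'l set| )"

lemma Field_lam: "Field lam = UNIV"
  using card_order_lam card_order_on_Card_order by fastforce

lemma Card_order_lam: "Card_order lam"
  using card_order_lam card_order_on_Card_order by fastforce

lemma lam_ordIso: "lam =o |UNIV :: 'l set|"
  using Card_order_lam Field_lam by (metis Card_order_iff_ordIso_card_of)

lemma uncountable_UNIV: "natLeq <o |UNIV :: 'l set|"
  using uncountable_lam lam_ordIso by (rule ordLess_ordIso_trans)

lemma infinite_UNIV: "infinite (UNIV :: 'l set)"
  using uncountable_UNIV infinite_iff_natLeq_ordLeq ordLess_imp_ordLeq by blast

lemma Well_order_lam: "Well_order lam"
  using Card_order_lam unfolding card_order_on_def by simp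

sublocale L: wellorder le lt
proof -
  have refl: "refl_on UNIV lam" and tr: "trans lam" and an: "antisym lam"
    and tot: "total_on UNIV lam" and wf: "wf (lam - Id)"
    using Well_order_lam
    by (auto simp: well_order_on_def linear_order_on_def partial_order_on_def preorder_on_def Field_lam)
  have eq: "{(x, y). x \<sqsubset> y} = lam - Id" by auto
  show "class.wellorder le lt"
  proof (unfold_locales, goal_cases)
    case 1 show ?case using an by (auto dest: antisymD)
  next
    case 2 show ?case using refl by (auto simp: refl_on_def)
  next
    case 3 then show ?case using tr by (auto dest: transD)
  next
    case 4 then show ?case using an by (auto dest: antisymD)
  next
    case 5 show ?case using tot refl unfolding total_on_def refl_on_def by (metis UNIV_I)
  next
    case (6 P a)
    have "wf {(x, y). x \<sqsubset> y}" unfolding eq by (rule wf)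
    then show ?case by (induction a rule: wf_induct_rule) (use 6 in auto)
  qed
qed

lemma underS_lam: "underS lam a = {b. b \<sqsubset> a}"
  by (auto simp: underS_def)

lemma small_below: "small {b. b \<sqsubset> a}"
proof -
  have "|underS lam a| <o lam" by (rule card_of_underS[OF Card_order_lam]) (simp add: Field_lam)
  then show ?thesis unfolding small_def underS_lam using lam_ordIso by (rule ordLess_ordIso_trans)
qed

lemma ex_greater: "\<exists>b. a \<sqsubset> b"
  using infinite_Card_order_limit[OF Card_order_lam, of a] infinite_UNIV by (auto simp: Field_lam)

lemma small_ordLeq: "|A| \<le>o |B| \<Longrightarrow> small B \<Longrightarrow> small A"
  unfolding small_def by (rule ordLeq_ordLess_trans)

lemma small_subset: "A \<subseteq> B \<Longrightarrow> small B \<Longrightarrow> small A"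
  by (rule small_ordLeq[OF card_of_mono1])

lemma small_image: "small A \<Longrightarrow> small (f ` A)"
  by (rule small_ordLeq[OF card_of_image])

lemma small_atMost: "small {b. b \<sqsubseteq> a}"
proof -
  obtain c where c: "a \<sqsubset> c" using ex_greater by blast
  have "{b. b \<sqsubseteq> a} \<subseteq> {b. b \<sqsubset> c}" using L.le_less_trans[OF _ c] by auto
  then show ?thesis using small_below small_subset by blast
qed

lemma small_finite: "finite A \<Longrightarrow> small A"
  unfolding small_def using infinite_UNIV
  by (intro finite_ordLess_infinite) (auto simp: card_of_well_order_on Field_card_of)

lemma small_imp_ordLeq: "small A \<Longrightarrow> |A| \<le>o |UNIV :: 'l set|"
  unfolding small_def by (rule ordLess_imp_ordLeq)

lemma small_Times:
  assumes "small A" "small B"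
  shows "small (A \<times> B)"
proof -
  \<comment> \<open>\<open>E\<close> stands for the larger factor. If it is infinite, the product
    has at most its size; otherwise both factors are finite.\<close>
  have *: "small (C \<times> D)" if "|C| \<le>o |E|" "|D| \<le>o |E|" "small E" "finite E \<longrightarrow> finite C \<and> finite D"
    for C :: "'c set" and D :: "'d set" and E :: "'e set"
  proof (cases "finite E")
    case True
    then show ?thesis using that by (intro small_finite) auto
  next
    case False
    then have "|C \<times> D| \<le>o |E|" using that by (intro card_of_Sigma_ordLeq_infinite) auto
    then show ?thesis using that(3) by (rule small_ordLeq)
  qed
  have fin: "finite C \<Longrightarrow> |D| \<le>o |C| \<Longrightarrow> finite D" for C :: "'c set" and D :: "'d set"
    using card_of_ordLeq_finite by blast
  consider "|A| \<le>o |B|" | "|B| \<le>o |A|"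
    using ordLeq_total[OF card_of_Well_order card_of_Well_order] by blast
  then show ?thesis
  proof cases
    case 1
    then show ?thesis using assms fin[of B A] by (intro *[of A B B]) (auto simp: ordLeq_refl card_of_Card_order)
  next
    case 2
    then show ?thesis using assms fin[of A B] by (intro *[of A A B]) (auto simp: ordLeq_refl card_of_Card_order)
  qed
qed

lemma small_embeds_below:
  assumes "small Z"
  obtains a where "|Z| \<le>o |{b. b \<sqsubset> a}|"
proof -
  have "|Z| <o lam" using assms lam_ordIso unfolding small_def
    by (meson ordIso_symmetric ordLess_ordIso_trans)
  then obtain a where "|Z| =o Restr lam (underS lam a)"
    using ordLess_iff_ordIso_Restr[OF Well_order_lam card_of_Well_order] by blast
  then have "|Field |Z|| \<le>o |Field (Restr lam (underS lam a))|"
    by (intro card_of_mono2 ordIso_imp_ordLeq)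
  moreover have "|Field (Restr lam (underS lam a))| \<le>o |underS lam a|"
    by (rule card_of_mono1) (auto simp: Field_def)
  ultimately have "|Z| \<le>o |{b. b \<sqsubset> a}|" unfolding Field_card_of underS_lam by (rule ordLeq_transitive)
  then show thesis by (rule that)
qed

text \<open>All counting draws on 2^(<\<lambda>) = \<lambda> through this lemma: after an embedding
  into a proper initial segment, subsets become binary sequences.\<close>

lemma Pow_small_ordLeq:
  assumes "small Z"
  shows "|Pow Z| \<le>o |UNIV :: 'l set|"
proof -
  obtain a where "|Z| \<le>o |{b. b \<sqsubset> a}|" using small_embeds_below[OF assms] .
  then obtain k where k: "inj_on k Z" "k ` Z \<subseteq> underS lam a"
    unfolding underS_lam card_of_ordLeq[symmetric] by blast
  \<comment> \<open>\<open>two_pow_less\<close> counts partial maps, so the characteristic function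
    of the copy of \<open>S\<close> must have exactly the initial segment as its domain.\<close>
  define h where "h S = (\<lambda>b. if b \<in> underS lam a then Some (b \<in> k ` S) else None)" for S
  have "inj_on h (Pow Z)"
  proof (rule inj_onI)
    fix S T assume ST: "S \<in> Pow Z" "T \<in> Pow Z" "h S = h T"
    have "b \<in> k ` S \<longleftrightarrow> b \<in> k ` T" for b
    proof (cases "b \<in> underS lam a")
      case True
      then show ?thesis using fun_cong[OF ST(3), of b] by (simp add: h_def)
    next
      case False
      then show ?thesis using ST(1,2) k(2) by blast
    qed
    then have "k ` S = k ` T" by blast
    then show "S = T" using k(1) ST(1,2) by (simp add: inj_on_image_eq_iff)
  qed
  moreover have "h ` Pow Z \<subseteq> {s. \<exists>a\<in>Field lam. dom s = underS lam a}"
    by (auto simp: h_def Field_lam dom_def split: if_splits)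
  ultimately have "|Pow Z| \<le>o two_pow_less lam"
    unfolding two_pow_less_def card_of_ordLeq[symmetric] by blast
  then show ?thesis using two_pow_less_lam lam_ordIso
    by (meson ordIso_transitive ordLeq_ordIso_trans)
qed

text \<open>All members of \<open>Func J C\<close> agree outside \<open>J\<close>, so each is
  determined by its graph, a subset of the small set \<open>J \<times> C\<close>.\<close>

lemma Func_small_ordLeq:
  assumes "small J" "small C"
  shows "|Func J C| \<le>o |UNIV :: 'l set|"
proof -
  define h where "h f = (\<lambda>j. (j, f j)) ` J" for f :: "'a \<Rightarrow> 'b"
  have "inj_on h (Func J C)"
  proof (rule inj_onI, rule ext)
    fix f g x assume fg: "f \<in> Func J C" "g \<in> Func J C" "h f = h g"
    show "f x = g x"
    proof (cases "x \<in> J")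
      case True
      then have "(x, f x) \<in> h g" unfolding fg(3)[symmetric] by (simp add: h_def)
      then show ?thesis by (auto simp: h_def)
    qed (use fg(1,2) in \<open>auto simp: Func_def\<close>)
  qed
  moreover have "h ` Func J C \<subseteq> Pow (J \<times> C)" by (auto simp: h_def Func_def)
  ultimately have "|Func J C| \<le>o |Pow (J \<times> C)|" unfolding card_of_ordLeq[symmetric] by blast
  then show ?thesis using Pow_small_ordLeq[OF small_Times[OF assms]] by (rule ordLeq_transitive)
qed

lemma power_bounded_small: "small C \<Longrightarrow> power_bounded C"
  unfolding power_bounded_def using Func_small_ordLeq by blast

text \<open>For regular \<lambda> a function on a small set has bounded range. The functions thus
  fall into \<lambda> many families, one for each bound, and each family has size at most
  \<lambda>.\<close>

lemma power_bounded_regular: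
  assumes bounded: "\<And>K. small K \<Longrightarrow> \<exists>a. \<forall>k\<in>K. k \<sqsubset> a"
  shows "power_bounded C"
  unfolding power_bounded_def
proof (intro allI impI)
  fix J :: "'l set" assume J: "small J"
  have "Func J C \<subseteq> (\<Union>a. Func J {b. b \<sqsubset> a})"
  proof
    fix f assume f: "f \<in> Func J C"
    obtain a where "\<forall>k\<in>f ` J. k \<sqsubset> a" using bounded[OF small_image[OF J]] by blast
    then show "f \<in> (\<Union>a. Func J {b. b \<sqsubset> a})" using f by (auto simp: Func_def)
  qed
  then have "|Func J C| \<le>o |\<Union>a. Func J {b. b \<sqsubset> a}|" by (rule card_of_mono1)
  moreover have "|\<Union>a. Func J {b. b \<sqsubset> a}| \<le>o |UNIV :: 'l set|"
    using infinite_UNIV Func_small_ordLeq[OF J small_below]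
    by (intro card_of_UNION_ordLeq_infinite) (auto simp: ordLeq_refl card_of_Card_order)
  ultimately show "|Func J C| \<le>o |UNIV :: 'l set|" by (rule ordLeq_transitive)
qed

text \<open>A cofinal set of least cardinality works: either it is small, or \<open>\<lambda>\<close> is regular.\<close>

lemma ex_power_bounded_cofinal:
  fixes W :: "'l \<Rightarrow> 'l \<Rightarrow> bool"
  assumes total: "\<And>a b. W a b \<or> W b a" and trans: "\<And>a b c. W a b \<Longrightarrow> W b c \<Longrightarrow> W a c"
  shows "\<exists>C. power_bounded C \<and> (\<forall>a. \<exists>c\<in>C. W a c)"
proof -
  let ?P = "\<lambda>C. \<forall>a. \<exists>c\<in>C. W a c"
  have "?P UNIV" using total by blast
  then obtain C where C: "?P C" and min: "\<And>B. ?P B \<Longrightarrow> |C| \<le>o |B|"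
    using min_card_attained[of ?P] by blast
  have "power_bounded C"
  proof (cases "small C")
    case False
    \<comment> \<open>By minimality of \<open>C\<close> a small set is not cofinal, and
      \<open>W\<close> is total, so some element lies above all of it.\<close>
    have unb: "\<exists>w. \<forall>b\<in>B. W b w" if "small B" for B
    proof -
      have "\<not> ?P B" using min[of B] that False small_ordLeq by blast
      then show ?thesis using total by blast
    qed
    have "C \<noteq> {}" using C by blast
    moreover have "|C| \<le>o |UNIV :: 'l set|" by (rule card_of_mono1) simp
    ultimately obtain e :: "'l \<Rightarrow> 'l" where e: "e ` UNIV = C"
      using card_of_ordLeq2[of C "UNIV :: 'l set"] by auto
    show ?thesis
    proof (rule power_bounded_regular, rule ccontr)
      fix K assume K: "small K" and nb: "\<nexists>a. \<forall>k\<in>K. k \<sqsubset> a"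
      have K': "\<exists>k\<in>K. a \<sqsubseteq> k" for a
      proof (rule ccontr)
        assume none: "\<not> (\<exists>k\<in>K. a \<sqsubseteq> k)"
        have "k \<sqsubset> a" if "k \<in> K" for k using none that L.not_le[of a k] by blast
        then show False using nb by blast
      qed
      \<comment> \<open>\<open>w k\<close> bounds the enumeration \<open>e\<close> of
        \<open>C\<close> up to \<open>k\<close>. If \<open>K\<close> is small and unbounded in
        \<lambda>, the values \<open>w k\<close> for \<open>k \<in> K\<close> form a small cofinal
        set, against the minimality of \<open>C\<close>.\<close>
      have "\<forall>k. \<exists>w. \<forall>b\<in>e ` {b. b \<sqsubseteq> k}. W b w"
        by (intro allI unb small_image small_atMost)
      then obtain w where "\<forall>k. \<forall>b\<in>e ` {b. b \<sqsubseteq> k}. W b (w k)" by (auto dest: choice)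
      then have w: "W (e b) (w k)" if "b \<sqsubseteq> k" for k b using that by blast
      have "\<exists>c\<in>w ` K. W a c" for a
      proof -
        obtain b where b: "W a (e b)" using C e by blast
        obtain k where "k \<in> K" "b \<sqsubseteq> k" using K' by blast
        then show ?thesis using w trans[OF b] by blast
      qed
      then have "|C| \<le>o |w ` K|" using min by blast
      then show False using False small_ordLeq small_image[OF K] by blast
    qed
  qed (rule power_bounded_small)
  then show ?thesis using C by blast
qed

text \<open>The point is that the levels \<open>rk i\<close> do not depend on the set \<open>B\<close>.\<close>

lemma Sigma0_normal_form:
  fixes \<xi> :: "'l succ_ord" and X :: "'a topology"
  assumes gt: "1 < \<xi>"
  shows "\<exists>rk :: 'l \<Rightarrow> 'l succ_ord. (\<forall>i. 1 \<le> rk i \<and> rk i < \<xi>) \<and>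
    (\<forall>B\<in>Sigma0 \<xi> X. \<exists>A. B = (\<Union>i. A i) \<and> (\<forall>i. A i \<in> Pi0 (rk i) X))"
proof -
  have "|(UNIV :: 'l set) \<times> {1..<\<xi>}| \<le>o |UNIV :: 'l set|"
  proof (intro card_of_Sigma_ordLeq_infinite infinite_UNIV ballI)
    have "|{1..<\<xi>}| \<le>o |{..<\<xi>}|" by (rule card_of_mono1) auto
    then show "|{1..<\<xi>}| \<le>o |UNIV :: 'l set|" using card_of_succ_ord_lessThan by (rule ordLeq_transitive)
  qed (simp add: ordLeq_refl card_of_Card_order)
  moreover have "(UNIV :: 'l set) \<times> {1..<\<xi>} \<noteq> {}" using gt by auto
  ultimately obtain e :: "'l \<Rightarrow> 'l \<times> 'l succ_ord" where e: "range e = UNIV \<times> {1..<\<xi>}"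
    using card_of_ordLeq2[of "(UNIV :: 'l set) \<times> {1..<\<xi>}" "UNIV :: 'l set"] by auto
  define rk where "rk i = snd (e i)" for i
  have rk: "1 \<le> rk i" "rk i < \<xi>" for i
    using rangeI[of e i] unfolding e by (auto simp: rk_def)
  show ?thesis
  proof (intro exI[of _ rk] conjI ballI)
    fix B assume B: "B \<in> Sigma0 \<xi> X"
    from Sigma0_union_ranked[OF gt B] obtain A :: "'l \<Rightarrow> 'a set" and z
      where A: "B = (\<Union>i. A i)" and z: "\<forall>i. z i < \<xi>" "\<forall>i. A i \<in> Pi0 (z i) X"
      by (elim exE conjE) (rule that)
    have z1: "1 \<le> z i" for i using z(2) Sigma0_ge_1[of "topspace X - A i" "z i" X] by (simp add: Pi0_iff)
    \<comment> \<open>The index \<open>k\<close> stands for a pair of an index \<open>i\<close> and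
      a level. It receives \<open>A i\<close> if that level is \<open>z i\<close>, and the empty set
      otherwise; so \<open>rk\<close> depends on the enumeration \<open>e\<close> alone.\<close>
    define A' where "A' k = (if rk k = z (fst (e k)) then A (fst (e k)) else {})" for k
    have "A' k \<in> Pi0 (rk k) X" for k using z rk by (simp add: A'_def empty_in_Pi0)
    moreover have "B = (\<Union>k. A' k)"
    proof
      show "B \<subseteq> (\<Union>k. A' k)"
      proof
        fix x assume "x \<in> B"
        then obtain i where i: "x \<in> A i" using A by blast
        have "(i, z i) \<in> range e" unfolding e using z1 z by auto
        then obtain k where "e k = (i, z i)" by auto
        then have "x \<in> A' k" using i by (simp add: A'_def rk_def)
        then show "x \<in> (\<Union>k. A' k)" by blast
      qed
      show "(\<Union>k. A' k) \<subseteq> B" by (auto simp: A A'_def split: if_splits)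
    qed
    ultimately show "\<exists>A. B = (\<Union>i. A i) \<and> (\<forall>i. A i \<in> Pi0 (rk i) X)"
      by (intro exI[of _ A']) simp
  qed (use rk in auto)
qed

text \<open>The level 1 case of \<open>Sigma0_decomposition\<close>, imposed on the space. It
  strengthens \<open>open_Fsigma\<close>: one index set serves all open sets and has few choice
  functions.\<close>

definition uniform_Fsigma :: "'a topology \<Rightarrow> bool" where
  "uniform_Fsigma X \<longleftrightarrow> (\<exists>C. power_bounded C \<and> (\<forall>U. openin X U \<longrightarrow>
     (\<exists>D. U = (\<Union>c\<in>C. D c) \<and> (\<forall>c\<in>C. closedin X (D c)))))"

lemma uniform_Fsigma_imp_open_Fsigma:
  assumes "uniform_Fsigma X"
  shows "open_Fsigma TYPE('l) X"
  unfolding open_Fsigma_def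
proof (intro allI impI)
  fix U assume U: "openin X U"
  from assms obtain C where "power_bounded C" and
    C: "\<forall>U. openin X U \<longrightarrow> (\<exists>D. U = (\<Union>c\<in>C. D c) \<and> (\<forall>c\<in>C. closedin X (D c)))"
    unfolding uniform_Fsigma_def by (elim exE conjE) (rule that)
  from C[rule_format, OF U] obtain D where "U = (\<Union>c\<in>C. D c)" "\<forall>c\<in>C. closedin X (D c)"
    by (elim exE conjE) (rule that)
  then show "\<exists>A :: 'l \<Rightarrow> _. U = (\<Union>i. A i) \<and> (\<forall>i. closedin X (A i))"
    by (intro exI[of _ "\<lambda>i. if i \<in> C then D i else {}"]) auto
qed

text \<open>Members of lower level are dealt with at once by their union, so that \<open>small_inter\<close> is only
  needed for members of one and the same level; for mixed levels below a limit it is false.\<close>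

lemma Pi0_union_initial_segment:
  fixes \<xi> :: "'l succ_ord" and rk :: "'l \<Rightarrow> 'l succ_ord"
  assumes X: "uniform_Fsigma X"
    and small_inter: "\<And>(J :: 'l set) B. small J \<Longrightarrow> (\<And>j. j \<in> J \<Longrightarrow> B j \<in> Sigma0 (rk c) X) \<Longrightarrow>
        topspace X \<inter> (\<Inter>j\<in>J. B j) \<in> Sigma0 \<xi> X"
    and rk: "\<And>i. 1 \<le> rk i" "rk c < \<xi>"
    and A: "\<And>i. A i \<in> Pi0 (rk i) X"
  shows "(\<Union>i\<in>{i. rk i < rk c \<or> rk i = rk c \<and> i \<sqsubset> c}. A i) \<in> Pi0 \<xi> X"
proof -
  have 1: "(\<Union>i\<in>{i. rk i < rk c}. A i) \<in> Pi0 \<xi> X"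
  proof (cases "rk c = 1")
    case True
    then have "{i. rk i < rk c} = {}" using rk(1) by (auto simp: not_less[symmetric])
    then show ?thesis using rk by (auto intro!: empty_in_Pi0 order.trans[OF rk(1)[of c]])
  next
    case False
    then have "1 < rk c" using rk(1)[of c] by simp
    then have "(\<Union>i\<in>{i. rk i < rk c}. A i) \<in> Sigma0 (rk c) X"
      using A by (intro Sigma0_Pi0_small_union) (auto intro: card_of_mono1)
    then show ?thesis by (rule Sigma0_subset_Pi0[OF rk(2)])
  qed
  let ?J = "{i. rk i = rk c \<and> i \<sqsubset> c}"
  have "small ?J" by (rule small_subset[OF _ small_below[of c]]) auto
  then have "topspace X \<inter> (\<Inter>j\<in>?J. topspace X - A j) \<in> Sigma0 \<xi> X"
  proof (rule small_inter)
    fix j assume "j \<in> ?J"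
    then have "rk j = rk c" by simp
    then show "topspace X - A j \<in> Sigma0 (rk c) X" using A[of j] by (simp add: Pi0_iff)
  qed
  moreover have "topspace X \<inter> (\<Inter>j\<in>?J. topspace X - A j) = topspace X - (\<Union>j\<in>?J. A j)" by auto
  ultimately have 2: "(\<Union>j\<in>?J. A j) \<in> Pi0 \<xi> X" using A Pi0_subset_topspace by (auto simp: Pi0_iff)
  have "(\<Union>i\<in>{i. rk i < rk c}. A i) \<union> (\<Union>j\<in>?J. A j) \<in> Pi0 \<xi> X"
    by (rule Pi0_Un[OF infinite_UNIV uniform_Fsigma_imp_open_Fsigma[OF X] 1 2])
  moreover have "(\<Union>i\<in>{i. rk i < rk c}. A i) \<union> (\<Union>j\<in>?J. A j) =
    (\<Union>i\<in>{i. rk i < rk c \<or> rk i = rk c \<and> i \<sqsubset> c}. A i)" by auto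
  ultimately show ?thesis by simp
qed

text \<open>Distributivity turns the intersection into a union over \<open>f\<close> in
  \<open>Func J C\<close> of the intersections of the sets \<open>D j (f j)\<close>. Each of these
  is \<Pi> of level \<open>\<eta>\<close>, a class closed under intersections of size at most
  \<lambda>, and \<open>power_bounded\<close> keeps their number at \<lambda>.\<close>

lemma Sigma0_inter_of_decompositions:
  fixes \<eta> \<zeta> :: "'l succ_ord"
  assumes "\<eta> < \<zeta>" and J: "small J" and C: "power_bounded C" and eta: "1 \<le> \<eta>"
    and D: "\<And>j :: 'l. j \<in> J \<Longrightarrow> B j = (\<Union>c\<in>C. D j c)" "\<And>j c. j \<in> J \<Longrightarrow> c \<in> C \<Longrightarrow> D j c \<in> Pi0 \<eta> X"
  shows "topspace X \<inter> (\<Inter>j\<in>J. B j) \<in> Sigma0 \<zeta> X"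
proof -
  have "(\<Union>f\<in>Func J C. topspace X \<inter> (\<Inter>j\<in>J. D j (f j))) \<in> Sigma0 \<zeta> X"
  proof (rule Sigma0_Pi0_small_union)
    show "1 < \<zeta>" using assms by simp
    show "|Func J C| \<le>o |UNIV :: 'l set|" using C J unfolding power_bounded_def by blast
    fix f assume "f \<in> Func J C"
    then have "topspace X \<inter> (\<Inter>j\<in>J. D j (f j)) \<in> Pi0 \<eta> X"
      using D(2) by (intro Pi0_small_inter infinite_UNIV eta small_imp_ordLeq J) (auto simp: Func_def)
    then show "\<exists>\<eta><\<zeta>. topspace X \<inter> (\<Inter>j\<in>J. D j (f j)) \<in> Pi0 \<eta> X" using assms(1) by blast
  qed
  moreover have "(\<Union>f\<in>Func J C. topspace X \<inter> (\<Inter>j\<in>J. D j (f j))) = topspace X \<inter> (\<Inter>j\<in>J. B j)"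
  proof (intro equalityI subsetI)
    fix x assume x: "x \<in> topspace X \<inter> (\<Inter>j\<in>J. B j)"
    then have "\<forall>j\<in>J. \<exists>c\<in>C. x \<in> D j c" using D(1) by blast
    then obtain g where g: "\<And>j. j \<in> J \<Longrightarrow> g j \<in> C \<and> x \<in> D j (g j)" by metis
    \<comment> \<open>\<open>Func\<close> prescribes the value \<open>undefined\<close> outside
      \<open>J\<close>.\<close>
    have "(\<lambda>j. if j \<in> J then g j else undefined) \<in> Func J C" using g by (auto simp: Func_def)
    then show "x \<in> (\<Union>f\<in>Func J C. topspace X \<inter> (\<Inter>j\<in>J. D j (f j)))"
      using g x by (intro UN_I) auto
  next
    fix x assume "x \<in> (\<Union>f\<in>Func J C. topspace X \<inter> (\<Inter>j\<in>J. D j (f j)))"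
    then show "x \<in> topspace X \<inter> (\<Inter>j\<in>J. B j)" using D(1) by (fastforce simp: Func_def)
  qed
  ultimately show ?thesis by simp
qed

text \<open>Above level 1 the sets \<open>D c\<close> are unions over initial segments of the order
  \<open>W\<close>. They increase with \<open>c\<close>, so those with \<open>c\<close> in a cofinal
  set suffice. Since \<open>rk\<close> does not depend on \<open>B\<close>, neither does
  \<open>C\<close>.\<close>

lemma Sigma0_decomposition:
  fixes \<eta> :: "'l succ_ord"
  assumes X: "uniform_Fsigma X" and eta: "1 \<le> \<eta>"
    and IH: "\<And>\<zeta> J B. \<lbrakk>1 \<le> \<zeta>; \<zeta> < \<eta>; small J; \<And>j :: 'l. j \<in> J \<Longrightarrow> B j \<in> Sigma0 \<zeta> X\<rbrakk> \<Longrightarrow>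
      topspace X \<inter> (\<Inter>j\<in>J. B j) \<in> Sigma0 \<eta> X"
  obtains C where "power_bounded C"
    "\<And>B. B \<in> Sigma0 \<eta> X \<Longrightarrow> \<exists>D. B = (\<Union>c\<in>C. D c) \<and> (\<forall>c\<in>C. D c \<in> Pi0 \<eta> X)"
proof (cases "\<eta> = 1")
  case True
  from X obtain C where "power_bounded C"
    and "\<forall>U. openin X U \<longrightarrow> (\<exists>D. U = (\<Union>c\<in>C. D c) \<and> (\<forall>c\<in>C. closedin X (D c)))"
    unfolding uniform_Fsigma_def by (elim exE conjE) (rule that)
  then show ?thesis using True by (intro that[of C]) (simp_all add: Sigma0_1 Pi0_1)
next
  case False
  then have gt: "1 < \<eta>" using eta by simp
  note oF = uniform_Fsigma_imp_open_Fsigma[OF X]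
  from Sigma0_normal_form[OF gt, of X] obtain rk :: "'l \<Rightarrow> 'l succ_ord"
    where rk': "\<forall>i. 1 \<le> rk i \<and> rk i < \<eta>"
    and nf: "\<forall>B\<in>Sigma0 \<eta> X. \<exists>A. B = (\<Union>i. A i) \<and> (\<forall>i. A i \<in> Pi0 (rk i) X)"
    by (elim exE conjE) (rule that)
  have rk: "1 \<le> rk i" "rk i < \<eta>" for i using rk' by auto
  define W where "W i c \<longleftrightarrow> rk i < rk c \<or> rk i = rk c \<and> i \<sqsubseteq> c" for i c
  have Wtot: "W a b \<or> W b a" for a b unfolding W_def using L.linear[of a b] by auto
  have Wtrans: "W a c" if "W a b" "W b c" for a b c
    using that L.order_trans[of a b c] unfolding W_def by auto
  have "\<exists>C. power_bounded C \<and> (\<forall>a. \<exists>c\<in>C. W a c)"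
    by (rule ex_power_bounded_cofinal) (fact Wtot, rule Wtrans)
  then obtain C where C: "power_bounded C" "\<And>a. \<exists>c\<in>C. W a c" by blast
  show ?thesis
  proof (rule that[OF C(1)])
    fix B assume "B \<in> Sigma0 \<eta> X"
    from bspec[OF nf this] obtain A where A': "B = (\<Union>i. A i)" "\<forall>i. A i \<in> Pi0 (rk i) X"
      by (elim exE conjE) (rule that)
    have A: "B = (\<Union>i. A i)" "\<And>i. A i \<in> Pi0 (rk i) X" using A' by auto
    have "(\<Union>i\<in>{i. W i c}. A i) \<in> Pi0 \<eta> X" for c
    proof -
      \<comment> \<open>\<open>Pi0_union_initial_segment\<close> covers what comes strictly before
        \<open>c\<close>; \<open>A c\<close> itself is added by closure under finite unions.\<close>
      have "(\<Union>i\<in>{i. rk i < rk c \<or> rk i = rk c \<and> i \<sqsubset> c}. A i) \<in> Pi0 \<eta> X"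
        by (rule Pi0_union_initial_segment[where rk = rk, OF X IH[OF rk] rk A(2)])
      moreover have "A c \<in> Pi0 \<eta> X" using Pi0_mono[OF oF less_imp_le[OF rk(2)] A(2)] .
      ultimately have "(\<Union>i\<in>{i. rk i < rk c \<or> rk i = rk c \<and> i \<sqsubset> c}. A i) \<union> A c \<in> Pi0 \<eta> X"
        by (rule Pi0_Un[OF infinite_UNIV oF])
      moreover have "{i. W i c} = insert c {i. rk i < rk c \<or> rk i = rk c \<and> i \<sqsubset> c}"
        unfolding W_def by auto
      ultimately show ?thesis by (simp add: Un_commute)
    qed
    moreover have "B = (\<Union>c\<in>C. \<Union>i\<in>{i. W i c}. A i)" using C(2) A(1) by fastforce
    ultimately show "\<exists>D. B = (\<Union>c\<in>C. D c) \<and> (\<forall>c\<in>C. D c \<in> Pi0 \<eta> X)"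
      by (intro exI[of _ "\<lambda>c. \<Union>i\<in>{i. W i c}. A i"]) simp
  qed
qed

text \<open>The target level is arbitrary in the induction because the decomposition at level
  \<open>\<eta>\<close> calls for the claim at lower levels with target
  \<open>\<eta>\<close>.\<close>

lemma Sigma0_small_inter:
  fixes \<eta> \<zeta> :: "'l succ_ord"
  assumes X: "uniform_Fsigma X"
  shows "1 \<le> \<eta> \<Longrightarrow> \<eta> < \<zeta> \<Longrightarrow> small J \<Longrightarrow> (\<And>j :: 'l. j \<in> J \<Longrightarrow> B j \<in> Sigma0 \<eta> X) \<Longrightarrow>
    topspace X \<inter> (\<Inter>j\<in>J. B j) \<in> Sigma0 \<zeta> X"
proof (induction \<eta> arbitrary: \<zeta> J B rule: less_induct)
  case (less \<eta>)
  obtain C where C: "power_bounded C"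
    "\<And>B. B \<in> Sigma0 \<eta> X \<Longrightarrow> \<exists>D. B = (\<Union>c\<in>C. D c) \<and> (\<forall>c\<in>C. D c \<in> Pi0 \<eta> X)"
    using Sigma0_decomposition[OF X less.prems(1)] less.IH by metis
  have "\<forall>j\<in>J. \<exists>D. B j = (\<Union>c\<in>C. D c) \<and> (\<forall>c\<in>C. D c \<in> Pi0 \<eta> X)" using C(2) less.prems(4) by simp
  then obtain D where "\<And>j. j \<in> J \<Longrightarrow> B j = (\<Union>c\<in>C. D j c)" "\<And>j c. j \<in> J \<Longrightarrow> c \<in> C \<Longrightarrow> D j c \<in> Pi0 \<eta> X"
    by metis
  then show ?case by (rule Sigma0_inter_of_decompositions[OF less.prems(2,3) C(1) less.prems(1)])
qed

lemma Sigma0_reduction_gt_1: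
  fixes \<xi> :: "'l succ_ord" and X :: "'a topology"
  assumes X: "uniform_Fsigma X" and gt: "1 < \<xi>"
  shows "Sigma0_reduction \<xi> X"
  unfolding Sigma0_reduction_def
proof (intro allI impI)
  fix A :: "'l \<Rightarrow> 'a set" assume A: "\<forall>i. A i \<in> Sigma0 \<xi> X"
  note oF = uniform_Fsigma_imp_open_Fsigma[OF X]
  have "\<forall>i. \<exists>B :: 'l \<Rightarrow> 'a set. A i = (\<Union>j. B j) \<and> (\<forall>j. \<exists>\<zeta><\<xi>. B j \<in> Pi0 \<zeta> X)"
    using A by (simp add: Sigma0_iff_Pi0_union[OF gt])
  then obtain B :: "'l \<Rightarrow> 'l \<Rightarrow> 'a set" where B: "\<And>i. A i = (\<Union>j. B i j)" "\<And>i j. \<exists>\<zeta><\<xi>. B i j \<in> Pi0 \<zeta> X"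
    by metis
  have "|(UNIV :: 'l set) \<times> (UNIV :: 'l set)| \<le>o |UNIV :: 'l set|"
    using infinite_UNIV by (intro card_of_Sigma_ordLeq_infinite) (auto simp: ordLeq_refl card_of_Card_order)
  then obtain e :: "'l \<Rightarrow> 'l \<times> 'l" where e: "range e = UNIV"
    using card_of_ordLeq2[of "UNIV \<times> UNIV :: ('l \<times> 'l) set" "UNIV :: 'l set"] by auto
  \<comment> \<open>All pieces of all the \<open>A i\<close> are put into one sequence;
    \<open>fst (e k)\<close> remembers which set the piece \<open>E k\<close> comes from.\<close>
  define E where "E k = B (fst (e k)) (snd (e k))" for k
  have "\<forall>k. \<exists>\<zeta><\<xi>. E k \<in> Pi0 \<zeta> X" using B(2) by (simp add: E_def)
  then obtain rk where rk: "\<And>k. rk k < \<xi>" and E: "\<And>k. E k \<in> Pi0 (rk k) X" by metis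
  have rk1: "1 \<le> rk k" for k using E[of k] by (auto simp: Pi0_iff dest: Sigma0_ge_1)
  define S where "S c = {i. rk i < rk c \<or> rk i = rk c \<and> i \<sqsubset> c}" for c
  define F where "F c = E c - (\<Union>i\<in>S c. E i)" for c
  have F: "F c \<in> Sigma0 \<xi> X" for c
  proof -
    have "(\<Union>i\<in>S c. E i) \<in> Pi0 \<xi> X"
      unfolding S_def
      by (rule Pi0_union_initial_segment[where rk = rk, OF X Sigma0_small_inter[OF X rk1 rk] rk1 rk E])
    then have "topspace X - (\<Union>i\<in>S c. E i) \<in> Sigma0 \<xi> X" by (simp add: Pi0_iff)
    moreover have "E c \<in> Sigma0 \<xi> X" using Pi0_subset_Sigma0[OF rk E] .
    ultimately have "E c \<inter> (topspace X - (\<Union>i\<in>S c. E i)) \<in> Sigma0 \<xi> X"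
      by (rule Sigma0_Int[OF infinite_UNIV oF, rotated])
    moreover have "E c \<inter> (topspace X - (\<Union>i\<in>S c. E i)) = F c"
      using Pi0_subset_topspace[OF E] by (auto simp: F_def)
    ultimately show ?thesis by simp
  qed
  have S_total: "c \<noteq> d \<Longrightarrow> c \<in> S d \<or> d \<in> S c" for c d
    unfolding S_def using L.linear[of c d] by (auto simp: neq_iff)
  have disj: "c = d" if "x \<in> F c" "x \<in> F d" for c d x
    using that S_total[of c d] by (auto simp: F_def)
  have cover: "\<exists>c. x \<in> F c" if "x \<in> E k" for x k
  proof -
    \<comment> \<open>\<open>x\<close> goes to the first piece that contains it: the least level
      \<open>\<rho>\<close>, then the least index at that level.\<close>
    define \<rho> where "\<rho> = (LEAST r. \<exists>k. rk k = r \<and> x \<in> E k)"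
    have "\<exists>k. rk k = \<rho> \<and> x \<in> E k" unfolding \<rho>_def by (rule LeastI_ex) (use that in blast)
    then obtain c where c: "rk c = \<rho>" "x \<in> E c" and cmin: "\<And>d. d \<sqsubset> c \<Longrightarrow> \<not> (rk d = \<rho> \<and> x \<in> E d)"
      using L.exists_least_iff[of "\<lambda>k. rk k = \<rho> \<and> x \<in> E k"] by blast
    have "x \<notin> E i" if "rk i < rk c" for i
      using not_less_Least[of "rk i" "\<lambda>r. \<exists>k. rk k = r \<and> x \<in> E k"] that unfolding c(1) \<rho>_def by blast
    then have "x \<in> F c" using c cmin by (auto simp: F_def S_def)
    then show ?thesis by blast
  qed
  define A' where "A' i = (\<Union>k\<in>{k. fst (e k) = i}. F k)" for i
  have A': "A' i \<in> Sigma0 \<xi> X" for i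
    unfolding A'_def using F gt by (intro Sigma0_small_union[OF infinite_UNIV]) (auto intro: card_of_mono1)
  have FA: "F k \<subseteq> A (fst (e k))" for k by (auto simp: F_def E_def B(1))
  show "\<exists>A'. (\<forall>i. A' i \<in> Sigma0 \<xi> X \<and> A' i \<subseteq> A i) \<and>
           (\<forall>i j. i \<noteq> j \<longrightarrow> A' i \<inter> A' j = {}) \<and> (\<Union>i. A' i) = (\<Union>i. A i)"
  proof (intro exI[of _ A'] conjI allI impI)
    show "A' i \<subseteq> A i" for i using FA by (auto simp: A'_def)
    show "A' i \<inter> A' j = {}" if "i \<noteq> j" for i j using disj that by (auto simp: A'_def)
    show "(\<Union>i. A' i) = (\<Union>i. A i)"
    proof (intro equalityI subsetI)
      fix x assume "x \<in> (\<Union>i. A i)"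
      then obtain i j where "x \<in> B i j" using B(1) by auto
      moreover obtain k where "e k = (i, j)" using e by (metis UNIV_I imageE)
      ultimately have "x \<in> E k" by (simp add: E_def)
      then show "x \<in> (\<Union>i. A' i)" using cover by (auto simp: A'_def)
    qed (use FA in \<open>auto simp: A'_def\<close>)
  qed (rule A')
qed

end

section \<open>Metrics, filtrations and reduction of open sets\<close>

definition G_metrized :: "('a \<Rightarrow> 'a \<Rightarrow> 'g::linordered_field) \<Rightarrow> 'a topology \<Rightarrow> bool" where
  "G_metrized d X \<longleftrightarrow> G_metric (topspace X) d \<and>
     (\<forall>U. openin X U \<longleftrightarrow> U \<subseteq> topspace X \<and>
        (\<forall>x\<in>U. \<exists>e>0. \<forall>y\<in>topspace X. d x y < e \<longrightarrow> y \<in> U))"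

lemma G_metrizable_space_iff: "G_metrizable_space TYPE('g::linordered_field) X \<longleftrightarrow> (\<exists>d :: _ \<Rightarrow> _ \<Rightarrow> 'g. G_metrized d X)"
  unfolding G_metrizable_space_def G_metrized_def ..

lemma G_metrized_mtopology:
  assumes "Metric_space M d"
  shows "G_metrized d (Metric_space.mtopology M d)"
proof -
  interpret Metric_space M d by fact
  show ?thesis
    unfolding G_metrized_def
  proof (intro conjI allI)
    show "G_metric (topspace mtopology) d" unfolding G_metric_def using commute triangle by simp
    show "openin mtopology U \<longleftrightarrow> U \<subseteq> topspace mtopology \<and>
        (\<forall>x\<in>U. \<exists>e>0. \<forall>y\<in>topspace mtopology. d x y < e \<longrightarrow> y \<in> U)" for U
      unfolding openin_mtopology by (fastforce simp: subset_iff)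
  qed
qed

lemma ultrametrizable_imp_metrizable_space:
  assumes "ultrametrizable_space X"
  shows "metrizable_space X"
  using assms unfolding ultrametrizable_space_def metrizable_space_def by blast

lemma ultrametrizable_spaceI:
  fixes d :: "'a \<Rightarrow> 'a \<Rightarrow> real"
  assumes d: "G_metrized d X"
    and ultra: "\<And>x y z. x \<in> topspace X \<Longrightarrow> y \<in> topspace X \<Longrightarrow> z \<in> topspace X \<Longrightarrow> d x z \<le> max (d x y) (d y z)"
  shows "ultrametrizable_space X"
proof -
  let ?M = "topspace X"
  \<comment> \<open>\<open>Metric_space\<close> asks for nonnegativity and symmetry at all points of
    the type, while \<open>G_metrized\<close> controls \<open>d\<close> only on the space.\<close>
  define d' where "d' x y = (if x \<in> ?M \<and> y \<in> ?M then d x y else 0)" for x y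
  have gm: "G_metric ?M d" using d by (simp add: G_metrized_def)
  interpret Metric_space ?M d'
    using gm by unfold_locales (auto simp: d'_def G_metric_def)
  have "openin X U \<longleftrightarrow> openin mtopology U" for U
  proof -
    have "openin X U \<longleftrightarrow> U \<subseteq> ?M \<and> (\<forall>x\<in>U. \<exists>e>0. \<forall>y\<in>?M. d x y < e \<longrightarrow> y \<in> U)"
      using d by (simp add: G_metrized_def)
    also have "\<dots> \<longleftrightarrow> openin mtopology U"
      unfolding openin_mtopology by (fastforce simp: subset_iff d'_def)
    finally show ?thesis .
  qed
  then have "X = mtopology" by (simp add: topology_eq)
  moreover have "\<forall>x\<in>?M. \<forall>y\<in>?M. \<forall>z\<in>?M. d' x z \<le> max (d' x y) (d' y z)"
    using ultra by (simp add: d'_def)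
  ultimately show ?thesis
    unfolding ultrametrizable_space_def using Metric_space_axioms by blast
qed

definition pos_coinitial :: "'g::linordered_field set \<Rightarrow> bool" where
  "pos_coinitial C \<longleftrightarrow> C \<subseteq> {0<..} \<and> (\<forall>x>0. \<exists>c\<in>C. c \<le> x)"

lemma pos_coinitiality_attained:
  "\<exists>D :: 'g::linordered_field set. pos_coinitial D \<and> pos_coinitiality TYPE('g) = |D| \<and>
     (\<forall>B :: 'g set. pos_coinitial B \<longrightarrow> |D| \<le>o |B| )"
proof -
  have eq: "pos_coinitiality TYPE('g) = min_card (pos_coinitial :: 'g set \<Rightarrow> bool)"
    by (simp add: pos_coinitiality_def pos_coinitial_def[abs_def])
  have "pos_coinitial {0 :: 'g <..}" by (auto simp: pos_coinitial_def)
  from min_card_attained[of pos_coinitial, OF this] show ?thesis unfolding eq .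
qed

lemma infinite_pos_coinitial:
  fixes D :: "'g::linordered_field set"
  assumes "pos_coinitial D"
  shows "infinite D"
proof
  have D: "D \<subseteq> {0<..}" "\<forall>x>0. \<exists>c\<in>D. c \<le> x" using assms by (auto simp: pos_coinitial_def)
  assume fin: "finite D"
  have "D \<noteq> {}" using D(2) zero_less_one by blast
  then have "Min D \<in> D" using fin by simp
  then have pos: "0 < Min D" using D(1) by auto
  then obtain c where "c \<in> D" "c \<le> Min D / 2" using D(2) half_gt_zero by blast
  moreover from this have "Min D \<le> c" using fin by simp
  ultimately show False using pos by (simp add: field_simps)
qed

text \<open>Makes \<mu> = \<omega> an instance of \<open>ex_radius\<close>, with the reals as the
  field.\<close>

lemma pos_coinitiality_real: "pos_coinitiality TYPE(real) =o natLeq"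
proof -
  have N: "pos_coinitial (range (\<lambda>n. 1 / real (Suc n)))"
    unfolding pos_coinitial_def
  proof (intro conjI allI impI)
    fix x :: real assume "0 < x"
    then obtain n where "1 / real (Suc n) < x" using nat_approx_posE by blast
    then show "\<exists>c\<in>range (\<lambda>n. 1 / real (Suc n)). c \<le> x" by (auto intro: less_imp_le)
  qed auto
  from pos_coinitiality_attained[where 'g = real] obtain D :: "real set"
    where D: "pos_coinitial D" "pos_coinitiality TYPE(real) = |D|" "\<forall>B :: real set. pos_coinitial B \<longrightarrow> |D| \<le>o |B|"
    by (elim exE conjE) (rule that)
  have "|D| \<le>o |range (\<lambda>n. 1 / real (Suc n))|" using D(3) N by simp
  also have "|range (\<lambda>n. 1 / real (Suc n))| \<le>o |UNIV :: nat set|" by (rule card_of_image)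
  also have "|UNIV :: nat set| =o natLeq" by (rule card_of_nat)
  finally have "|D| \<le>o natLeq" .
  moreover have "natLeq \<le>o |D|"
    using infinite_pos_coinitial[OF D(1)] infinite_iff_natLeq_ordLeq[of D] by blast
  ultimately show ?thesis unfolding D(2) by (simp add: ordIso_iff_ordLeq)
qed

section \<open>Radii, and open sets as uniform unions of closed sets\<close>

context lambda_cardinal
begin

text \<open>Indexed by all of \<lambda> instead of a cofinal set of size \<mu>, so that balls,
  filtrations and the tree space share one index set. The price is that \<open>\<rho>\<close>
  decreases only weakly.\<close>

definition radius :: "('l \<Rightarrow> 'g::linordered_field) \<Rightarrow> bool" where
  "radius \<rho> \<longleftrightarrow> (\<forall>a. 0 < \<rho> a) \<and> (\<forall>a b. a \<sqsubseteq> b \<longrightarrow> \<rho> b \<le> \<rho> a) \<and> (\<forall>e>0. \<exists>a. \<rho> a < e)"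

lemma finite_bounded: "finite K \<Longrightarrow> \<exists>a. \<forall>k\<in>K. k \<sqsubseteq> a"
proof (induction K rule: finite_induct)
  case (insert k K)
  then obtain a where a: "\<forall>k\<in>K. k \<sqsubseteq> a" by blast
  show ?case
  proof (cases "a \<sqsubseteq> k")
    case True
    then show ?thesis using a L.order_trans by (intro exI[of _ k]) blast
  next
    case False
    then show ?thesis using a L.linear by (intro exI[of _ a]) blast
  qed
qed simp

lemma cofinal_infinite:
  assumes "cofinal K lam"
  shows "infinite K"
proof
  assume "finite K"
  then obtain a where a: "\<forall>k\<in>K. k \<sqsubseteq> a" using finite_bounded by blast
  obtain k where "k \<in> K" "a \<noteq> k" "a \<sqsubseteq> k" using assms unfolding cofinal_def Field_lam by blast
  then show False using a L.order_antisym by blast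
qed

lemma cof_attained:
  "\<exists>K. cofinal K lam \<and> cof lam = |K| \<and> (\<forall>B. cofinal B lam \<longrightarrow> |K| \<le>o |B| )"
proof -
  have "cofinal UNIV lam" using ex_greater by (auto simp: cofinal_def Field_lam)
  from min_card_attained[of "\<lambda>A. cofinal A lam", OF this] show ?thesis
    unfolding cof_def by (simp add: Field_lam)
qed

lemma cof_cases: "cof lam =o natLeq \<or> natLeq <o cof lam"
proof -
  from cof_attained obtain K where "cofinal K lam" "cof lam = |K|" by (elim exE conjE) (rule that)
  then have "natLeq \<le>o cof lam" using cofinal_infinite[of K] infinite_iff_natLeq_ordLeq[of K] by auto
  then show ?thesis using ordLeq_iff_ordLess_or_ordIso ordIso_symmetric by blast
qed

text \<open>Both \<open>K\<close> and \<open>D\<close> have size \<mu>, the least possible.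
  \<open>K\<close> is ordered in type \<mu> by \<open>r\<close>, an index \<open>a\<close> is sent
  to a position \<open>ix a\<close> in \<open>r\<close>, and the radius at \<open>a\<close> is a
  value of \<open>\<phi>\<close> that is at most all values at earlier positions. It exists because
  fewer than \<mu> values are not coinitial, and \<open>ix\<close> is unbounded in \<open>r\<close>
  because fewer than \<mu> elements are not cofinal in \<lambda>.\<close>

lemma ex_radius:
  assumes "pos_coinitiality TYPE('g::linordered_field) =o cof lam"
  shows "\<exists>\<rho> :: 'l \<Rightarrow> 'g. radius \<rho>"
proof -
  from cof_attained obtain K where K: "cofinal K lam" "cof lam = |K|" "\<forall>B. cofinal B lam \<longrightarrow> |K| \<le>o |B|"
    by (elim exE conjE) (rule that)
  from pos_coinitiality_attained[where 'g = 'g] obtain D :: "'g set"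
    where D': "pos_coinitial D" "pos_coinitiality TYPE('g) = |D|" "\<forall>B :: 'g set. pos_coinitial B \<longrightarrow> |D| \<le>o |B|"
    by (elim exE conjE) (rule that)
  have D: "D \<subseteq> {0<..}" "\<And>x. x > 0 \<Longrightarrow> \<exists>c\<in>D. c \<le> x" using D'(1) by (auto simp: pos_coinitial_def)
  \<comment> \<open>As a cardinal, \<open>r\<close> has proper initial segments smaller than
    \<open>K\<close>; it need not agree with the order of \<lambda> on \<open>K\<close>.\<close>
  define r where "r = |K|"
  have "|K| =o |D|" using assms ordIso_symmetric unfolding K(2) D'(2) by blast
  then obtain \<phi> where \<phi>: "bij_betw \<phi> K D" using card_of_ordIso by blast
  then have \<phi>D: "\<phi> ` K = D" by (simp add: bij_betw_def)
  have Fr: "Field r = K" and Cr: "Card_order r"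
    using card_of_Card_order[of K] by (simp_all add: r_def Field_card_of)
  have wr: "wo_rel r" using card_of_Well_order[of K] by (simp add: wo_rel_def r_def)
  have infK: "infinite K" by (rule cofinal_infinite[OF K(1)])
  have cof: "\<exists>k\<in>K. a \<sqsubset> k" for a using K(1) unfolding cofinal_def Field_lam by blast
  have trans_r: "trans r" and antisym_r: "antisym r"
    using wr by (simp_all add: wo_rel.TRANS wo_rel.ANTISYM)
  define I where "I a = {i\<in>K. a \<sqsubseteq> i}" for a
  define ix where "ix a = wo_rel.minim r (I a)" for a
  have I_ne: "I a \<noteq> {}" "I a \<subseteq> Field r" for a using cof[of a] by (auto simp: I_def Fr)
  have ix: "ix a \<in> K" "a \<sqsubseteq> ix a" for a
    using wo_rel.minim_in[OF wr I_ne(2,1), of a] by (auto simp: I_def ix_def)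
  have ix_mono: "(ix a, ix b) \<in> r" if "a \<sqsubseteq> b" for a b
  proof -
    have "ix b \<in> I a" using ix[of b] L.order_trans[OF that] by (auto simp: I_def)
    then show ?thesis unfolding ix_def[of a] by (rule wo_rel.minim_least[OF wr I_ne(2)])
  qed
  define J where "J i = {j\<in>K. \<forall>j'\<in>underS r i. \<phi> j \<le> \<phi> j'}" for i
  have underS_K: "underS r i \<subseteq> K" for i using Fr by (auto simp: underS_def Field_def)
  have underS_small: "|underS r i| <o |K|" if "i \<in> K" for i
    using card_of_underS[OF Cr] that Fr by (simp add: r_def)
  have J_ne: "J i \<noteq> {}" if "i \<in> K" for i
  proof -
    have "|\<phi> ` underS r i| <o |K|"
      using card_of_image underS_small[OF that] by (rule ordLeq_ordLess_trans)
    then have "|\<phi> ` underS r i| <o |D|" using \<open>|K| =o |D|\<close> by (rule ordLess_ordIso_trans)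
    then have "\<not> |D| \<le>o |\<phi> ` underS r i|" using not_ordLess_ordLeq by blast
    then have "\<not> pos_coinitial (\<phi> ` underS r i)" using D'(3) by blast
    moreover have "\<phi> ` underS r i \<subseteq> {0<..}" using underS_K[of i] \<phi>D D(1) by blast
    ultimately obtain x where x: "x > 0" "\<And>j'. j' \<in> underS r i \<Longrightarrow> x < \<phi> j'" by (auto simp: not_le pos_coinitial_def)
    obtain c where "c \<in> D" "c \<le> x" using D(2)[OF x(1)] by blast
    then obtain j where "j \<in> K" "\<phi> j \<le> x" using \<phi>D by blast
    then have "j \<in> J i" using x(2) by (force simp: J_def)
    then show ?thesis by blast
  qed
  have J_sub: "J i \<subseteq> Field r" for i by (auto simp: J_def Fr)
  \<comment> \<open>Taking the \<open>r\<close>-least candidate gives monotonicity: if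
    \<open>jx a\<close> is still a candidate at a later \<open>b\<close>, it is still the least one;
    if not, some \<open>\<phi> j'\<close> has dropped below \<open>\<phi> (jx a)\<close>, and
    \<open>\<phi> (jx b)\<close> is at most \<open>\<phi> j'\<close>.\<close>
  define jx where "jx a = wo_rel.minim r (J (ix a))" for a
  have jx: "jx a \<in> J (ix a)" for a
    unfolding jx_def by (rule wo_rel.minim_in[OF wr J_sub J_ne[OF ix(1)]])
  have jxK: "jx a \<in> K" for a using jx[of a] by (simp add: J_def)
  have mono: "\<phi> (jx b) \<le> \<phi> (jx a)" if "a \<sqsubseteq> b" for a b
  proof (cases "jx a \<in> J (ix b)")
    case True
    then have 1: "(jx b, jx a) \<in> r" unfolding jx_def[of b] by (rule wo_rel.minim_least[OF wr J_sub])
    have "underS r (ix a) \<subseteq> underS r (ix b)"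
    proof
      fix x assume "x \<in> underS r (ix a)"
      then have x: "x \<noteq> ix a" "(x, ix a) \<in> r" by (auto simp: underS_def)
      have "(x, ix b) \<in> r" using x(2) ix_mono[OF that] transD[OF trans_r] by blast
      moreover have "x \<noteq> ix b" using x ix_mono[OF that] antisymD[OF antisym_r] by blast
      ultimately show "x \<in> underS r (ix b)" by (simp add: underS_def)
    qed
    then have "jx b \<in> J (ix a)" using jx[of b] by (auto simp: J_def)
    then have "(jx a, jx b) \<in> r" unfolding jx_def[of a] by (rule wo_rel.minim_least[OF wr J_sub])
    then have "jx a = jx b" using 1 antisymD[OF antisym_r] by blast
    then show ?thesis by simp
  next
    case False
    then obtain j' where j': "j' \<in> underS r (ix b)" "\<phi> j' < \<phi> (jx a)"
      using jxK[of a] by (auto simp: J_def not_le)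
    have "\<phi> (jx b) \<le> \<phi> j'" using jx[of b] j'(1) by (auto simp: J_def)
    then show ?thesis using j'(2) by simp
  qed
  have coin: "\<exists>a. \<phi> (jx a) < e" if e0: "e > 0" for e
  proof -
    \<comment> \<open>Half of \<open>e\<close> turns the weak inequality of coinitiality into the
      strict one of \<open>radius\<close>.\<close>
    obtain c where c: "c \<in> D" "c \<le> e / 2" using D(2)[OF half_gt_zero[OF e0]] by blast
    then obtain j0 where j0: "j0 \<in> K" "\<phi> j0 = c" using \<phi>D by blast
    obtain i1 where i1: "i1 \<in> K" "j0 \<in> underS r i1"
      using infinite_Card_order_limit[OF Cr, of j0] infK j0(1) unfolding Fr underS_def by blast
    have "\<not> |K| \<le>o |underS r i1|" using underS_small[OF i1(1)] not_ordLess_ordLeq by blast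
    then have "\<not> cofinal (underS r i1) lam" using K(3) by blast
    then obtain a where a: "\<And>k. k \<in> underS r i1 \<Longrightarrow> \<not> a \<sqsubset> k" unfolding cofinal_def by blast
    obtain b where b: "a \<sqsubset> b" using ex_greater by blast
    have "a \<sqsubset> ix b" using L.less_le_trans[OF b ix(2)] .
    then have "ix b \<notin> underS r i1" using a by blast
    then have 1: "(i1, ix b) \<in> r"
      using wo_rel.TOTALS[OF wr] ix(1)[of b] i1(1) unfolding Fr underS_def by blast
    have "(j0, ix b) \<in> r" using i1(2) 1 transD[OF trans_r] by (auto simp: underS_def)
    moreover have "j0 \<noteq> ix b" using i1(2) 1 antisymD[OF antisym_r] by (auto simp: underS_def)
    ultimately have "\<phi> (jx b) \<le> \<phi> j0" using jx[of b] by (auto simp: J_def underS_def)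
    then have "\<phi> (jx b) < e" using c(2) j0(2) e0 by (simp add: field_simps)
    then show ?thesis by blast
  qed
  have "0 < \<phi> (jx a)" for a using jxK[of a] \<phi>D D(1) by blast
  then have "radius (\<lambda>a. \<phi> (jx a))" unfolding radius_def using mono coin by blast
  then show ?thesis by blast
qed

lemma ex_radius_real:
  assumes "cof lam =o natLeq"
  shows "\<exists>\<rho> :: 'l \<Rightarrow> real. radius \<rho>"
  by (rule ex_radius[OF ordIso_transitive[OF pos_coinitiality_real ordIso_symmetric[OF assms]]])

text \<open>The closed sets for \<open>U\<close> are the sets \<open>D c\<close> of points whose
  ball of radius \<open>\<rho> c\<close> lies in \<open>U\<close>. They grow with \<open>c\<close>,
  so \<open>c\<close> may be restricted to a power bounded cofinal subset of \<lambda>.\<close>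

lemma G_metrized_uniform_Fsigma:
  fixes d :: "'a \<Rightarrow> 'a \<Rightarrow> 'g::linordered_field" and \<rho> :: "'l \<Rightarrow> 'g"
  assumes d: "G_metrized d X" and \<rho>: "radius \<rho>"
  shows "uniform_Fsigma X"
proof -
  let ?M = "topspace X"
  have op: "openin X U \<longleftrightarrow> U \<subseteq> ?M \<and> (\<forall>x\<in>U. \<exists>e>0. \<forall>y\<in>?M. d x y < e \<longrightarrow> y \<in> U)" for U
    using d by (simp add: G_metrized_def)
  have refl: "x \<in> ?M \<Longrightarrow> d x x = 0"
    and tri: "x \<in> ?M \<Longrightarrow> y \<in> ?M \<Longrightarrow> z \<in> ?M \<Longrightarrow> d x z \<le> d x y + d y z"
    and sym: "x \<in> ?M \<Longrightarrow> y \<in> ?M \<Longrightarrow> d x y = d y x" for x y z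
    using d by (auto simp: G_metrized_def G_metric_def)
  have \<rho>0: "0 < \<rho> a" and \<rho>m: "a \<sqsubseteq> b \<Longrightarrow> \<rho> b \<le> \<rho> a" and \<rho>c: "0 < e \<Longrightarrow> \<exists>a. \<rho> a < e" for a b e
    using \<rho> by (auto simp: radius_def)
  have "\<exists>C. power_bounded C \<and> (\<forall>a. \<exists>c\<in>C. a \<sqsubseteq> c)"
    by (rule ex_power_bounded_cofinal) (fact L.linear, rule L.order_trans)
  then obtain C where C: "power_bounded C" "\<And>a. \<exists>c\<in>C. a \<sqsubseteq> c" by blast
  show ?thesis
    unfolding uniform_Fsigma_def
  proof (intro exI[of _ C] conjI allI impI)
    fix U assume U: "openin X U"
    define D where "D c = {x\<in>?M. \<forall>y\<in>?M. d x y < \<rho> c \<longrightarrow> y \<in> U}" for c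
    have "closedin X (D c)" for c
    proof -
      have "openin X (?M - D c)"
        unfolding op
      proof (intro conjI ballI)
        fix x assume "x \<in> ?M - D c"
        then obtain y where y: "x \<in> ?M" "y \<in> ?M" "d x y < \<rho> c" "y \<notin> U" by (auto simp: D_def)
        have "z \<in> ?M - D c" if z: "z \<in> ?M" "d x z < \<rho> c - d x y" for z
        proof -
          have "d z y \<le> d x z + d x y" using tri[of z x y] sym[of x z] z(1) y(1,2) by simp
          then have "d z y < \<rho> c" using z(2) by simp
          then show ?thesis using y z(1) by (auto simp: D_def)
        qed
        then show "\<exists>e>0. \<forall>z\<in>?M. d x z < e \<longrightarrow> z \<in> ?M - D c"
          using y(3) by (intro exI[of _ "\<rho> c - d x y"]) auto
      qed auto
      then show ?thesis by (auto simp: closedin_def D_def)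
    qed
    moreover have "U = (\<Union>c\<in>C. D c)"
    proof (intro equalityI subsetI)
      fix x assume x: "x \<in> U"
      then obtain e where e: "e > 0" "\<And>y. y \<in> ?M \<Longrightarrow> d x y < e \<Longrightarrow> y \<in> U" using U[unfolded op] by blast
      obtain a where a: "\<rho> a < e" using \<rho>c[OF e(1)] by blast
      obtain c where c: "c \<in> C" "a \<sqsubseteq> c" using C(2) by blast
      have "\<rho> c < e" using \<rho>m[OF c(2)] a by simp
      moreover have "x \<in> ?M" using x openin_subset[OF U] by blast
      ultimately have "x \<in> D c" using e(2) by (auto simp: D_def)
      then show "x \<in> (\<Union>c\<in>C. D c)" using c(1) by blast
    next
      fix x assume "x \<in> (\<Union>c\<in>C. D c)"
      then show "x \<in> U" using \<rho>0 refl by (auto simp: D_def)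
    qed
    ultimately show "\<exists>D. U = (\<Union>c\<in>C. D c) \<and> (\<forall>c\<in>C. closedin X (D c))"
      by (intro exI[of _ D]) simp
  qed (rule C(1))
qed

section \<open>Filtrations by equivalence relations\<close>

text \<open>A common form of ultrametrics, of metrics over a field of uncountable coinitiality and
  of the tree space: the classes are clopen and form a base. Distinct points may stay equivalent
  throughout; where a metric or the Hausdorff property is wanted, separation of points is a
  hypothesis of its own.\<close>

definition filtration :: "('l \<Rightarrow> 'a \<Rightarrow> 'a \<Rightarrow> bool) \<Rightarrow> 'a topology \<Rightarrow> bool" where
  "filtration E X \<longleftrightarrow>
     (\<forall>a. \<forall>x\<in>topspace X. E a x x) \<and>
     (\<forall>a. \<forall>x\<in>topspace X. \<forall>y\<in>topspace X. E a x y \<longrightarrow> E a y x) \<and>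
     (\<forall>a. \<forall>x\<in>topspace X. \<forall>y\<in>topspace X. \<forall>z\<in>topspace X. E a x y \<longrightarrow> E a y z \<longrightarrow> E a x z) \<and>
     (\<forall>a b. a \<sqsubseteq> b \<longrightarrow> (\<forall>x\<in>topspace X. \<forall>y\<in>topspace X. E b x y \<longrightarrow> E a x y)) \<and>
     (\<forall>U. openin X U \<longleftrightarrow> U \<subseteq> topspace X \<and> (\<forall>x\<in>U. \<exists>a. \<forall>y\<in>topspace X. E a x y \<longrightarrow> y \<in> U))"

lemma filtration_reduction:
  fixes X :: "'a topology"
  assumes E: "filtration E X"
  shows "Sigma0_reduction (1 :: 'l succ_ord) X"
  unfolding Sigma0_reduction_def
proof (intro allI impI)
  let ?M = "topspace X"
  have refl: "x \<in> ?M \<Longrightarrow> E a x x"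
    and sym: "x \<in> ?M \<Longrightarrow> y \<in> ?M \<Longrightarrow> E a x y \<Longrightarrow> E a y x"
    and trans: "x \<in> ?M \<Longrightarrow> y \<in> ?M \<Longrightarrow> z \<in> ?M \<Longrightarrow> E a x y \<Longrightarrow> E a y z \<Longrightarrow> E a x z" for a x y z
    using E unfolding filtration_def by metis+
  have anti: "a \<sqsubseteq> b \<Longrightarrow> x \<in> ?M \<Longrightarrow> y \<in> ?M \<Longrightarrow> E b x y \<Longrightarrow> E a x y" for a b x y
    using E unfolding filtration_def by metis
  have op: "openin X U \<longleftrightarrow> U \<subseteq> ?M \<and> (\<forall>x\<in>U. \<exists>a. \<forall>y\<in>?M. E a x y \<longrightarrow> y \<in> U)" for U
    using E unfolding filtration_def by metis
  fix A :: "'l \<Rightarrow> 'a set" assume "\<forall>i. A i \<in> Sigma0 (1 :: 'l succ_ord) X"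
  then have A: "openin X (A i)" for i by (simp add: Sigma0_1)
  then have AM: "A i \<subseteq> ?M" for i using openin_subset by blast
  define P where "P a x i \<longleftrightarrow> (\<forall>y\<in>?M. E a x y \<longrightarrow> y \<in> A i)" for a x i
  have P_cong: "P a x i \<longleftrightarrow> P a y i" if "x \<in> ?M" "y \<in> ?M" "E a x y" for a x y i
    unfolding P_def using that sym trans by blast
  define \<alpha> where "\<alpha> x = L.Least (\<lambda>a. \<exists>i. P a x i)" for x
  define \<iota> where "\<iota> x = L.Least (\<lambda>i. P (\<alpha> x) x i)" for x
  have ex: "\<exists>a i. P a x i" if "x \<in> A i" for x i using that A[of i, unfolded op] unfolding P_def by blast
  have \<alpha>: "\<exists>i. P (\<alpha> x) x i" if "x \<in> A i" for x i
    unfolding \<alpha>_def by (rule L.LeastI_ex) (use ex[OF that] in blast)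
  have \<iota>: "P (\<alpha> x) x (\<iota> x)" if "x \<in> A i" for x i
    unfolding \<iota>_def by (rule L.LeastI_ex) (rule \<alpha>[OF that])
  have \<alpha>_le: "\<alpha> x \<sqsubseteq> a" if "P a x i" for a x i
    unfolding \<alpha>_def by (rule L.Least_le) (use that in blast)
  \<comment> \<open>This makes the sets \<open>A' i\<close> open. The class of \<open>x\<close> at
    \<open>\<alpha> x\<close> is also that of \<open>y\<close>, so \<open>\<alpha> y\<close> is not
    later; then \<open>x\<close> and \<open>y\<close> are equivalent at \<open>\<alpha> y\<close>
    too, and the same argument gives the converse.\<close>
  have const: "\<alpha> y = \<alpha> x \<and> \<iota> y = \<iota> x" if x: "x \<in> A i" and y: "y \<in> ?M" "E (\<alpha> x) x y" for x y i
  proof -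
    have xM: "x \<in> ?M" using x AM by blast
    have Py: "P (\<alpha> x) y j \<longleftrightarrow> P (\<alpha> x) x j" for j using P_cong[OF xM y] by blast
    obtain j where j: "P (\<alpha> x) y j" using \<iota>[OF x] Py by blast
    then have yA: "y \<in> A j" using y(1) refl unfolding P_def by blast
    have le: "\<alpha> y \<sqsubseteq> \<alpha> x" using \<alpha>_le[OF j] .
    have "E (\<alpha> y) x y" using anti[OF le xM y(1,2)] .
    then have "P (\<alpha> y) x (\<iota> y)" using \<iota>[OF yA] P_cong[OF xM y(1)] by blast
    then have "\<alpha> x \<sqsubseteq> \<alpha> y" by (rule \<alpha>_le)
    then have eq: "\<alpha> y = \<alpha> x" using le L.order_antisym by blast
    then show ?thesis using Py by (simp add: \<iota>_def)
  qed
  define A' where "A' i = {x \<in> (\<Union>j. A j). \<iota> x = i}" for i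
  have sub: "A' i \<subseteq> A i" for i
  proof
    fix x assume "x \<in> A' i"
    then obtain j where j: "x \<in> A j" "\<iota> x = i" by (auto simp: A'_def)
    have "x \<in> ?M" using j(1) AM by blast
    then show "x \<in> A i" using \<iota>[OF j(1)] refl j(2) by (auto simp: P_def)
  qed
  have "openin X (A' i)" for i
    unfolding op
  proof (intro conjI ballI)
    show "A' i \<subseteq> ?M" using sub AM by blast
    fix x assume x: "x \<in> A' i"
    then obtain j where j: "x \<in> A j" "\<iota> x = i" by (auto simp: A'_def)
    have "y \<in> A' i" if y: "y \<in> ?M" "E (\<alpha> x) x y" for y
    proof -
      have "y \<in> A (\<iota> x)" using \<iota>[OF j(1)] y by (simp add: P_def)
      then show ?thesis using const[OF j(1) y] j(2) by (auto simp: A'_def)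
    qed
    then show "\<exists>a. \<forall>y\<in>?M. E a x y \<longrightarrow> y \<in> A' i" by blast
  qed
  moreover have "A' i \<inter> A' j = {}" if "i \<noteq> j" for i j using that by (auto simp: A'_def)
  moreover have "(\<Union>i. A' i) = (\<Union>i. A i)" by (auto simp: A'_def)
  ultimately show "\<exists>A'. (\<forall>i. A' i \<in> Sigma0 1 X \<and> A' i \<subseteq> A i) \<and>
      (\<forall>i j. i \<noteq> j \<longrightarrow> A' i \<inter> A' j = {}) \<and> (\<Union>i. A' i) = (\<Union>i. A i)"
    using sub by (intro exI[of _ A']) (simp add: Sigma0_1)
qed

text \<open>Being infinitesimal relative to \<open>\<rho> a\<close> is transitive, and it is an open condition because
  the coinitiality is uncountable.\<close>

lemma G_metrized_filtration:
  fixes d :: "'a \<Rightarrow> 'a \<Rightarrow> 'g::linordered_field" and \<rho> :: "'l \<Rightarrow> 'g"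
  assumes d: "G_metrized d X" and \<rho>: "radius \<rho>" and unc: "natLeq <o pos_coinitiality TYPE('g)"
  shows "filtration (\<lambda>a x y. \<forall>n. of_nat n * d x y < \<rho> a) X"
proof -
  let ?M = "topspace X"
  let ?E = "\<lambda>a x y. \<forall>n. of_nat n * d x y < \<rho> a"
  have op: "openin X U \<longleftrightarrow> U \<subseteq> ?M \<and> (\<forall>x\<in>U. \<exists>e>0. \<forall>y\<in>?M. d x y < e \<longrightarrow> y \<in> U)" for U
    using d by (simp add: G_metrized_def)
  have refl: "x \<in> ?M \<Longrightarrow> d x x = 0"
    and tri: "x \<in> ?M \<Longrightarrow> y \<in> ?M \<Longrightarrow> z \<in> ?M \<Longrightarrow> d x z \<le> d x y + d y z"
    and sym: "x \<in> ?M \<Longrightarrow> y \<in> ?M \<Longrightarrow> d x y = d y x" for x y z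
    using d by (auto simp: G_metrized_def G_metric_def)
  have \<rho>0: "0 < \<rho> a" and \<rho>m: "a \<sqsubseteq> b \<Longrightarrow> \<rho> b \<le> \<rho> a" and \<rho>c: "0 < e \<Longrightarrow> \<exists>a. \<rho> a < e" for a b e
    using \<rho> by (auto simp: radius_def)
  have trans: "?E a x z" if M: "x \<in> ?M" "y \<in> ?M" "z \<in> ?M" and E: "?E a x y" "?E a y z" for a x y z
  proof
    fix n
    \<comment> \<open>Using the assumptions at \<open>2 * n\<close> absorbs the factor 2 from the
      sum of two distances.\<close>
    have "2 * (of_nat n * d x z) \<le> of_nat (2 * n) * d x y + of_nat (2 * n) * d y z"
      using mult_left_mono[OF tri[OF M], of "2 * of_nat n"] by (simp add: algebra_simps)
    also have "\<dots> < \<rho> a + \<rho> a" using E by (intro add_strict_mono) blast+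
    finally show "of_nat n * d x z < \<rho> a" by simp
  qed
  have small_ball: "\<exists>e>0. \<forall>n. of_nat n * e < \<rho> a" for a
  proof -
    \<comment> \<open>This set is countable, so it is not coinitial; a positive \<open>e\<close>
      below all its members is infinitesimal relative to \<open>\<rho> a\<close>.\<close>
    let ?N = "range (\<lambda>n. \<rho> a / of_nat (Suc n))"
    from pos_coinitiality_attained[where 'g = 'g] obtain D :: "'g set"
      where "pos_coinitial D" and D: "pos_coinitiality TYPE('g) = |D|" "\<forall>B :: 'g set. pos_coinitial B \<longrightarrow> |D| \<le>o |B|"
      by (elim exE conjE) (rule that)
    have "\<not> pos_coinitial ?N"
    proof
      assume "pos_coinitial ?N"
      then have "|D| \<le>o |?N|" using D(2) by blast
      also have "|?N| \<le>o |UNIV :: nat set|" by (rule card_of_image)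
      also have "|UNIV :: nat set| =o natLeq" by (rule card_of_nat)
      finally show False using unc not_ordLess_ordLeq unfolding D(1) by blast
    qed
    moreover have "?N \<subseteq> {0<..}" using \<rho>0 by (auto simp: zero_less_divide_iff simp del: of_nat_Suc)
    ultimately obtain e where e: "e > 0" "\<And>n. e < \<rho> a / of_nat (Suc n)" by (auto simp: not_le pos_coinitial_def)
    have "of_nat n * e < \<rho> a" for n
    proof -
      have "of_nat n * e \<le> of_nat (Suc n) * e" using e(1) by (intro mult_right_mono) auto
      also have "\<dots> < \<rho> a" using e(2)[of n] by (simp add: field_simps del: of_nat_Suc)
      finally show ?thesis .
    qed
    then show ?thesis using e(1) by blast
  qed
  have op': "openin X U \<longleftrightarrow> U \<subseteq> ?M \<and> (\<forall>x\<in>U. \<exists>a. \<forall>y\<in>?M. ?E a x y \<longrightarrow> y \<in> U)" for U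
    unfolding op
  proof (intro conj_cong refl ball_cong iffI)
    fix x assume "x \<in> U" "U \<subseteq> ?M"
    { assume "\<exists>e>0. \<forall>y\<in>?M. d x y < e \<longrightarrow> y \<in> U"
      then obtain e where e: "e > 0" "\<And>y. y \<in> ?M \<Longrightarrow> d x y < e \<Longrightarrow> y \<in> U" by blast
      obtain a where a: "\<rho> a < e" using \<rho>c[OF e(1)] by blast
      have "y \<in> U" if y: "y \<in> ?M" "?E a x y" for y
      proof -
        have "of_nat 1 * d x y < \<rho> a" using y(2) by blast
        then show ?thesis using e(2)[OF y(1)] a by simp
      qed
      then show "\<exists>a. \<forall>y\<in>?M. ?E a x y \<longrightarrow> y \<in> U" by blast }
    { assume "\<exists>a. \<forall>y\<in>?M. ?E a x y \<longrightarrow> y \<in> U"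
      then obtain a where a: "\<And>y. y \<in> ?M \<Longrightarrow> ?E a x y \<Longrightarrow> y \<in> U" by blast
      obtain e where e: "e > 0" "\<And>n. of_nat n * e < \<rho> a" using small_ball by blast
      have "y \<in> U" if y: "y \<in> ?M" "d x y < e" for y
      proof (rule a[OF y(1)], rule)
        fix n
        have "of_nat n * d x y \<le> of_nat n * e" using y(2) by (intro mult_left_mono) auto
        then show "of_nat n * d x y < \<rho> a" using e(2)[of n] by simp
      qed
      then show "\<exists>e>0. \<forall>y\<in>?M. d x y < e \<longrightarrow> y \<in> U" using e(1) by blast }
  qed auto
  have antit: "?E a x y" if "a \<sqsubseteq> b" "?E b x y" for a b x y
  proof
    fix n show "of_nat n * d x y < \<rho> a" using spec[OF that(2), of n] \<rho>m[OF that(1)] by simp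
  qed
  show ?thesis
    unfolding filtration_def
  proof (intro conjI)
    show "\<forall>a. \<forall>x\<in>?M. ?E a x x" using refl \<rho>0 by simp
    show "\<forall>a. \<forall>x\<in>?M. \<forall>y\<in>?M. ?E a x y \<longrightarrow> ?E a y x" using sym by simp
    show "\<forall>a. \<forall>x\<in>?M. \<forall>y\<in>?M. \<forall>z\<in>?M. ?E a x y \<longrightarrow> ?E a y z \<longrightarrow> ?E a x z" using trans by blast
    show "\<forall>a b. a \<sqsubseteq> b \<longrightarrow> (\<forall>x\<in>?M. \<forall>y\<in>?M. ?E b x y \<longrightarrow> ?E a x y)" using antit by blast
    show "\<forall>U. openin X U \<longleftrightarrow> U \<subseteq> ?M \<and> (\<forall>x\<in>U. \<exists>a. \<forall>y\<in>?M. ?E a x y \<longrightarrow> y \<in> U)" using op' by blast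
  qed
qed

lemma ultrametric_filtration:
  fixes d :: "'a \<Rightarrow> 'a \<Rightarrow> 'g::linordered_field" and \<rho> :: "'l \<Rightarrow> 'g"
  assumes d: "G_metrized d X" and \<rho>: "radius \<rho>"
    and ultra: "\<And>x y z. x \<in> topspace X \<Longrightarrow> y \<in> topspace X \<Longrightarrow> z \<in> topspace X \<Longrightarrow> d x z \<le> max (d x y) (d y z)"
  shows "filtration (\<lambda>a x y. d x y < \<rho> a) X"
proof -
  let ?M = "topspace X"
  have op: "openin X U \<longleftrightarrow> U \<subseteq> ?M \<and> (\<forall>x\<in>U. \<exists>e>0. \<forall>y\<in>?M. d x y < e \<longrightarrow> y \<in> U)" for U
    using d by (simp add: G_metrized_def)
  have refl: "x \<in> ?M \<Longrightarrow> d x x = 0"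
    and sym: "x \<in> ?M \<Longrightarrow> y \<in> ?M \<Longrightarrow> d x y = d y x" for x y
    using d by (auto simp: G_metrized_def G_metric_def)
  have \<rho>0: "0 < \<rho> a" and \<rho>m: "a \<sqsubseteq> b \<Longrightarrow> \<rho> b \<le> \<rho> a" and \<rho>c: "0 < e \<Longrightarrow> \<exists>a. \<rho> a < e" for a b e
    using \<rho> by (auto simp: radius_def)
  have eq: "(\<exists>e>0. \<forall>y\<in>?M. d x y < e \<longrightarrow> y \<in> U) \<longleftrightarrow> (\<exists>a. \<forall>y\<in>?M. d x y < \<rho> a \<longrightarrow> y \<in> U)" for x U
    using \<rho>0 \<rho>c by (meson order.strict_trans)
  show ?thesis
    unfolding filtration_def
  proof (intro conjI)
    show "\<forall>a. \<forall>x\<in>?M. d x x < \<rho> a" using refl \<rho>0 by simp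
    show "\<forall>a. \<forall>x\<in>?M. \<forall>y\<in>?M. d x y < \<rho> a \<longrightarrow> d y x < \<rho> a" using sym by simp
    show "\<forall>a. \<forall>x\<in>?M. \<forall>y\<in>?M. \<forall>z\<in>?M. d x y < \<rho> a \<longrightarrow> d y z < \<rho> a \<longrightarrow> d x z < \<rho> a"
      using ultra by (meson le_less_trans max_less_iff_conj)
    show "\<forall>a b. a \<sqsubseteq> b \<longrightarrow> (\<forall>x\<in>?M. \<forall>y\<in>?M. d x y < \<rho> b \<longrightarrow> d x y < \<rho> a)"
      using \<rho>m less_le_trans by blast
    show "\<forall>U. openin X U \<longleftrightarrow> U \<subseteq> ?M \<and> (\<forall>x\<in>U. \<exists>a. \<forall>y\<in>?M. d x y < \<rho> a \<longrightarrow> y \<in> U)"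
      using op eq by simp
  qed
qed

text \<open>The distance of two points is \<open>\<rho>\<close> at the first index that separates
  them. An index separating \<open>x\<close> from \<open>z\<close> separates \<open>y\<close> from
  one of them, which is the ultrametric inequality.\<close>

lemma filtration_ultrametric:
  fixes \<rho> :: "'l \<Rightarrow> 'g::linordered_field" and X :: "'a topology"
  assumes E: "filtration E X" and \<rho>: "radius \<rho>"
    and sep: "\<And>x y. x \<in> topspace X \<Longrightarrow> y \<in> topspace X \<Longrightarrow> x \<noteq> y \<Longrightarrow> \<exists>a. \<not> E a x y"
  shows "\<exists>d :: 'a \<Rightarrow> 'a \<Rightarrow> 'g. G_metrized d X \<and>
    (\<forall>x\<in>topspace X. \<forall>y\<in>topspace X. \<forall>z\<in>topspace X. d x z \<le> max (d x y) (d y z))"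
proof -
  let ?M = "topspace X"
  have refl: "x \<in> ?M \<Longrightarrow> E a x x"
    and sym: "x \<in> ?M \<Longrightarrow> y \<in> ?M \<Longrightarrow> E a x y \<longleftrightarrow> E a y x"
    and trans: "x \<in> ?M \<Longrightarrow> y \<in> ?M \<Longrightarrow> z \<in> ?M \<Longrightarrow> E a x y \<Longrightarrow> E a y z \<Longrightarrow> E a x z" for a x y z
    using E unfolding filtration_def by metis+
  have anti: "a \<sqsubseteq> b \<Longrightarrow> x \<in> ?M \<Longrightarrow> y \<in> ?M \<Longrightarrow> E b x y \<Longrightarrow> E a x y" for a b x y
    using E unfolding filtration_def by metis
  have op: "openin X U \<longleftrightarrow> U \<subseteq> ?M \<and> (\<forall>x\<in>U. \<exists>a. \<forall>y\<in>?M. E a x y \<longrightarrow> y \<in> U)" for U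
    using E unfolding filtration_def by metis
  have \<rho>0: "0 < \<rho> a" and \<rho>m: "a \<sqsubseteq> b \<Longrightarrow> \<rho> b \<le> \<rho> a" and \<rho>c: "0 < e \<Longrightarrow> \<exists>a. \<rho> a < e" for a b e
    using \<rho> by (auto simp: radius_def)
  define \<delta> where "\<delta> x y = L.Least (\<lambda>a. \<not> E a x y)" for x y
  define d where "d x y = (if x = y then 0 else \<rho> (\<delta> x y))" for x y
  have \<delta>: "\<not> E (\<delta> x y) x y" if "x \<in> ?M" "y \<in> ?M" "x \<noteq> y" for x y
    unfolding \<delta>_def by (rule L.LeastI_ex[OF sep[OF that]])
  have \<delta>_le: "\<delta> x y \<sqsubseteq> a" if "\<not> E a x y" for a x y
    unfolding \<delta>_def by (rule L.Least_le) (rule that)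
  have \<delta>_gt: "a \<sqsubset> \<delta> x y" if "x \<in> ?M" "y \<in> ?M" "x \<noteq> y" "E a x y" for a x y
  proof (rule ccontr)
    assume "\<not> a \<sqsubset> \<delta> x y"
    then have "\<delta> x y \<sqsubseteq> a" using L.not_less by blast
    then show False using anti[OF _ that(1,2,4)] \<delta>[OF that(1-3)] by blast
  qed
  have d_sym: "d x y = d y x" if "x \<in> ?M" "y \<in> ?M" for x y
    using sym[OF that] by (simp add: d_def \<delta>_def)
  have ultra: "d x z \<le> max (d x y) (d y z)" if M: "x \<in> ?M" "y \<in> ?M" "z \<in> ?M" for x y z
  proof (cases "x = z \<or> x = y \<or> y = z")
    case True
    then show ?thesis using \<rho>0 by (auto simp: d_def le_max_iff_disj less_imp_le)
  next
    case False
    then have "\<not> E (\<delta> x z) x y \<or> \<not> E (\<delta> x z) y z" using \<delta>[of x z] trans M by blast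
    then have "\<delta> x y \<sqsubseteq> \<delta> x z \<or> \<delta> y z \<sqsubseteq> \<delta> x z" using \<delta>_le by blast
    then show ?thesis using False \<rho>m by (auto simp: d_def le_max_iff_disj)
  qed
  have d0: "0 \<le> d x y" for x y using \<rho>0 by (simp add: d_def less_imp_le)
  have "G_metric ?M d"
    unfolding G_metric_def
  proof (intro conjI ballI)
    fix x y assume M: "x \<in> ?M" "y \<in> ?M"
    show "0 \<le> d x y" by (rule d0)
    show "d x y = 0 \<longleftrightarrow> x = y" using \<rho>0[of "\<delta> x y"] by (simp add: d_def)
    show "d x y = d y x" by (rule d_sym[OF M])
    fix z assume "z \<in> ?M"
    then have "d x z \<le> max (d x y) (d y z)" by (rule ultra[OF M])
    also have "\<dots> \<le> d x y + d y z" using d0[of x y] d0[of y z] by simp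
    finally show "d x z \<le> d x y + d y z" .
  qed
  \<comment> \<open>As \<open>\<rho>\<close> is only weakly decreasing, balls and classes may
    differ: the ball of radius \<open>\<rho> a\<close> lies in the class at \<open>a\<close>, and
    that class lies in the ball of radius \<open>e\<close> once \<open>\<rho> a < e\<close>.\<close>
  moreover have nb: "(\<exists>a. \<forall>y\<in>?M. E a x y \<longrightarrow> y \<in> U) \<longleftrightarrow> (\<exists>e>0. \<forall>y\<in>?M. d x y < e \<longrightarrow> y \<in> U)"
    if x: "x \<in> ?M" "x \<in> U" for x U
  proof
    assume "\<exists>a. \<forall>y\<in>?M. E a x y \<longrightarrow> y \<in> U"
    then obtain a where a: "\<And>y. y \<in> ?M \<Longrightarrow> E a x y \<Longrightarrow> y \<in> U" by blast
    have "y \<in> U" if y: "y \<in> ?M" "d x y < \<rho> a" for y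
    proof (cases "x = y")
      case False
      then have "\<rho> (\<delta> x y) < \<rho> a" using y(2) by (simp add: d_def)
      then have "\<not> \<delta> x y \<sqsubseteq> a" using \<rho>m[of "\<delta> x y" a] by auto
      then show ?thesis using \<delta>_le a[OF y(1)] by blast
    qed (use x in simp)
    then show "\<exists>e>0. \<forall>y\<in>?M. d x y < e \<longrightarrow> y \<in> U" using \<rho>0 by blast
  next
    assume "\<exists>e>0. \<forall>y\<in>?M. d x y < e \<longrightarrow> y \<in> U"
    then obtain e where e: "e > 0" "\<And>y. y \<in> ?M \<Longrightarrow> d x y < e \<Longrightarrow> y \<in> U" by blast
    obtain a where a: "\<rho> a < e" using \<rho>c[OF e(1)] by blast
    have "y \<in> U" if y: "y \<in> ?M" "E a x y" for y
    proof (cases "x = y")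
      case False
      then have "a \<sqsubset> \<delta> x y" using \<delta>_gt x(1) y by blast
      then have "d x y < e" using \<rho>m[of a "\<delta> x y"] a False by (simp add: d_def)
      then show ?thesis using e(2)[OF y(1)] by blast
    qed (use x in simp)
    then show "\<exists>a. \<forall>y\<in>?M. E a x y \<longrightarrow> y \<in> U" by blast
  qed
  then have "openin X U \<longleftrightarrow> U \<subseteq> ?M \<and> (\<forall>x\<in>U. \<exists>e>0. \<forall>y\<in>?M. d x y < e \<longrightarrow> y \<in> U)" for U
    unfolding op by (intro conj_cong ball_cong refl nb) auto
  ultimately have "G_metrized d X" unfolding G_metrized_def by blast
  then show ?thesis using ultra by blast
qed

lemma filtration_class_open:
  assumes E: "filtration E X" and x: "x \<in> topspace X"
  shows "openin X {y \<in> topspace X. E a x y}" "closedin X {y \<in> topspace X. E a x y}"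
proof -
  let ?M = "topspace X"
  have refl: "x \<in> ?M \<Longrightarrow> E a x x"
    and sym: "x \<in> ?M \<Longrightarrow> y \<in> ?M \<Longrightarrow> E a x y \<Longrightarrow> E a y x"
    and trans: "x \<in> ?M \<Longrightarrow> y \<in> ?M \<Longrightarrow> z \<in> ?M \<Longrightarrow> E a x y \<Longrightarrow> E a y z \<Longrightarrow> E a x z" for a x y z
    using E unfolding filtration_def by metis+
  have op: "openin X U \<longleftrightarrow> U \<subseteq> ?M \<and> (\<forall>x\<in>U. \<exists>a. \<forall>y\<in>?M. E a x y \<longrightarrow> y \<in> U)" for U
    using E unfolding filtration_def by metis
  show "openin X {y \<in> ?M. E a x y}"
    unfolding op using x by (auto intro!: exI[of _ a] intro: trans)
  have "openin X (?M - {y \<in> ?M. E a x y})"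
    unfolding op using x sym trans by (intro conjI ballI exI[of _ a]) blast+
  then show "closedin X {y \<in> ?M. E a x y}" by (auto simp: closedin_def)
qed

lemma filtration_regular_Hausdorff:
  assumes E: "filtration E X"
    and sep: "\<And>x y. x \<in> topspace X \<Longrightarrow> y \<in> topspace X \<Longrightarrow> x \<noteq> y \<Longrightarrow> \<exists>a. \<not> E a x y"
  shows "regular_space X" "Hausdorff_space X"
proof -
  let ?M = "topspace X"
  have refl: "x \<in> ?M \<Longrightarrow> E a x x" for a x
    using E unfolding filtration_def by metis
  have op: "openin X U \<longleftrightarrow> U \<subseteq> ?M \<and> (\<forall>x\<in>U. \<exists>a. \<forall>y\<in>?M. E a x y \<longrightarrow> y \<in> U)" for U
    using E unfolding filtration_def by metis
  note cl = filtration_class_open[OF E]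
  show "regular_space X"
    unfolding regular_space_def
  proof (intro allI impI)
    fix C x assume Cx: "closedin X C \<and> x \<in> ?M - C"
    then have "openin X (?M - C)" by (simp add: closedin_def)
    then obtain a where a: "\<And>y. y \<in> ?M \<Longrightarrow> E a x y \<Longrightarrow> y \<in> ?M - C"
      unfolding op using Cx by blast
    have xM: "x \<in> ?M" using Cx by simp
    show "\<exists>U V. openin X U \<and> openin X V \<and> x \<in> U \<and> C \<subseteq> V \<and> disjnt U V"
    proof (rule exI[of _ "{y \<in> ?M. E a x y}"], rule exI[of _ "?M - {y \<in> ?M. E a x y}"], intro conjI)
      show "openin X (?M - {y \<in> ?M. E a x y})" using cl(2)[OF xM] by (simp add: closedin_def)
      show "C \<subseteq> ?M - {y \<in> ?M. E a x y}" using a Cx closedin_subset by blast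
    qed (use cl(1)[OF xM] refl xM in \<open>auto simp: disjnt_def\<close>)
  qed
  show "Hausdorff_space X"
    unfolding Hausdorff_space_def
  proof (intro allI impI)
    fix x y assume "x \<in> ?M \<and> y \<in> ?M \<and> x \<noteq> y"
    then have xy: "x \<in> ?M" "y \<in> ?M" "x \<noteq> y" by auto
    then obtain a where a: "\<not> E a x y" using sep by blast
    show "\<exists>U V. openin X U \<and> openin X V \<and> x \<in> U \<and> y \<in> V \<and> disjnt U V"
    proof (rule exI[of _ "{y \<in> ?M. E a x y}"], rule exI[of _ "?M - {y \<in> ?M. E a x y}"], intro conjI)
      show "openin X (?M - {y \<in> ?M. E a x y})" using cl(2)[OF xy(1)] by (simp add: closedin_def)
    qed (use cl(1)[OF xy(1)] refl xy a in \<open>auto simp: disjnt_def\<close>)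
  qed
qed

end

section \<open>A space with universal sets\<close>

definition base_of :: "'a topology \<Rightarrow> 'a set set \<Rightarrow> bool" where
  "base_of X \<B> \<longleftrightarrow> (\<forall>V\<in>\<B>. openin X V) \<and>
     (\<forall>U x. openin X U \<and> x \<in> U \<longrightarrow> (\<exists>V\<in>\<B>. x \<in> V \<and> V \<subseteq> U))"

lemma base_of_openin: "base_of X \<B> \<Longrightarrow> V \<in> \<B> \<Longrightarrow> openin X V"
  by (simp add: base_of_def)

lemma base_of_neighbourhood: "base_of X \<B> \<Longrightarrow> openin X U \<Longrightarrow> x \<in> U \<Longrightarrow> \<exists>V\<in>\<B>. x \<in> V \<and> V \<subseteq> U"
  by (simp add: base_of_def)

lemma weight_attained:
  fixes X :: "'a topology"
  shows "\<exists>\<B>. base_of X \<B> \<and> weight X = |\<B>| \<and> (\<forall>\<C> :: 'a set set. base_of X \<C> \<longrightarrow> |\<B>| \<le>o |\<C>| )"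
proof -
  have eq: "weight X = min_card (base_of X)" by (simp add: weight_def base_of_def[abs_def])
  have "base_of X {U. openin X U}" by (auto simp: base_of_def)
  from min_card_attained[of "base_of X", OF this] show ?thesis unfolding eq .
qed

lemma weight_ordLeq: "base_of X \<B> \<Longrightarrow> weight X \<le>o |\<B>|"
  using weight_attained[of X] by force

lemma weight_homeomorphic:
  assumes "X homeomorphic_space Y"
  shows "weight Y \<le>o weight X"
proof -
  from weight_attained[of X] obtain \<B> where \<B>: "base_of X \<B>" "weight X = |\<B>|"
    by (elim exE conjE) (rule that)
  obtain f g where fg: "homeomorphic_maps X Y f g" using assms unfolding homeomorphic_space_def by blast
  then have hf: "homeomorphic_map X Y f" and cf: "continuous_map X Y f"
    and gf: "\<And>y. y \<in> topspace Y \<Longrightarrow> f (g y) = y" and cg: "continuous_map Y X g"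
    using homeomorphic_maps_map[of X Y f g] by (auto simp: homeomorphic_maps_def)
  have "base_of Y ((`) f ` \<B>)"
    unfolding base_of_def
  proof (intro conjI ballI allI impI)
    fix V assume "V \<in> (`) f ` \<B>"
    then show "openin Y V"
      using \<B>(1) homeomorphic_imp_open_map[OF hf] unfolding open_map_def base_of_def by blast
  next
    fix U y assume U: "openin Y U \<and> y \<in> U"
    then have yY: "y \<in> topspace Y" using openin_subset by blast
    have "openin X {x \<in> topspace X. f x \<in> U}" using cf U by (simp add: openin_continuous_map_preimage)
    moreover have "g y \<in> {x \<in> topspace X. f x \<in> U}"
      using U gf[OF yY] yY continuous_map_image_subset_topspace[OF cg] by auto
    ultimately obtain V where V: "V \<in> \<B>" "g y \<in> V" "V \<subseteq> {x \<in> topspace X. f x \<in> U}"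
      using base_of_neighbourhood[OF \<B>(1)] by blast
    have "y \<in> f ` V" using V(2) gf[OF yY] by force
    then show "\<exists>V\<in>(`) f ` \<B>. y \<in> V \<and> V \<subseteq> U" using V by blast
  qed
  then have "weight Y \<le>o |(`) f ` \<B>|" by (rule weight_ordLeq)
  also have "|(`) f ` \<B>| \<le>o |\<B>|" by (rule card_of_image)
  finally show ?thesis unfolding \<B>(2) .
qed

lemma card_of_lists_ordLeq:
  assumes inf: "infinite B" and A: "|A| \<le>o |B|"
  shows "|lists A| \<le>o |B|"
proof -
  have n: "|{xs \<in> lists A. length xs = n}| \<le>o |B|" for n
  proof (induction n)
    case 0
    have "{xs \<in> lists A. length xs = 0} = {[]}" by auto
    then have "|{xs \<in> lists A. length xs = 0}| <o |B|"
      using inf by (intro finite_ordLess_infinite) (auto simp: card_of_Well_order Field_card_of card_of_well_order_on)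
    then show ?case by (rule ordLess_imp_ordLeq)
  next
    case (Suc n)
    let ?S = "{xs \<in> lists A. length xs = n}"
    have "{xs \<in> lists A. length xs = Suc n} \<subseteq> (\<lambda>(x, xs). x # xs) ` (A \<times> ?S)"
      by (force simp: length_Suc_conv)
    then have "|{xs \<in> lists A. length xs = Suc n}| \<le>o |(\<lambda>(x, xs). x # xs) ` (A \<times> ?S)|" by (rule card_of_mono1)
    also have "|(\<lambda>(x, xs). x # xs) ` (A \<times> ?S)| \<le>o |A \<times> ?S|" by (rule card_of_image)
    also have "|A \<times> ?S| \<le>o |B|" using inf A Suc.IH by (intro card_of_Sigma_ordLeq_infinite) auto
    finally show ?case .
  qed
  have "|\<Union>n. {xs \<in> lists A. length xs = n}| \<le>o |B|"
    using inf n by (intro card_of_UNION_ordLeq_infinite) (auto simp: infinite_iff_card_of_nat)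
  moreover have "(\<Union>n. {xs \<in> lists A. length xs = n}) = lists A" by auto
  ultimately show ?thesis by simp
qed

lemma Sigma0_inseparable_pair_homeomorphic:
  fixes \<xi> :: "'l succ_ord"
  assumes hom: "X homeomorphic_space Y" and X: "Sigma0_inseparable_pair \<xi> X"
  shows "Sigma0_inseparable_pair \<xi> Y"
proof -
  obtain A B where AB: "A \<in> Sigma0 \<xi> X" "B \<in> Sigma0 \<xi> X" "A \<inter> B = {}"
    and ns: "\<And>D. D \<in> Sigma0 \<xi> X \<Longrightarrow> D \<in> Pi0 \<xi> X \<Longrightarrow> A \<subseteq> D \<Longrightarrow> B \<inter> D \<noteq> {}"
    using X unfolding Sigma0_inseparable_pair_def by blast
  obtain f g where "homeomorphic_maps X Y f g" using hom unfolding homeomorphic_space_def by blast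
  then have cf: "continuous_map X Y f" and cg: "continuous_map Y X g"
    and gf: "\<And>x. x \<in> topspace X \<Longrightarrow> g (f x) = x"
    by (auto simp: homeomorphic_maps_def)
  have fY: "f x \<in> topspace Y" if "x \<in> topspace X" for x
    using that continuous_map_image_subset_topspace[OF cf] by auto
  let ?A = "{y \<in> topspace Y. g y \<in> A}" and ?B = "{y \<in> topspace Y. g y \<in> B}"
  have "?B \<inter> D \<noteq> {}" if D: "D \<in> Sigma0 \<xi> Y" "D \<in> Pi0 \<xi> Y" "?A \<subseteq> D" for D
  proof -
    let ?D = "{x \<in> topspace X. f x \<in> D}"
    have "?D \<in> Sigma0 \<xi> X" by (rule Sigma0_continuous_preimage[OF cf D(1)])
    moreover have "?D \<in> Pi0 \<xi> X"
    proof -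
      have "{x \<in> topspace X. f x \<in> topspace Y - D} \<in> Sigma0 \<xi> X"
        using D(2) by (intro Sigma0_continuous_preimage[OF cf]) (simp add: Pi0_iff)
      moreover have "{x \<in> topspace X. f x \<in> topspace Y - D} = topspace X - ?D" using fY by auto
      ultimately show ?thesis by (simp add: Pi0_iff)
    qed
    moreover have "A \<subseteq> ?D"
    proof
      fix x assume x: "x \<in> A"
      then have "x \<in> topspace X" using Sigma0_subset_topspace[OF AB(1)] by blast
      then show "x \<in> ?D" using D(3) x gf fY by auto
    qed
    ultimately obtain x where x: "x \<in> B" "x \<in> ?D" using ns by blast
    then have "f x \<in> ?B \<inter> D" using gf fY by auto
    then show ?thesis by blast
  qed
  moreover have "?A \<in> Sigma0 \<xi> Y" "?B \<in> Sigma0 \<xi> Y"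
    using AB(1,2) Sigma0_continuous_preimage[OF cg] by blast+
  moreover have "?A \<inter> ?B = {}" using AB(3) by auto
  ultimately show ?thesis unfolding Sigma0_inseparable_pair_def by blast
qed

context lambda_cardinal
begin

lemma filtration_homeomorphic:
  assumes hom: "homeomorphic_maps X Y f g" and E: "filtration E X"
  shows "filtration (\<lambda>a x y. E a (g x) (g y)) Y"
proof -
  let ?M = "topspace X" and ?N = "topspace Y"
  have refl: "x \<in> ?M \<Longrightarrow> E a x x"
    and sym: "x \<in> ?M \<Longrightarrow> y \<in> ?M \<Longrightarrow> E a x y \<Longrightarrow> E a y x"
    and trans: "x \<in> ?M \<Longrightarrow> y \<in> ?M \<Longrightarrow> z \<in> ?M \<Longrightarrow> E a x y \<Longrightarrow> E a y z \<Longrightarrow> E a x z" for a x y z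
    using E unfolding filtration_def by metis+
  have anti: "a \<sqsubseteq> b \<Longrightarrow> x \<in> ?M \<Longrightarrow> y \<in> ?M \<Longrightarrow> E b x y \<Longrightarrow> E a x y" for a b x y
    using E unfolding filtration_def by metis
  have op: "openin X U \<longleftrightarrow> U \<subseteq> ?M \<and> (\<forall>x\<in>U. \<exists>a. \<forall>y\<in>?M. E a x y \<longrightarrow> y \<in> U)" for U
    using E unfolding filtration_def by metis
  have cf: "continuous_map X Y f" and cg: "continuous_map Y X g"
    and gf: "\<And>x. x \<in> ?M \<Longrightarrow> g (f x) = x" and fg: "\<And>y. y \<in> ?N \<Longrightarrow> f (g y) = y"
    using hom by (auto simp: homeomorphic_maps_def)
  have gM: "g y \<in> ?M" if "y \<in> ?N" for y using that continuous_map_image_subset_topspace[OF cg] by auto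
  have fN: "f x \<in> ?N" if "x \<in> ?M" for x using that continuous_map_image_subset_topspace[OF cf] by auto
  have eq: "openin Y U \<longleftrightarrow> openin X {x \<in> ?M. f x \<in> U}" if U: "U \<subseteq> ?N" for U
  proof
    assume "openin X {x \<in> ?M. f x \<in> U}"
    then have "openin Y {y \<in> ?N. g y \<in> {x \<in> ?M. f x \<in> U}}" by (rule openin_continuous_map_preimage[OF cg])
    moreover have "{y \<in> ?N. g y \<in> {x \<in> ?M. f x \<in> U}} = U" using U gM fg by auto
    ultimately show "openin Y U" by simp
  qed (rule openin_continuous_map_preimage[OF cf])
  have op': "openin Y U \<longleftrightarrow> U \<subseteq> ?N \<and> (\<forall>x\<in>U. \<exists>a. \<forall>y\<in>?N. E a (g x) (g y) \<longrightarrow> y \<in> U)" for U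
  proof (cases "U \<subseteq> ?N")
    case True
    have "openin Y U \<longleftrightarrow> (\<forall>x\<in>{x \<in> ?M. f x \<in> U}. \<exists>a. \<forall>y\<in>?M. E a x y \<longrightarrow> y \<in> {x \<in> ?M. f x \<in> U})"
      unfolding eq[OF True] op by auto
    also have "\<dots> \<longleftrightarrow> (\<forall>x\<in>U. \<exists>a. \<forall>y\<in>?N. E a (g x) (g y) \<longrightarrow> y \<in> U)"
    proof (intro iffI ballI)
      fix x assume all: "\<forall>x\<in>{x \<in> ?M. f x \<in> U}. \<exists>a. \<forall>y\<in>?M. E a x y \<longrightarrow> y \<in> {x \<in> ?M. f x \<in> U}" and x: "x \<in> U"
      then have "x \<in> ?N" using True by blast
      then have "g x \<in> {x \<in> ?M. f x \<in> U}" using gM fg x by simp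
      then obtain a where a: "\<forall>y\<in>?M. E a (g x) y \<longrightarrow> y \<in> {x \<in> ?M. f x \<in> U}" using all by blast
      have "y \<in> U" if "y \<in> ?N" "E a (g x) (g y)" for y using a gM[OF that(1)] that fg by fastforce
      then show "\<exists>a. \<forall>y\<in>?N. E a (g x) (g y) \<longrightarrow> y \<in> U" by blast
    next
      fix x assume all: "\<forall>x\<in>U. \<exists>a. \<forall>y\<in>?N. E a (g x) (g y) \<longrightarrow> y \<in> U" and x: "x \<in> {x \<in> ?M. f x \<in> U}"
      then obtain a where a: "\<forall>y\<in>?N. E a (g (f x)) (g y) \<longrightarrow> y \<in> U" by blast
      have "f y \<in> U" if "y \<in> ?M" "E a x y" for y using a fN[OF that(1)] that gf x by simp
      then show "\<exists>a. \<forall>y\<in>?M. E a x y \<longrightarrow> y \<in> {x \<in> ?M. f x \<in> U}" by blast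
    qed
    finally show ?thesis using True by simp
  qed (use openin_subset in blast)
  show ?thesis
    unfolding filtration_def
  proof (intro conjI)
    show "\<forall>a. \<forall>x\<in>?N. E a (g x) (g x)" using refl gM by simp
    show "\<forall>a. \<forall>x\<in>?N. \<forall>y\<in>?N. E a (g x) (g y) \<longrightarrow> E a (g y) (g x)" using sym gM by simp
    show "\<forall>a. \<forall>x\<in>?N. \<forall>y\<in>?N. \<forall>z\<in>?N. E a (g x) (g y) \<longrightarrow> E a (g y) (g z) \<longrightarrow> E a (g x) (g z)"
      using trans gM by blast
    show "\<forall>a b. a \<sqsubseteq> b \<longrightarrow> (\<forall>x\<in>?N. \<forall>y\<in>?N. E b (g x) (g y) \<longrightarrow> E a (g x) (g y))" using anti gM by blast
    show "\<forall>U. openin Y U \<longleftrightarrow> U \<subseteq> ?N \<and> (\<forall>x\<in>U. \<exists>a. \<forall>y\<in>?N. E a (g x) (g y) \<longrightarrow> y \<in> U)"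
      using op' by (intro allI)
  qed
qed

section \<open>The tree space and its cylinder sets\<close>

definition nodes :: "'l \<Rightarrow> 'l list set" where
  "nodes a = lists {b. b \<sqsubset> a}"

text \<open>The generalized Cantor space on \<open>\<lambda>\<close>, indexed by finite sequences so that a point codes
  a \<open>\<lambda>\<close>-sequence of points by \<open>branch\<close>, without a pairing function respecting bounded sets.\<close>

definition tree_space :: "'l list set topology" where
  "tree_space = topology (\<lambda>U. \<forall>x\<in>U. \<exists>a. \<forall>y. x \<inter> nodes a = y \<inter> nodes a \<longrightarrow> y \<in> U)"

lemma nodes_mono: "a \<sqsubseteq> b \<Longrightarrow> nodes a \<subseteq> nodes b"
  unfolding nodes_def using L.less_le_trans by (intro lists_mono) blast

lemma nodes_agree_mono:
  assumes "a \<sqsubseteq> b" "x \<inter> nodes b = y \<inter> nodes b"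
  shows "x \<inter> nodes a = y \<inter> nodes a"
  using assms nodes_mono by blast

lemma ex_upper: "\<exists>c. a \<sqsubseteq> c \<and> b \<sqsubset> c"
proof (cases "a \<sqsubseteq> b")
  case True
  obtain c where c: "b \<sqsubset> c" using ex_greater by blast
  then show ?thesis using L.le_less_trans[OF True c] by blast
next
  case False
  then show ?thesis using L.not_le[of a b] L.order_refl by blast
qed

lemma openin_tree_space:
  "openin tree_space U \<longleftrightarrow> (\<forall>x\<in>U. \<exists>a. \<forall>y. x \<inter> nodes a = y \<inter> nodes a \<longrightarrow> y \<in> U)"
proof -
  let ?op = "\<lambda>U. \<forall>x\<in>U. \<exists>a. \<forall>y. x \<inter> nodes a = y \<inter> nodes a \<longrightarrow> y \<in> U"
  have "istopology ?op"
    unfolding istopology_def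
  proof (intro conjI allI impI ballI)
    fix S T x assume ST: "?op S" "?op T" and x: "x \<in> S \<inter> T"
    obtain a where a: "\<And>y. x \<inter> nodes a = y \<inter> nodes a \<Longrightarrow> y \<in> S" using ST(1) x by blast
    obtain b where b: "\<And>y. x \<inter> nodes b = y \<inter> nodes b \<Longrightarrow> y \<in> T" using ST(2) x by blast
    obtain c where c: "a \<sqsubseteq> c" "b \<sqsubseteq> c" using ex_upper by blast
    have "y \<in> S \<inter> T" if "x \<inter> nodes c = y \<inter> nodes c" for y
      using a[OF nodes_agree_mono[OF c(1) that]] b[OF nodes_agree_mono[OF c(2) that]] by blast
    then show "\<exists>a. \<forall>y. x \<inter> nodes a = y \<inter> nodes a \<longrightarrow> y \<in> S \<inter> T" by blast
  next
    fix \<K> x assume K: "\<forall>K\<in>\<K>. ?op K" and "x \<in> \<Union>\<K>"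
    then obtain K where K': "K \<in> \<K>" "x \<in> K" by blast
    then obtain a where "\<forall>y. x \<inter> nodes a = y \<inter> nodes a \<longrightarrow> y \<in> K" using K by blast
    then show "\<exists>a. \<forall>y. x \<inter> nodes a = y \<inter> nodes a \<longrightarrow> y \<in> \<Union>\<K>" using K'(1) by blast
  qed
  then show ?thesis unfolding tree_space_def by (simp add: topology_inverse')
qed

lemma topspace_tree_space: "topspace tree_space = UNIV"
proof -
  have "openin tree_space UNIV" by (simp add: openin_tree_space)
  then show ?thesis using openin_subset by blast
qed

lemma filtration_tree_space: "filtration (\<lambda>a x y. x \<inter> nodes a = y \<inter> nodes a) tree_space"
  unfolding filtration_def
proof (intro conjI)
  show "\<forall>a b. a \<sqsubseteq> b \<longrightarrow> (\<forall>x\<in>topspace tree_space. \<forall>y\<in>topspace tree_space.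
      x \<inter> nodes b = y \<inter> nodes b \<longrightarrow> x \<inter> nodes a = y \<inter> nodes a)"
    using nodes_agree_mono by blast
qed (simp_all add: topspace_tree_space openin_tree_space)

lemma list_in_nodes: "\<exists>a. t \<in> nodes a"
proof -
  obtain b where b: "\<forall>k\<in>set t. k \<sqsubseteq> b" using finite_bounded[of "set t"] by blast
  obtain a where a: "b \<sqsubset> a" using ex_greater by blast
  have "k \<sqsubset> a" if "k \<in> set t" for k using L.le_less_trans[OF _ a] b that by blast
  then show ?thesis unfolding nodes_def by (intro exI[of _ a]) auto
qed

lemma tree_space_separated:
  assumes "x \<noteq> y"
  shows "\<exists>a. x \<inter> nodes a \<noteq> y \<inter> nodes a"
proof -
  obtain t where "t \<in> x \<longleftrightarrow> t \<notin> y" using assms by blast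
  moreover obtain a where "t \<in> nodes a" using list_in_nodes by blast
  ultimately show ?thesis by blast
qed

lemma small_nodes: "small (nodes a)"
proof (cases "finite {b. b \<sqsubset> a}")
  \<comment> \<open>Finitely many entries may still give infinitely many sequences; these are
    countably many, which is small because \<lambda> is uncountable.\<close>
  case True
  have "|{b. b \<sqsubset> a}| \<le>o |UNIV :: nat set|"
    using True by (intro ordLess_imp_ordLeq finite_ordLess_infinite) (auto simp: card_of_Well_order Field_card_of card_of_well_order_on)
  then have "|nodes a| \<le>o |UNIV :: nat set|" unfolding nodes_def by (intro card_of_lists_ordLeq) auto
  moreover have "small (UNIV :: nat set)"
    unfolding small_def using card_of_nat uncountable_UNIV by (rule ordIso_ordLess_trans)
  ultimately show ?thesis by (rule small_ordLeq)
next
  case False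
  then have "|nodes a| \<le>o |{b. b \<sqsubset> a}|"
    unfolding nodes_def by (intro card_of_lists_ordLeq) (auto simp: card_of_refl[THEN ordIso_imp_ordLeq])
  then show ?thesis using small_below by (rule small_ordLeq)
qed

definition tree_base :: "'l list set set set" where
  "tree_base = (\<Union>a. (\<lambda>S. {y. y \<inter> nodes a = S}) ` Pow (nodes a))"

lemma base_of_tree_space: "base_of tree_space tree_base"
  unfolding base_of_def
proof (intro conjI ballI allI impI)
  fix V assume "V \<in> tree_base"
  then obtain a S where "V = {y. y \<inter> nodes a = S}" by (auto simp: tree_base_def)
  then show "openin tree_space V" unfolding openin_tree_space by (auto intro!: exI[of _ a])
next
  fix U x assume "openin tree_space U \<and> x \<in> U"
  then obtain a where a: "\<forall>y. x \<inter> nodes a = y \<inter> nodes a \<longrightarrow> y \<in> U" unfolding openin_tree_space by blast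
  have "{y. y \<inter> nodes a = x \<inter> nodes a} \<in> tree_base" unfolding tree_base_def by blast
  then show "\<exists>V\<in>tree_base. x \<in> V \<and> V \<subseteq> U"
    by (rule bexI[rotated]) (use a in force)
qed

text \<open>There are \<lambda> many indices \<open>a\<close>, and the small set
  \<open>nodes a\<close> has at most \<lambda> subsets.\<close>

lemma card_of_tree_base: "|tree_base| \<le>o |UNIV :: 'l set|"
  unfolding tree_base_def
proof (rule card_of_UNION_ordLeq_infinite[OF infinite_UNIV])
  show "|UNIV :: 'l set| \<le>o |UNIV :: 'l set|" by (rule card_of_refl[THEN ordIso_imp_ordLeq])
  show "\<forall>a\<in>UNIV. |(\<lambda>S. {y. y \<inter> nodes a = S}) ` Pow (nodes a)| \<le>o |UNIV :: 'l set|"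
    using card_of_image Pow_small_ordLeq[OF small_nodes] ordLeq_transitive by blast
qed

lemma weight_tree_space: "weight tree_space \<le>o lam"
  using weight_ordLeq[OF base_of_tree_space] card_of_tree_base ordIso_symmetric[OF lam_ordIso]
  by (meson ordLeq_ordIso_trans ordLeq_transitive)

definition branch :: "'l \<Rightarrow> 'l list set \<Rightarrow> 'l list set" where
  "branch i y = {t. i # t \<in> y}"

lemma continuous_map_branch: "continuous_map tree_space tree_space (branch i)"
  unfolding continuous_map_def
proof (intro conjI allI impI)
  fix U assume U: "openin tree_space U"
  have "\<exists>a. \<forall>y. x \<inter> nodes a = y \<inter> nodes a \<longrightarrow> branch i y \<in> U" if x: "branch i x \<in> U" for x
  proof -
    obtain a where a: "\<And>y. branch i x \<inter> nodes a = y \<inter> nodes a \<Longrightarrow> y \<in> U"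
      using U[unfolded openin_tree_space] x by blast
    \<comment> \<open>\<open>b\<close> has to exceed \<open>i\<close> as well, so that
      \<open>i # t\<close> is in \<open>nodes b\<close> for every \<open>t\<close> in
      \<open>nodes a\<close>.\<close>
    obtain b where b: "a \<sqsubseteq> b" "i \<sqsubset> b" using ex_upper by blast
    have node: "i # t \<in> nodes b" if "t \<in> nodes a" for t
      using nodes_mono[OF b(1)] that b(2) by (auto simp: nodes_def)
    have "branch i y \<in> U" if "x \<inter> nodes b = y \<inter> nodes b" for y
    proof (rule a)
      show "branch i x \<inter> nodes a = branch i y \<inter> nodes a" using that node by (auto simp: branch_def)
    qed
    then show ?thesis by blast
  qed
  then show "openin tree_space {x \<in> topspace tree_space. branch i x \<in> U}"
    by (simp add: openin_tree_space topspace_tree_space)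
qed (simp add: topspace_tree_space)

lemma openin_tree_space_member: "openin tree_space {y. t \<in> y}"
  unfolding openin_tree_space
proof
  fix x assume x: "x \<in> {y. t \<in> y}"
  obtain a where "t \<in> nodes a" using list_in_nodes by blast
  then show "\<exists>a. \<forall>y. x \<inter> nodes a = y \<inter> nodes a \<longrightarrow> y \<in> {y. t \<in> y}" using x by blast
qed

section \<open>Universal sets and the diagonal argument\<close>

text \<open>\<open>U y\<close> is the set coded by \<open>y\<close>. Complexity is stated for all
  pairs of continuous maps, in place of a universal set in the product: the induction replaces
  \<open>g\<close> by \<open>branch i \<circ> g\<close>, and the diagonal argument takes the
  identity and \<open>branch i\<close>.\<close>

lemma tree_space_universal:
  fixes \<xi> :: "'l succ_ord"
  shows "1 \<le> \<xi> \<Longrightarrow> \<exists>U :: 'l list set \<Rightarrow> 'l list set set. (\<forall>A\<in>Sigma0 \<xi> tree_space. \<exists>y. U y = A) \<and>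
    (\<forall>f g. continuous_map tree_space tree_space f \<longrightarrow> continuous_map tree_space tree_space g \<longrightarrow>
       {x. f x \<in> U (g x)} \<in> Sigma0 \<xi> tree_space)"
proof (induction \<xi> rule: less_induct)
  case (less \<xi>)
  let ?T = tree_space
  let ?univ = "\<lambda>\<zeta> U. (\<forall>A\<in>Sigma0 (\<zeta> :: 'l succ_ord) ?T. \<exists>y. U y = A) \<and>
    (\<forall>f g. continuous_map ?T ?T f \<longrightarrow> continuous_map ?T ?T g \<longrightarrow> {x. f x \<in> U (g x)} \<in> Sigma0 \<zeta> ?T)"
  show ?case
  proof (cases "\<xi> = 1")
    case True
    have "tree_base \<noteq> {}" unfolding tree_base_def by blast
    then obtain V :: "'l \<Rightarrow> _" where V: "range V = tree_base"
      using card_of_tree_base card_of_ordLeq2[of tree_base "UNIV :: 'l set"] by auto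
    have Vop: "openin ?T (V i)" for i using base_of_openin[OF base_of_tree_space] V by blast
    \<comment> \<open>The one-element sequence \<open>[i]\<close> is the bit that puts the basic
      open set \<open>V i\<close> into the union.\<close>
    define U where "U y = (\<Union>i\<in>{i. [i] \<in> y}. V i)" for y
    have "\<exists>y. U y = A" if A: "openin ?T A" for A
    proof
      show "U {[i] | i. V i \<subseteq> A} = A"
      proof (intro equalityI subsetI)
        fix x assume "x \<in> A"
        then obtain W where "W \<in> tree_base" "x \<in> W" "W \<subseteq> A"
          using base_of_neighbourhood[OF base_of_tree_space A] by blast
        moreover from this(1) obtain i where "W = V i" using V by blast
        ultimately show "x \<in> U {[i] | i. V i \<subseteq> A}" by (auto simp: U_def)
      qed (auto simp: U_def)
    qed
    moreover have "openin ?T {x. f x \<in> U (g x)}"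
      if fg: "continuous_map ?T ?T f" "continuous_map ?T ?T g" for f g
    proof -
      have "openin ?T ({x \<in> topspace ?T. g x \<in> {y. [i] \<in> y}} \<inter> {x \<in> topspace ?T. f x \<in> V i})" for i
        using fg Vop openin_tree_space_member by (intro openin_Int openin_continuous_map_preimage)
      then have "openin ?T (\<Union>i. {x \<in> topspace ?T. g x \<in> {y. [i] \<in> y}} \<inter> {x \<in> topspace ?T. f x \<in> V i})" by auto
      moreover have "(\<Union>i. {x \<in> topspace ?T. g x \<in> {y. [i] \<in> y}} \<inter> {x \<in> topspace ?T. f x \<in> V i}) = {x. f x \<in> U (g x)}"
        by (auto simp: U_def topspace_tree_space)
      ultimately show ?thesis by simp
    qed
    ultimately have "?univ \<xi> U" by (simp add: Sigma0_1 True)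
    then show ?thesis by (intro exI[of _ U])
  next
    case False
    then have gt: "1 < \<xi>" using less.prems by simp
    from Sigma0_normal_form[OF gt, of ?T] obtain rk :: "'l \<Rightarrow> 'l succ_ord"
      where rk: "\<forall>i. 1 \<le> rk i \<and> rk i < \<xi>"
      and nf: "\<forall>B\<in>Sigma0 \<xi> ?T. \<exists>A. B = (\<Union>i. A i) \<and> (\<forall>i. A i \<in> Pi0 (rk i) ?T)"
      by (elim exE conjE) (rule that)
    have "\<forall>i. \<exists>U. ?univ (rk i) U" using less.IH rk by blast
    from choice[OF this] obtain u where u: "\<forall>i. ?univ (rk i) (u i)" ..
    \<comment> \<open>By \<open>Sigma0_normal_form\<close> position \<open>i\<close> always carries
      a \<Pi> set of level \<open>rk i\<close>, so \<open>branch i y\<close> can be read as a code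
      for its complement.\<close>
    define U where "U y = (\<Union>i. - u i (branch i y))" for y
    have "\<exists>y. U y = B" if B: "B \<in> Sigma0 \<xi> ?T" for B
    proof -
      from bspec[OF nf B] obtain A where A: "B = (\<Union>i. A i)" "\<forall>i. A i \<in> Pi0 (rk i) ?T"
        by (elim exE conjE) (rule that)
      have "\<forall>i. \<exists>y. u i y = - A i"
      proof
        fix i
        have "- A i \<in> Sigma0 (rk i) ?T" using A(2) by (simp add: Pi0_iff topspace_tree_space Compl_eq_Diff_UNIV)
        then show "\<exists>y. u i y = - A i" using u by blast
      qed
      from choice[OF this] obtain c where c: "\<forall>i. u i (c i) = - A i" ..
      have "branch i {j # t | j t. t \<in> c j} = c i" for i by (auto simp: branch_def)
      then have "U {j # t | j t. t \<in> c j} = B" using c by (simp add: U_def A(1))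
      then show ?thesis by blast
    qed
    moreover have "{x. f x \<in> U (g x)} \<in> Sigma0 \<xi> ?T"
      if fg: "continuous_map ?T ?T f" "continuous_map ?T ?T g" for f g
    proof -
      have "\<exists>\<zeta><\<xi>. {x. f x \<notin> u i (branch i (g x))} \<in> Pi0 \<zeta> ?T" for i
      proof -
        have "continuous_map ?T ?T (branch i \<circ> g)"
          by (rule continuous_map_compose[OF fg(2) continuous_map_branch])
        then have "{x. f x \<in> u i ((branch i \<circ> g) x)} \<in> Sigma0 (rk i) ?T" using u fg(1) by blast
        moreover have "- {x. f x \<notin> u i (branch i (g x))} = {x. f x \<in> u i ((branch i \<circ> g) x)}" by auto
        ultimately have "{x. f x \<notin> u i (branch i (g x))} \<in> Pi0 (rk i) ?T"
          by (simp add: Pi0_iff topspace_tree_space Compl_eq_Diff_UNIV[symmetric])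
        then show ?thesis using rk by blast
      qed
      then have "(\<Union>i\<in>UNIV. {x. f x \<notin> u i (branch i (g x))}) \<in> Sigma0 \<xi> ?T"
        using gt by (intro Sigma0_Pi0_small_union card_of_refl[THEN ordIso_imp_ordLeq])
      moreover have "(\<Union>i\<in>UNIV. {x. f x \<notin> u i (branch i (g x))}) = {x. f x \<in> U (g x)}"
        by (auto simp: U_def)
      ultimately show ?thesis by simp
    qed
    ultimately have "?univ \<xi> U" by simp
    then show ?thesis by (intro exI[of _ U])
  qed
qed

lemma tree_space_inseparable_pair:
  fixes \<xi> :: "'l succ_ord"
  assumes "1 \<le> \<xi>" and red: "Sigma0_reduction \<xi> tree_space"
  shows "Sigma0_inseparable_pair \<xi> tree_space"
proof -
  let ?T = tree_space
  from tree_space_universal[OF assms(1)] obtain U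
    where U: "\<forall>A\<in>Sigma0 \<xi> ?T. \<exists>y. U y = A"
      "\<forall>f g. continuous_map ?T ?T f \<longrightarrow> continuous_map ?T ?T g \<longrightarrow> {x. f x \<in> U (g x)} \<in> Sigma0 \<xi> ?T"
    by (elim exE conjE) (rule that)
  obtain p q :: 'l where pq: "p \<noteq> q" using infinite_ex_distinct[OF infinite_UNIV] by blast
  define A where "A i = {y. y \<in> U (branch i y)}" for i
  define A0 where "A0 i = (if i = p \<or> i = q then A i else {})" for i
  have "A i \<in> Sigma0 \<xi> ?T" for i
    using U(2)[rule_format, of "\<lambda>x. x" "branch i"] continuous_map_branch by (simp add: A_def)
  then have "\<forall>i. A0 i \<in> Sigma0 \<xi> ?T" using assms(1) by (simp add: A0_def empty_in_Sigma0)
  with red have "\<exists>A'. (\<forall>i. A' i \<in> Sigma0 \<xi> ?T \<and> A' i \<subseteq> A0 i) \<and>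
      (\<forall>i j. i \<noteq> j \<longrightarrow> A' i \<inter> A' j = {}) \<and> (\<Union>i. A' i) = (\<Union>i. A0 i)"
    unfolding Sigma0_reduction_def by simp
  then obtain R where R: "\<forall>i. R i \<in> Sigma0 \<xi> ?T \<and> R i \<subseteq> A0 i" "\<forall>i j. i \<noteq> j \<longrightarrow> R i \<inter> R j = {}"
      "(\<Union>i. R i) = (\<Union>i. A0 i)"
    by (elim exE conjE) (rule that)
  have "R q \<inter> D \<noteq> {}" if D: "D \<in> Sigma0 \<xi> ?T" "D \<in> Pi0 \<xi> ?T" "R p \<subseteq> D" for D
  proof
    assume disj: "R q \<inter> D = {}"
    have "- D \<in> Sigma0 \<xi> ?T" using D(2) by (simp add: Pi0_iff topspace_tree_space Compl_eq_Diff_UNIV)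
    then obtain u where u: "U u = - D" using U(1) by blast
    obtain v where v: "U v = D" using U(1) D(1) by blast
    \<comment> \<open>\<open>y\<close> codes the complement of \<open>D\<close> at \<open>p\<close>
      and \<open>D\<close> itself at \<open>q\<close>, so it is in \<open>A p\<close> iff it is
      outside \<open>D\<close>, and in \<open>A q\<close> iff it is inside. Hence it lies in
      \<open>R p\<close> outside \<open>D\<close> or in \<open>R q\<close> inside \<open>D\<close>,
      and either is excluded.\<close>
    define y where "y = {p # t | t. t \<in> u} \<union> {q # t | t. t \<in> v}"
    have "branch p y = u" "branch q y = v" using pq by (auto simp: y_def branch_def)
    then have Ap: "y \<in> A0 p \<longleftrightarrow> y \<notin> D" and Aq: "y \<in> A0 q \<longleftrightarrow> y \<in> D" using u v by (auto simp: A0_def A_def)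
    then have "y \<in> (\<Union>i. R i)" unfolding R(3) by blast
    then obtain i where i: "y \<in> R i" by blast
    then have yi: "y \<in> A0 i" using R(1) by blast
    then have "i = p \<or> i = q" by (simp add: A0_def split: if_splits)
    then show False using i yi Ap Aq D(3) disj by blast
  qed
  moreover have "R p \<inter> R q = {}" using R(2) pq by blast
  ultimately show ?thesis using R(1) unfolding Sigma0_inseparable_pair_def by blast
qed

end

section \<open>Dimension zero\<close>

text \<open>In \<open>enat\<close> the infimum of the empty set is infinite, and any other infimum
  is attained.\<close>

lemma covering_dim_eq_0_iff: "covering_dim X = 0 \<longleftrightarrow> covering_dim_le X 0"
proof
  assume 0: "covering_dim X = 0"
  let ?S = "enat ` {n. covering_dim_le X n}"
  have "?S \<noteq> {}"
  proof
    assume "?S = {}"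
    then have "covering_dim X = \<infinity>" by (simp add: covering_dim_def top_enat_def)
    then show False using 0 by simp
  qed
  then have "Inf ?S \<in> ?S" unfolding Inf_enat_def using LeastI_ex[of "\<lambda>x. x \<in> ?S"] by auto
  then show "covering_dim_le X 0" using 0 by (auto simp: covering_dim_def zero_enat_def)
next
  assume "covering_dim_le X 0"
  then have "covering_dim X \<le> enat 0" unfolding covering_dim_def by (intro INF_lower) simp
  then show "covering_dim X = 0" by (simp add: zero_enat_def[symmetric])
qed

text \<open>A refinement of \<open>{W, topspace X - F}\<close> in which no point lies in two sets is
  a finite partition into open sets. Members that meet \<open>F\<close> do not fit into the
  complement of \<open>F\<close>, hence lie in \<open>W\<close>.\<close>

lemma covering_dim_le_0_clopen:
  assumes X: "covering_dim_le X 0" and F: "closedin X F" and W: "openin X W" and FW: "F \<subseteq> W"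
  shows "\<exists>C. openin X C \<and> closedin X C \<and> F \<subseteq> C \<and> C \<subseteq> W"
proof -
  let ?U = "{W, topspace X - F}"
  have "openin X (topspace X - F)" using F by (simp add: closedin_def)
  moreover have "\<Union>?U = topspace X" using FW openin_subset[OF W] by auto
  ultimately have "finite ?U \<and> (\<forall>U\<in>?U. openin X U) \<and> \<Union>?U = topspace X" using W by simp
  from X[unfolded covering_dim_le_def, THEN spec, THEN mp, OF this] obtain \<V>
    where \<V>: "finite \<V>" "\<forall>V\<in>\<V>. openin X V \<and> (\<exists>U\<in>?U. V \<subseteq> U)"
      "\<Union>\<V> = topspace X" "\<forall>x\<in>topspace X. card {V\<in>\<V>. x \<in> V} \<le> 0 + 1"
    by (elim exE conjE) (rule that)
  have disj: "V = V'" if "V \<in> \<V>" "V' \<in> \<V>" "x \<in> V" "x \<in> V'" for V V' x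
  proof -
    have "x \<in> topspace X" using \<V>(3) that by blast
    then have "card {V\<in>\<V>. x \<in> V} \<le> Suc 0" using \<V>(4) by simp
    then show ?thesis using \<V>(1) that by (subst (asm) card_le_Suc0_iff_eq) auto
  qed
  let ?C = "\<Union>{V\<in>\<V>. V \<inter> F \<noteq> {}}"
  show ?thesis
  proof (intro exI[of _ ?C] conjI)
    show "openin X ?C" using \<V>(2) by (intro openin_Union) auto
    have "openin X (\<Union>{V\<in>\<V>. V \<inter> F = {}})" using \<V>(2) by (intro openin_Union) auto
    moreover have "\<Union>{V\<in>\<V>. V \<inter> F = {}} = topspace X - ?C"
    proof (intro equalityI subsetI)
      fix x assume "x \<in> \<Union>{V\<in>\<V>. V \<inter> F = {}}"
      then obtain V where V: "V \<in> \<V>" "V \<inter> F = {}" "x \<in> V" by auto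
      have "V' \<inter> F = {}" if "V' \<in> \<V>" "x \<in> V'" for V' using disj[OF V(1) that(1) V(3) that(2)] V(2) by simp
      then show "x \<in> topspace X - ?C" using V(1,3) \<V>(3) by auto
    next
      fix x assume x: "x \<in> topspace X - ?C"
      have "x \<in> \<Union>\<V>" unfolding \<V>(3) using x by (rule DiffD1)
      then obtain V where "V \<in> \<V>" "x \<in> V" by (rule UnionE)
      then show "x \<in> \<Union>{V\<in>\<V>. V \<inter> F = {}}" using x by auto
    qed
    moreover have "?C \<subseteq> topspace X" unfolding \<V>(3)[symmetric] by blast
    ultimately show "closedin X ?C" by (simp add: closedin_def)
    show "F \<subseteq> ?C" using closedin_subset[OF F] unfolding \<V>(3)[symmetric] by blast
    show "?C \<subseteq> W" using \<V>(2) by blast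
  qed
qed

text \<open>Reducing a finite open cover gives a disjoint open refinement. Combined with
  \<open>filtration_reduction\<close>, this shows that ultrametrizable spaces have dimension
  zero.\<close>

lemma Sigma0_reduction_one_imp_covering_dim_le_0:
  fixes X :: "'a topology"
  assumes inf: "infinite (UNIV :: 'l set)" and red: "Sigma0_reduction (1 :: 'l succ_ord) X"
  shows "covering_dim_le X 0"
  unfolding covering_dim_le_def
proof (intro allI impI)
  fix \<U> assume U: "finite \<U> \<and> (\<forall>U\<in>\<U>. openin X U) \<and> \<Union>\<U> = topspace X"
  have "|\<U>| <o |UNIV :: 'l set|"
    using U inf by (intro finite_ordLess_infinite) (auto simp: card_of_Well_order Field_card_of card_of_well_order_on)
  then obtain k :: "'a set \<Rightarrow> 'l" where k: "inj_on k \<U>"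
    using card_of_ordLeq[of \<U> "UNIV :: 'l set"] ordLess_imp_ordLeq by blast
  define A where "A i = (if i \<in> k ` \<U> then inv_into \<U> k i else {})" for i
  have Ak: "A (k U) = U" if "U \<in> \<U>" for U using that k by (simp add: A_def)
  have "\<forall>i. A i \<in> Sigma0 (1 :: 'l succ_ord) X"
    using U by (auto simp: Sigma0_1 A_def inv_into_into)
  with red have "\<exists>A' :: 'l \<Rightarrow> _. (\<forall>i. A' i \<in> Sigma0 (1 :: 'l succ_ord) X \<and> A' i \<subseteq> A i) \<and>
      (\<forall>i j. i \<noteq> j \<longrightarrow> A' i \<inter> A' j = {}) \<and> (\<Union>i. A' i) = (\<Union>i. A i)"
    unfolding Sigma0_reduction_def by simp
  then obtain R :: "'l \<Rightarrow> 'a set" where R: "\<forall>i. R i \<in> Sigma0 (1 :: 'l succ_ord) X \<and> R i \<subseteq> A i"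
      "\<forall>i j. i \<noteq> j \<longrightarrow> R i \<inter> R j = {}" "(\<Union>i. R i) = (\<Union>i. A i)"
    by (elim exE conjE) (rule that)
  have Rout: "R i = {}" if "i \<notin> k ` \<U>" for i
  proof -
    have "R i \<subseteq> A i" using R(1) by blast
    then show ?thesis using that by (simp add: A_def)
  qed
  show "\<exists>\<V>. finite \<V> \<and> (\<forall>V\<in>\<V>. openin X V \<and> (\<exists>U\<in>\<U>. V \<subseteq> U)) \<and> \<Union>\<V> = topspace X \<and>
           (\<forall>x\<in>topspace X. card {V\<in>\<V>. x \<in> V} \<le> 0 + 1)"
  proof (intro exI[of _ "R ` k ` \<U>"] conjI ballI)
    show "finite (R ` k ` \<U>)" using U by simp
    fix V assume "V \<in> R ` k ` \<U>"
    then obtain U where "U \<in> \<U>" "V = R (k U)" by blast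
    moreover have "R (k U) \<subseteq> A (k U)" using R(1) by blast
    ultimately show "openin X V" "\<exists>U\<in>\<U>. V \<subseteq> U" using R(1) Ak by (auto simp: Sigma0_1)
  next
    have "\<Union>(R ` k ` \<U>) = (\<Union>i. R i)" using Rout by blast
    also have "\<dots> = \<Union>\<U>"
    proof
      show "(\<Union>i. R i) \<subseteq> \<Union>\<U>" unfolding R(3) using k by (auto simp: A_def split: if_splits)
      show "\<Union>\<U> \<subseteq> (\<Union>i. R i)" unfolding R(3) using Ak by blast
    qed
    finally show "\<Union>(R ` k ` \<U>) = topspace X" using U by simp
  next
    fix x
    have "V = V'" if V: "V \<in> R ` k ` \<U>" "V' \<in> R ` k ` \<U>" "x \<in> V" "x \<in> V'" for V V'
    proof -
      obtain i j where ij: "V = R i" "V' = R j" using V(1,2) by auto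
      then have "R i \<inter> R j \<noteq> {}" using V(3,4) by auto
      then have "i = j" using R(2) by auto
      then show ?thesis using ij by simp
    qed
    then have "card {V \<in> R ` k ` \<U>. x \<in> V} \<le> Suc 0"
      using U by (subst card_le_Suc0_iff_eq) auto
    then show "card {V \<in> R ` k ` \<U>. x \<in> V} \<le> 0 + 1" by simp
  qed
qed

text \<open>Stone's construction for the cover by balls; dimension zero allows one to shrink the
  resulting discrete families to clopen sets and to disjointify them.\<close>

lemma (in Metric_space) open_partition_of_mesh:
  assumes dim: "covering_dim_le mtopology 0" and r: "r > 0"
  shows "\<exists>p :: 'a \<Rightarrow> nat \<times> 'a. (\<forall>v. openin mtopology {y \<in> M. p y = v}) \<and>
    (\<forall>x\<in>M. \<forall>y\<in>M. p x = p y \<longrightarrow> d x y < r)"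
proof -
  define R where "R = |UNIV :: 'a set|"
  have "well_order_on UNIV R" unfolding R_def by (rule card_of_well_order_on)
  then have wf: "wf (R - Id)" and tot: "total_on UNIV R"
    by (auto simp: well_order_on_def linear_order_on_def)
  define lt where "lt s t \<longleftrightarrow> (s, t) \<in> R - Id" for s t
  have lt_total: "s \<noteq> t \<Longrightarrow> lt s t \<or> lt t s" for s t using tot by (auto simp: lt_def total_on_def)
  define \<epsilon> where "\<epsilon> n = 1 / real (Suc n)" for n
  have \<epsilon>0: "\<epsilon> n > 0" for n by (simp add: \<epsilon>_def)
  \<comment> \<open>Half of \<open>r\<close>, so that two points of one ball are closer than
    \<open>r\<close>.\<close>
  define U where "U s = mball s (r / 2)" for s
  \<comment> \<open>Points that lie in \<open>U s\<close> to depth \<open>\<epsilon> n\<close> and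
    in no earlier ball. For fixed \<open>n\<close>, different \<open>s\<close> give sets at distance
    at least \<open>\<epsilon> n\<close>, so their neighbourhoods \<open>W n s\<close> of radius
    \<open>\<epsilon> n / 3\<close> are disjoint and together contain the closure of the
    union.\<close>
  define F where "F n s = {x\<in>M. mball x (\<epsilon> n) \<subseteq> U s \<and> (\<forall>t. lt t s \<longrightarrow> x \<notin> U t)}" for n s
  define W where "W n s = (\<Union>y\<in>F n s. mball y (\<epsilon> n / 3))" for n s
  have WU: "W n s \<subseteq> U s" for n s
  proof
    fix x assume "x \<in> W n s"
    then obtain y where "y \<in> F n s" "x \<in> mball y (\<epsilon> n / 3)" by (auto simp: W_def)
    moreover from this have "x \<in> mball y (\<epsilon> n)" using \<epsilon>0[of n] by (auto simp: in_mball)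
    ultimately show "x \<in> U s" by (auto simp: F_def)
  qed
  have W_open: "openin mtopology (W n s)" for n s unfolding W_def by auto
  have far: "\<epsilon> n \<le> d x y" if "x \<in> F n s" "y \<in> F n t" "lt s t" for n s t x y
  proof (rule ccontr)
    assume "\<not> \<epsilon> n \<le> d x y"
    then have "y \<in> mball x (\<epsilon> n)" using that by (auto simp: in_mball F_def)
    then have "y \<in> U s" using that(1) by (auto simp: F_def)
    then show False using that(2,3) by (auto simp: F_def)
  qed
  have W_disj: "s = t" if xs: "x \<in> W n s" and xt: "x \<in> W n t" for x n s t
  proof (rule ccontr)
    assume "s \<noteq> t"
    obtain y where y: "y \<in> F n s" "x \<in> mball y (\<epsilon> n / 3)" using xs by (auto simp: W_def)
    obtain z where z: "z \<in> F n t" "x \<in> mball z (\<epsilon> n / 3)" using xt by (auto simp: W_def)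
    have "d y z \<le> d y x + d x z" using y z by (intro triangle) (auto simp: F_def in_mball)
    then have "d y z < \<epsilon> n" using y(2) z(2) \<epsilon>0[of n] commute[of z x] by (auto simp: in_mball)
    then show False using lt_total[OF \<open>s \<noteq> t\<close>] far[OF y(1) z(1)] far[OF z(1) y(1)] commute[of y z] by auto
  qed
  have "\<exists>C. openin mtopology C \<and> closedin mtopology C \<and> (\<Union>s. F n s) \<subseteq> C \<and> C \<subseteq> (\<Union>s. W n s)" for n
  proof -
    let ?F = "mtopology closure_of (\<Union>s. F n s)"
    have "?F \<subseteq> (\<Union>s. W n s)"
    proof
      fix x assume "x \<in> ?F"
      then have x: "x \<in> M" and near: "\<And>r. r > 0 \<Longrightarrow> \<exists>y\<in>(\<Union>s. F n s). y \<in> mball x r"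
        unfolding metric_closure_of by auto
      obtain y where y: "y \<in> (\<Union>s. F n s)" "y \<in> mball x (\<epsilon> n / 3)"
        using near[of "\<epsilon> n / 3"] \<epsilon>0[of n] by auto
      then show "x \<in> (\<Union>s. W n s)" using commute[of x y] by (auto simp: W_def in_mball)
    qed
    moreover have "(\<Union>s. F n s) \<subseteq> ?F" by (rule closure_of_subset) (auto simp: F_def)
    moreover have "openin mtopology (\<Union>s. W n s)" using W_open by auto
    ultimately have "\<exists>C. openin mtopology C \<and> closedin mtopology C \<and> ?F \<subseteq> C \<and> C \<subseteq> (\<Union>s. W n s)"
      by (intro covering_dim_le_0_clopen[OF dim closedin_closure_of])
    then obtain C where "openin mtopology C" "closedin mtopology C" "?F \<subseteq> C" "C \<subseteq> (\<Union>s. W n s)"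
      by (elim exE conjE) (rule that)
    then show ?thesis using \<open>(\<Union>s. F n s) \<subseteq> ?F\<close> by (intro exI[of _ C]) auto
  qed
  then have "\<forall>n. \<exists>C. openin mtopology C \<and> closedin mtopology C \<and> (\<Union>s. F n s) \<subseteq> C \<and> C \<subseteq> (\<Union>s. W n s)" ..
  from choice[OF this] obtain C where C: "\<forall>n. openin mtopology (C n) \<and> closedin mtopology (C n) \<and>
      (\<Union>s. F n s) \<subseteq> C n \<and> C n \<subseteq> (\<Union>s. W n s)" ..
  have cover: "\<exists>n. x \<in> C n" if x: "x \<in> M" for x
  proof -
    have "x \<in> {s. x \<in> U s}" using x r by (simp add: U_def)
    then obtain s where "s \<in> {s. x \<in> U s}" "\<And>t. (t, s) \<in> R - Id \<Longrightarrow> t \<notin> {s. x \<in> U s}"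
      by (rule wfE_min[OF wf]) auto
    then have s: "x \<in> U s" "\<And>t. lt t s \<Longrightarrow> x \<notin> U t" unfolding lt_def by auto
    have "openin mtopology (U s)" by (simp add: U_def)
    then obtain e where e: "e > 0" "mball x e \<subseteq> U s" using s(1) unfolding openin_mtopology by blast
    obtain n where "\<epsilon> n < e" using nat_approx_posE[OF e(1)] unfolding \<epsilon>_def by blast
    then have "mball x (\<epsilon> n) \<subseteq> U s" using e(2) mball_subset_concentric[of "\<epsilon> n" e x] by simp
    then have "x \<in> F n s" using x s(2) by (simp add: F_def)
    then have "x \<in> C n" using C by blast
    then show ?thesis ..
  qed
  \<comment> \<open>The cell of \<open>x\<close> is given by the first \<open>C n\<close> containing
    \<open>x\<close> and the unique \<open>W n s\<close> containing it. Cells are open because the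
    finitely many earlier \<open>C m\<close> that are removed are closed.\<close>
  define N where "N x = (LEAST n. x \<in> C n)" for x
  have N: "x \<in> C (N x)" if "x \<in> M" for x unfolding N_def by (rule LeastI_ex[OF cover[OF that]])
  have N_iff: "N x = n \<longleftrightarrow> x \<in> C n \<and> (\<forall>m<n. x \<notin> C m)" if "x \<in> M" for x n
  proof
    assume n: "N x = n"
    have "x \<notin> C m" if "m < n" for m
      using that unfolding n[symmetric] N_def by (rule not_less_Least)
    then show "x \<in> C n \<and> (\<forall>m<n. x \<notin> C m)" using N[OF \<open>x \<in> M\<close>] n by simp
  next
    assume "x \<in> C n \<and> (\<forall>m<n. x \<notin> C m)"
    then show "N x = n" unfolding N_def by (intro Least_equality) (auto simp flip: not_less)
  qed
  define S where "S x = (THE s. x \<in> W (N x) s)" for x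
  have S_iff: "S x = s \<longleftrightarrow> x \<in> W (N x) s" if "x \<in> M" for x s
  proof -
    have "x \<in> (\<Union>s. W (N x) s)" using N[OF that] C by blast
    then obtain s0 where s0: "x \<in> W (N x) s0" by blast
    then have "S x = s0" unfolding S_def by (rule the_equality) (rule W_disj[OF _ s0])
    then show ?thesis using s0 W_disj by blast
  qed
  have "openin mtopology {y \<in> M. (N y, S y) = v}" for v
  proof -
    obtain n s where v: "v = (n, s)" by (cases v)
    have "{y \<in> M. (N y, S y) = v} = (C n - (\<Union>m<n. C m)) \<inter> W n s"
    proof -
      have "C n \<subseteq> M" using C closedin_subset by fastforce
      moreover have "N y = n \<and> S y = s \<longleftrightarrow> y \<in> C n \<and> (\<forall>m<n. y \<notin> C m) \<and> y \<in> W n s" if "y \<in> M" for y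
        using N_iff[OF that, of n] S_iff[OF that, of s] by auto
      ultimately show ?thesis unfolding v by auto
    qed
    moreover have "closedin mtopology (\<Union>m<n. C m)" using C by (intro closedin_Union) auto
    ultimately show ?thesis using C W_open by (auto intro!: openin_Int openin_diff)
  qed
  moreover have "d x y < r" if xy: "x \<in> M" "y \<in> M" "(N x, S x) = (N y, S y)" for x y
  proof -
    have "x \<in> U (S x)" "y \<in> U (S x)" using xy S_iff[OF xy(1), of "S x"] S_iff[OF xy(2), of "S y"] WU by auto
    then have "d x y \<le> d x (S x) + d (S x) y" "d (S x) x < r / 2" "d (S x) y < r / 2"
      using xy by (auto simp: U_def in_mball intro: triangle)
    then show ?thesis using commute[of x "S x"] by simp
  qed
  ultimately show ?thesis by (intro exI[of _ "\<lambda>x. (N x, S x)"]) blast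
qed

context lambda_cardinal
begin

text \<open>There are countably many partitions but \<lambda> many indices, so an index is
  translated into a finite number of partitions. Agreement on finitely many partitions is an open
  condition.\<close>

lemma covering_dim_le_0_filtration:
  fixes \<rho> :: "'l \<Rightarrow> real"
  assumes X: "metrizable_space X" and dim: "covering_dim_le X 0" and \<rho>: "radius \<rho>"
  shows "\<exists>E. filtration E X \<and> (\<forall>x\<in>topspace X. \<forall>y\<in>topspace X. x \<noteq> y \<longrightarrow> (\<exists>a. \<not> E a x y))"
proof -
  obtain M d where Md: "Metric_space M d" and Xeq: "X = Metric_space.mtopology M d"
    using X unfolding metrizable_space_def by blast
  interpret Metric_space M d by fact
  have \<rho>0: "0 < \<rho> a" and \<rho>m: "a \<sqsubseteq> b \<Longrightarrow> \<rho> b \<le> \<rho> a" and \<rho>c: "0 < e \<Longrightarrow> \<exists>a. \<rho> a < e" for a b e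
    using \<rho> by (auto simp: radius_def)
  have "\<forall>n. \<exists>p :: 'a \<Rightarrow> nat \<times> 'a. (\<forall>v. openin mtopology {y \<in> M. p y = v}) \<and>
      (\<forall>x\<in>M. \<forall>y\<in>M. p x = p y \<longrightarrow> d x y < 1 / real (Suc n))"
    using dim unfolding Xeq by (intro allI open_partition_of_mesh) auto
  from choice[OF this] obtain p :: "nat \<Rightarrow> 'a \<Rightarrow> nat \<times> 'a"
    where p: "\<forall>n. (\<forall>v. openin mtopology {y \<in> M. p n y = v}) \<and>
      (\<forall>x\<in>M. \<forall>y\<in>M. p n x = p n y \<longrightarrow> d x y < 1 / real (Suc n))" ..
  have p_open: "openin mtopology {y \<in> M. p n y = v}" for n v using p by blast
  \<comment> \<open>Large enough that \<open>1 / (ix a + 1)\<close> is at most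
    \<open>\<rho> a\<close>.\<close>
  define ix where "ix a = nat \<lceil>1 / \<rho> a\<rceil>" for a
  have ix_mono: "ix a \<le> ix b" if "a \<sqsubseteq> b" for a b
    unfolding ix_def using \<rho>m[OF that] \<rho>0[of b] by (intro nat_mono ceiling_mono divide_left_mono) auto
  define E where "E a x y \<longleftrightarrow> (\<forall>m\<le>ix a. p m x = p m y)" for a x y
  have E_dist: "d x y < \<rho> a" if "x \<in> M" "y \<in> M" "E a x y" for a x y
  proof -
    have "d x y < 1 / real (Suc (ix a))" using p that by (auto simp: E_def)
    also have "\<dots> \<le> 1 / (1 / \<rho> a)"
    proof (rule divide_left_mono)
      show "1 / \<rho> a \<le> real (Suc (ix a))" unfolding ix_def by (simp add: le_nat_iff) linarith
    qed (use \<rho>0[of a] in auto)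
    finally show ?thesis by simp
  qed
  have class_open: "openin mtopology {y \<in> M. E a x y}" for a x
  proof -
    have "openin mtopology (\<Inter>m\<in>{..ix a}. {y \<in> M. p m y = p m x})"
      by (intro openin_INT2 p_open) auto
    moreover have "(\<Inter>m\<in>{..ix a}. {y \<in> M. p m y = p m x}) = {y \<in> M. E a x y}"
      by (auto simp: E_def)
    ultimately show ?thesis by simp
  qed
  have op: "openin mtopology U \<longleftrightarrow> U \<subseteq> M \<and> (\<forall>x\<in>U. \<exists>a. \<forall>y\<in>M. E a x y \<longrightarrow> y \<in> U)" for U
  proof
    assume U: "openin mtopology U"
    have "\<exists>a. \<forall>y\<in>M. E a x y \<longrightarrow> y \<in> U" if x: "x \<in> U" for x
    proof -
      obtain e where e: "e > 0" "mball x e \<subseteq> U" using U x unfolding openin_mtopology by blast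
      obtain a where a: "\<rho> a < e" using \<rho>c[OF e(1)] by blast
      have xM: "x \<in> M" using x openin_subset[OF U] by auto
      have "y \<in> U" if "y \<in> M" "E a x y" for y
        using E_dist[OF xM that] a e(2) xM that(1) by (auto simp: in_mball)
      then show ?thesis by blast
    qed
    then show "U \<subseteq> M \<and> (\<forall>x\<in>U. \<exists>a. \<forall>y\<in>M. E a x y \<longrightarrow> y \<in> U)" using openin_subset[OF U] by simp
  next
    assume U: "U \<subseteq> M \<and> (\<forall>x\<in>U. \<exists>a. \<forall>y\<in>M. E a x y \<longrightarrow> y \<in> U)"
    show "openin mtopology U"
    proof (subst openin_subopen, intro ballI)
      fix x assume x: "x \<in> U"
      then obtain a where a: "\<forall>y\<in>M. E a x y \<longrightarrow> y \<in> U" using U by blast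
      show "\<exists>T. openin mtopology T \<and> x \<in> T \<and> T \<subseteq> U"
        using class_open a x U by (intro exI[of _ "{y \<in> M. E a x y}"]) (auto simp: E_def)
    qed
  qed
  have "filtration E X"
    unfolding filtration_def Xeq topspace_mtopology
  proof (intro conjI)
    show "\<forall>a b. a \<sqsubseteq> b \<longrightarrow> (\<forall>x\<in>M. \<forall>y\<in>M. E b x y \<longrightarrow> E a x y)"
      using ix_mono order_trans unfolding E_def by blast
    show "\<forall>U. openin mtopology U \<longleftrightarrow> U \<subseteq> M \<and> (\<forall>x\<in>U. \<exists>a. \<forall>y\<in>M. E a x y \<longrightarrow> y \<in> U)"
      using op by (intro allI)
  qed (auto simp: E_def)
  moreover have "\<exists>a. \<not> E a x y" if xy: "x \<in> M" "y \<in> M" "x \<noteq> y" for x y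
  proof -
    have "0 < d x y" using xy mdist_pos_less by blast
    then obtain a where "\<rho> a < d x y" using \<rho>c by blast
    then show ?thesis using E_dist[OF xy(1,2), of a] by auto
  qed
  ultimately show ?thesis by (intro exI[of _ E]) (simp add: Xeq)
qed

lemma ultrametrizable_filtration:
  assumes cof: "cof lam =o natLeq" and X: "ultrametrizable_space X"
  shows "\<exists>E. filtration E X"
proof -
  obtain M d where Md: "Metric_space M d" and ultra: "\<forall>x\<in>M. \<forall>y\<in>M. \<forall>z\<in>M. d x z \<le> max (d x y) (d y z)"
    and Xeq: "X = Metric_space.mtopology M d"
    using X unfolding ultrametrizable_space_def by blast
  interpret Metric_space M d by fact
  obtain \<rho> :: "'l \<Rightarrow> real" where "radius \<rho>" using ex_radius_real[OF cof] ..
  then have "filtration (\<lambda>a x y. d x y < \<rho> a) X"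
    using G_metrized_mtopology[OF Md] ultra unfolding Xeq by (intro ultrametric_filtration) auto
  then show ?thesis by blast
qed

text \<open>Dimension zero gives clopen partitions of every mesh, hence a filtration and an
  ultrametric. In the other direction a filtration gives reduction of open sets, and this gives
  dimension zero.\<close>

lemma ultrametrizable_iff_dim_0:
  assumes cof: "cof lam =o natLeq"
  shows "{X \<in> M_class lam TYPE('g::linordered_field). covering_dim X = 0} =
    {X. ultrametrizable_space X \<and> weight X \<le>o lam}"
proof (intro equalityI subsetI)
  fix X :: "'a topology" assume "X \<in> {X \<in> M_class lam TYPE('g). covering_dim X = 0}"
  then have X: "metrizable_space X" "weight X \<le>o lam" "covering_dim_le X 0"
    using cof by (auto simp: M_class_def mu_metrizable_space_def covering_dim_eq_0_iff)
  obtain \<rho> :: "'l \<Rightarrow> real" where \<rho>: "radius \<rho>" using ex_radius_real[OF cof] ..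
  from covering_dim_le_0_filtration[OF X(1,3) \<rho>] obtain E where E: "filtration E X"
    and sep: "\<forall>x\<in>topspace X. \<forall>y\<in>topspace X. x \<noteq> y \<longrightarrow> (\<exists>a. \<not> E a x y)"
    by (elim exE conjE) (rule that)
  have "\<exists>d :: 'a \<Rightarrow> 'a \<Rightarrow> real. G_metrized d X \<and>
      (\<forall>x\<in>topspace X. \<forall>y\<in>topspace X. \<forall>z\<in>topspace X. d x z \<le> max (d x y) (d y z))"
    by (rule filtration_ultrametric[OF E \<rho>]) (use sep in blast)
  then have "ultrametrizable_space X" using ultrametrizable_spaceI by metis
  then show "X \<in> {X. ultrametrizable_space X \<and> weight X \<le>o lam}" using X(2) by simp
next
  fix X :: "'a topology" assume "X \<in> {X. ultrametrizable_space X \<and> weight X \<le>o lam}"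
  then have X: "ultrametrizable_space X" "weight X \<le>o lam" by auto
  have met: "metrizable_space X" by (rule ultrametrizable_imp_metrizable_space[OF X(1)])
  obtain E where "filtration E X" using ultrametrizable_filtration[OF cof X(1)] ..
  then have "covering_dim_le X 0"
    by (intro Sigma0_reduction_one_imp_covering_dim_le_0[OF infinite_UNIV] filtration_reduction)
  then show "X \<in> {X \<in> M_class lam TYPE('g). covering_dim X = 0}"
    using met X(2) cof
    by (simp add: M_class_def mu_metrizable_space_def covering_dim_eq_0_iff metrizable_imp_regular_space metrizable_imp_Hausdorff_space)
qed

lemma cof_not_natLeq: "\<not> cof lam =o natLeq \<longleftrightarrow> natLeq <o cof lam"
  using cof_cases not_ordLess_ordIso ordIso_symmetric by blast

lemma M_class_uniform_Fsigma:
  assumes coin: "natLeq <o cof lam \<longrightarrow> pos_coinitiality TYPE('g::linordered_field) =o cof lam"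
    and X: "X \<in> M_class lam TYPE('g)"
  shows "uniform_Fsigma X"
proof (cases "cof lam =o natLeq")
  case True
  then have "metrizable_space X" using X by (simp add: M_class_def mu_metrizable_space_def)
  then obtain M d where "Metric_space M d" "X = Metric_space.mtopology M d"
    unfolding metrizable_space_def by blast
  then have "G_metrized d X" using G_metrized_mtopology by blast
  moreover obtain \<rho> :: "'l \<Rightarrow> real" where "radius \<rho>" using ex_radius_real[OF True] ..
  ultimately show ?thesis by (rule G_metrized_uniform_Fsigma)
next
  case False
  then have "G_metrizable_space TYPE('g) X" using X by (simp add: M_class_def mu_metrizable_space_def)
  then obtain d :: "_ \<Rightarrow> _ \<Rightarrow> 'g" where "G_metrized d X" unfolding G_metrizable_space_iff ..
  moreover obtain \<rho> :: "'l \<Rightarrow> 'g" where "radius \<rho>"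
    using ex_radius coin False unfolding cof_not_natLeq by blast
  ultimately show ?thesis by (rule G_metrized_uniform_Fsigma)
qed

lemma M_class_filtration:
  assumes coin: "pos_coinitiality TYPE('g::linordered_field) =o cof lam" and unc: "natLeq <o cof lam"
    and X: "X \<in> M_class lam TYPE('g)"
  shows "\<exists>E. filtration E X"
proof -
  have "G_metrizable_space TYPE('g) X"
    using X unc cof_not_natLeq by (simp add: M_class_def mu_metrizable_space_def)
  then obtain d :: "_ \<Rightarrow> _ \<Rightarrow> 'g" where d: "G_metrized d X" unfolding G_metrizable_space_iff ..
  obtain \<rho> :: "'l \<Rightarrow> 'g" where \<rho>: "radius \<rho>" using ex_radius[OF coin] ..
  have "natLeq <o pos_coinitiality TYPE('g)"
    using unc ordIso_symmetric[OF coin] by (rule ordLess_ordIso_trans)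
  from G_metrized_filtration[OF d \<rho> this] show ?thesis by blast
qed

text \<open>The tree space and its copies enter the class this way; their ultrametric takes values
  in the reals or in \<open>'g\<close> according to \<open>cof lam\<close>.\<close>

lemma filtration_in_M_class:
  fixes X :: "'a topology"
  assumes coin: "natLeq <o cof lam \<longrightarrow> pos_coinitiality TYPE('g::linordered_field) =o cof lam"
    and E: "filtration E X"
    and sep: "\<And>x y. x \<in> topspace X \<Longrightarrow> y \<in> topspace X \<Longrightarrow> x \<noteq> y \<Longrightarrow> \<exists>a. \<not> E a x y"
    and w: "weight X \<le>o lam"
  shows "X \<in> M_class lam TYPE('g) \<and> (cof lam =o natLeq \<longrightarrow> ultrametrizable_space X)"
proof (cases "cof lam =o natLeq")
  case True
  obtain \<rho> :: "'l \<Rightarrow> real" where \<rho>: "radius \<rho>" using ex_radius_real[OF True] ..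
  have "\<exists>d :: 'a \<Rightarrow> 'a \<Rightarrow> real. G_metrized d X \<and>
      (\<forall>x\<in>topspace X. \<forall>y\<in>topspace X. \<forall>z\<in>topspace X. d x z \<le> max (d x y) (d y z))"
    by (rule filtration_ultrametric[OF E \<rho> sep])
  then have "ultrametrizable_space X" using ultrametrizable_spaceI by metis
  then show ?thesis
    using True w filtration_regular_Hausdorff[OF E sep] ultrametrizable_imp_metrizable_space
    by (simp add: M_class_def mu_metrizable_space_def)
next
  case False
  then have unc: "natLeq <o cof lam" by (simp add: cof_not_natLeq)
  obtain \<rho> :: "'l \<Rightarrow> 'g" where \<rho>: "radius \<rho>" using ex_radius coin unc by blast
  have "\<exists>d :: 'a \<Rightarrow> 'a \<Rightarrow> 'g. G_metrized d X \<and>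
      (\<forall>x\<in>topspace X. \<forall>y\<in>topspace X. \<forall>z\<in>topspace X. d x z \<le> max (d x y) (d y z))"
    by (rule filtration_ultrametric[OF E \<rho> sep])
  then have "G_metrizable_space TYPE('g) X" unfolding G_metrizable_space_iff by blast
  then show ?thesis
    using False w filtration_regular_Hausdorff[OF E sep]
    by (simp add: M_class_def mu_metrizable_space_def)
qed

text \<open>The properties speak of spaces on \<open>'u\<close>, while the tree space lives on its
  own type. The size of \<open>'u\<close> leaves room for a homeomorphic copy, to which the
  filtration is carried over.\<close>

lemma ex_tree_space_copy:
  assumes coin: "natLeq <o cof lam \<longrightarrow> pos_coinitiality TYPE('g::linordered_field) =o cof lam"
    and big: "|UNIV :: 'l set set| \<le>o |UNIV :: 'u set|"
  shows "\<exists>Y :: 'u topology. tree_space homeomorphic_space Y \<and> Y \<in> M_class lam TYPE('g) \<and>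
    (cof lam =o natLeq \<longrightarrow> ultrametrizable_space Y)"
proof -
  have "tree_space \<in> M_class lam TYPE('g)"
    using filtration_in_M_class[OF coin filtration_tree_space tree_space_separated weight_tree_space] by blast
  then obtain Y :: "'u topology" where Y: "tree_space homeomorphic_space Y"
    using M_class_representable[OF card_order_lam _ big] by blast
  then obtain f g where fg: "homeomorphic_maps tree_space Y f g" unfolding homeomorphic_space_def by blast
  have w: "weight Y \<le>o lam" using weight_homeomorphic[OF Y] weight_tree_space by (rule ordLeq_transitive)
  have "\<exists>a. \<not> g x \<inter> nodes a = g y \<inter> nodes a" if "x \<in> topspace Y" "y \<in> topspace Y" "x \<noteq> y" for x y
  proof -
    have "g x \<noteq> g y" using fg that unfolding homeomorphic_maps_def by metis
    then show ?thesis by (rule tree_space_separated)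
  qed
  with filtration_in_M_class[OF coin filtration_homeomorphic[OF fg filtration_tree_space] _ w] Y
  show ?thesis by blast
qed

lemma inseparable_pair_transfer:
  fixes \<xi> :: "'l succ_ord"
  assumes "tree_space homeomorphic_space Y" and "1 \<le> \<xi>" and "Sigma0_reduction \<xi> tree_space"
  shows "Sigma0_inseparable_pair \<xi> Y"
  using Sigma0_inseparable_pair_homeomorphic[OF assms(1) tree_space_inseparable_pair[OF assms(2,3)]] .

lemma Sigma0_Pi0_properties:
  fixes \<xi> :: "'l succ_ord" and \<C> :: "'u topology set"
  assumes "reduction_property TYPE('l) \<C> (Sigma0 \<xi>)" and "Y \<in> \<C>" and "Sigma0_inseparable_pair \<xi> Y"
  shows "ordinal_uniformization_property \<C> (Sigma0 \<xi> :: ('u \<times> 'l) pointclass) \<and>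
      reduction_property TYPE('l) \<C> (Sigma0 \<xi>) \<and>
      \<not> separation_property TYPE('l) \<C> (Sigma0 \<xi>) \<and>
      separation_property TYPE('l) \<C> (Pi0 \<xi>) \<and>
      \<not> reduction_property TYPE('l) \<C> (Pi0 \<xi>)"
  using assms ordinal_uniformization_property_Sigma0[OF infinite_UNIV] separation_property_Pi0[OF infinite_UNIV]
    not_separation_property_Sigma0[OF infinite_UNIV] not_reduction_property_Pi0[OF infinite_UNIV]
  by blast

end

theorem theorem3p6:
  fixes lam :: "'l rel"
  assumes "card_order lam" and "natLeq <o lam"
    and "two_pow_less lam =o lam"
    and "natLeq <o cof lam \<longrightarrow> pos_coinitiality TYPE('g::linordered_field) =o cof lam"
    and "|UNIV :: 'l set set| \<le>o |UNIV :: 'u set|"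
  defines "\<M> \<equiv> M_class lam TYPE('g) :: 'u topology set"
  defines "\<M>\<^sub>0 \<equiv> {X \<in> \<M>. covering_dim X = 0}"
  shows "(\<forall>\<xi> :: 'l succ_ord. 1 < \<xi> \<longrightarrow>
      ordinal_uniformization_property \<M> (Sigma0 \<xi> :: ('u \<times> 'l) pointclass) \<and>
      reduction_property TYPE('l) \<M> (Sigma0 \<xi>) \<and>
      \<not> separation_property TYPE('l) \<M> (Sigma0 \<xi>) \<and>
      separation_property TYPE('l) \<M> (Pi0 \<xi>) \<and>
      \<not> reduction_property TYPE('l) \<M> (Pi0 \<xi>)) \<and>
    (natLeq <o cof lam \<longrightarrow>
      ordinal_uniformization_property \<M> (Sigma0 (1 :: 'l succ_ord) :: ('u \<times> 'l) pointclass) \<and>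
      reduction_property TYPE('l) \<M> (Sigma0 (1 :: 'l succ_ord)) \<and>
      \<not> separation_property TYPE('l) \<M> (Sigma0 (1 :: 'l succ_ord)) \<and>
      separation_property TYPE('l) \<M> (Pi0 (1 :: 'l succ_ord)) \<and>
      \<not> reduction_property TYPE('l) \<M> (Pi0 (1 :: 'l succ_ord))) \<and>
    (cof lam =o natLeq \<longrightarrow>
      \<M>\<^sub>0 = {X. ultrametrizable_space X \<and> weight X \<le>o lam} \<and>
      ordinal_uniformization_property \<M>\<^sub>0 (Sigma0 (1 :: 'l succ_ord) :: ('u \<times> 'l) pointclass) \<and>
      reduction_property TYPE('l) \<M>\<^sub>0 (Sigma0 (1 :: 'l succ_ord)) \<and>
      \<not> separation_property TYPE('l) \<M>\<^sub>0 (Sigma0 (1 :: 'l succ_ord)) \<and>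
      separation_property TYPE('l) \<M>\<^sub>0 (Pi0 (1 :: 'l succ_ord)) \<and>
      \<not> reduction_property TYPE('l) \<M>\<^sub>0 (Pi0 (1 :: 'l succ_ord)))"
proof -
  interpret lambda_cardinal lam using assms(1-3) by unfold_locales
  note coin = assms(4)
  from ex_tree_space_copy[OF coin assms(5)] obtain Y :: "'u topology"
    where Y: "tree_space homeomorphic_space Y" and YM': "Y \<in> M_class lam TYPE('g)"
      and Yu: "cof lam =o natLeq \<longrightarrow> ultrametrizable_space Y"
    by (elim exE conjE) (rule that)
  have YM: "Y \<in> \<M>" unfolding \<M>_def by (rule YM')
  \<comment> \<open>Reduction on the tree space itself yields the inseparable pair, which is then
    moved to \<open>Y\<close>; above level 1 this takes the tree space as a member of the class over
    its own type.\<close>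
  have tree_M: "tree_space \<in> M_class lam TYPE('g)"
    using filtration_in_M_class[OF coin filtration_tree_space tree_space_separated weight_tree_space] by blast
  have one: "Sigma0_inseparable_pair (1 :: 'l succ_ord) Y"
    by (rule inseparable_pair_transfer[OF Y order_refl filtration_reduction[OF filtration_tree_space]])
  show ?thesis
  proof (rule conjI, intro allI impI, goal_cases)
    case (1 \<xi>)
    have "reduction_property TYPE('l) \<M> (Sigma0 \<xi>)"
      unfolding reduction_property_Sigma0 \<M>_def
      using Sigma0_reduction_gt_1[OF M_class_uniform_Fsigma[OF coin] 1] by blast
    moreover have "Sigma0_inseparable_pair \<xi> Y"
      by (rule inseparable_pair_transfer[OF Y less_imp_le[OF 1]
        Sigma0_reduction_gt_1[OF M_class_uniform_Fsigma[OF coin tree_M] 1]])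
    ultimately show ?case by (rule Sigma0_Pi0_properties[OF _ YM])
  next
    case 2
    show ?case
    proof (rule conjI, rule impI, goal_cases)
      case 1
      have "reduction_property TYPE('l) \<M> (Sigma0 (1 :: 'l succ_ord))"
        unfolding reduction_property_Sigma0
      proof
        fix X assume X: "X \<in> \<M>"
        obtain E where "filtration E X" using M_class_filtration[OF mp[OF coin 1] 1 X[unfolded \<M>_def]] ..
        then show "Sigma0_reduction (1 :: 'l succ_ord) X" by (rule filtration_reduction)
      qed
      then show ?case by (rule Sigma0_Pi0_properties[OF _ YM one])
    next
      case 2
      show ?case
      proof (rule impI)
        assume cof: "cof lam =o natLeq"
        have eq: "\<M>\<^sub>0 = {X. ultrametrizable_space X \<and> weight X \<le>o lam}"
          unfolding \<M>\<^sub>0_def \<M>_def by (rule ultrametrizable_iff_dim_0[OF cof])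
        have "Y \<in> \<M>\<^sub>0" using YM Yu cof unfolding eq \<M>_def M_class_def by simp
        moreover have "reduction_property TYPE('l) \<M>\<^sub>0 (Sigma0 (1 :: 'l succ_ord))"
          unfolding reduction_property_Sigma0
        proof
          fix X assume "X \<in> \<M>\<^sub>0"
          then have "ultrametrizable_space X" unfolding eq by simp
          then obtain E where "filtration E X" using ultrametrizable_filtration[OF cof] by blast
          then show "Sigma0_reduction (1 :: 'l succ_ord) X" by (rule filtration_reduction)
        qed
        ultimately show "\<M>\<^sub>0 = {X. ultrametrizable_space X \<and> weight X \<le>o lam} \<and>
          ordinal_uniformization_property \<M>\<^sub>0 (Sigma0 (1 :: 'l succ_ord) :: ('u \<times> 'l) pointclass) \<and>
          reduction_property TYPE('l) \<M>\<^sub>0 (Sigma0 (1 :: 'l succ_ord)) \<and>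
          \<not> separation_property TYPE('l) \<M>\<^sub>0 (Sigma0 (1 :: 'l succ_ord)) \<and>
          separation_property TYPE('l) \<M>\<^sub>0 (Pi0 (1 :: 'l succ_ord)) \<and>
          \<not> reduction_property TYPE('l) \<M>\<^sub>0 (Pi0 (1 :: 'l succ_ord))"
          using eq Sigma0_Pi0_properties[OF _ _ one] by blast
      qed
    qed
  qed
qed

end
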